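(* Let $d\in\mathbb N$, $a\in\{-1,1\}$, and let $\gamma,\alpha\in\mathbb R$ satisfy $\gamma>-\min(2,d)$ and $\alpha>1+\frac{2+\gamma}{d}$. Let $\frac{2+\gamma}{\alpha-1}\le\sigma<d$ and $\Phi_\sigma(x)=\omega(x)|x|^{-\sigma}$, where $\omega\in L^\infty(\mathbb R^d)$ is homogeneous of degree $0$, $\|\omega\|_{L^\infty}$ is sufficiently small and $\omega\not\equiv0$. Let $\varphi\in C(\mathbb R^d)$ satisfy $|\varphi(x)|\le c(1+|x|^2)^{-\sigma/2}$ for all $x\in\mathbb R^d$ with $c$ sufficiently small, and $\varphi(x)=\omega(x)|x|^{-\sigma}$ for $|x|\ge A$, for some constant $A>0$. Let $u$ be the global solution of the Hardy–Hénon equation with initial data $\varphi$. Then: (i) (Nonlinear behavior) If $\sigma=\frac{2+\gamma}{\alpha-1}$, then there exist $C>0$ and $\delta>0$ such that $$\|u(t)-u_{\mathcal S}(t)\|_{L^\infty_{\tilde k}}\le Ct^{-\frac d2(\frac1{q_c(\gamma)}-\frac{\tilde k}d)-\delta}$$ for all $t>0$ and $0\le\tilde k<\min(\frac{2+\gamma}{\alpha-1},\frac{d+\gamma}\alpha)$, where $u_{\mathcal S}$ is the global self-similar solution with initial data $\omega(x)|x|^{-\frac{2+\gamma}{\alpha-1}}$. In particular, there is $\tilde C>0$ such that for $t$ large $$\tilde C^{-1}t^{-\frac d2(\frac1{q_c(\gamma)}-\frac{\tilde k}d)}\le\|u(t)\|_{L^\infty_{\tilde k}}\le\tilde Ct^{-\frac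 d2(\frac1{q_c(\gamma)}-\frac{\tilde k}d)}.$$ (ii) (Linear behavior) If $\sigma>\frac{2+\gamma}{\alpha-1}$, then there exist $C>0$ and $\delta>0$ such that $$\|u(t)-e^{t\Delta}\Phi_\sigma\|_{L^\infty_{\tilde k}}\le Ct^{-\frac d2(\frac\sigma d-\frac{\tilde k}d)-\delta}$$ for all $t>0$ and all $0\le\tilde k<\min(\sigma,\frac{d+\gamma}\alpha)$. In particular, there is $\tilde C>0$ such that for $t$ large $$\tilde C^{-1}t^{-\frac d2(\frac\sigma d-\frac{\tilde k}d)}\le\|u(t)\|_{L^\infty_{\tilde k}}\le\tilde Ct^{-\frac d2(\frac\sigma d-\frac{\tilde k}d)}.$$
   Context: The Hardy–Hénon equation is $\partial_tu-\Delta u=a|x|^\gamma|u|^{\alpha-1}u$; a solution with initial data $\varphi$ means a solution of $u(t)=e^{t\Delta}\varphi+a\int_0^te^{(t-\tau)\Delta}\{|\cdot|^\gamma|u(\tau)|^{\alpha-1}u(\tau)\}\,d\tau$ for all $t>0$, a.e. $x$, with $e^{t\Delta}$ the heat semigroup on $\mathbb R^d$. $\frac1{q_c(\gamma)}=\frac{2+\gamma}{d(\alpha-1)}$ and $\|f\|_{L^\infty_k}=\||\cdot|^kf\|_{L^\infty}$. The global solution is the small one given by the contraction principle: with $\|u\|_{\mathcal K^\infty_k}=\sup_{t>0}t^{\frac12(\frac{2+\gamma}{\alpha-1}-k)}\|u(t)\|_{L^\infty_k}$ and $k\ge0$ with $\frac{2+\gamma\alpha}{\alpha(\alpha-1)}<k<\min(\frac{2+\gamma}{\alpha-1},\frac{d+\gamma}{\alpha})$,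 $k$ close to this upper bound, $u$ is the unique solution in $\{w:\|w\|_{\mathcal K^\infty_k}\le M\}$ for a sufficiently small $M>0$ (the data are assumed so small that it exists). The self-similar solution $u_{\mathcal S}$ is obtained in the same way from the data $\omega(x)|x|^{-\frac{2+\gamma}{\alpha-1}}$; it satisfies $\lambda^{\frac{2+\gamma}{\alpha-1}}u_{\mathcal S}(\lambda^2t,\lambda x)=u_{\mathcal S}(t,x)$ for all $\lambda>0$. *)

theory Defs
  imports "HOL-Probability.Essential_Supremum"
begin

definition heat_kernel :: "real \<Rightarrow> 'a::euclidean_space \<Rightarrow> real" where
  "heat_kernel t z = (4 * pi * t) powr (- real DIM('a) / 2) * exp (- (norm z)\<^sup>2 / (4 * t))"

definition heat_semigroup :: "real \<Rightarrow> ('a::euclidean_space \<Rightarrow> real) \<Rightarrow> 'a \<Rightarrow> real" where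
  "heat_semigroup t f x = (LINT y|lebesgue. heat_kernel t (x - y) * f y)"

definition hardy_henon_nonlinearity ::
    "real \<Rightarrow> real \<Rightarrow> ('a::euclidean_space \<Rightarrow> real) \<Rightarrow> 'a \<Rightarrow> real" where
  "hardy_henon_nonlinearity \<gamma> \<alpha> v x = norm x powr \<gamma> * \<bar>v x\<bar> powr (\<alpha> - 1) * v x"

(* The integrals of the Duhamel formula are required to converge absolutely, because the Bochner
   integral of a non-integrable function is 0 by convention. *)
definition mild_solution ::
    "real \<Rightarrow> real \<Rightarrow> real \<Rightarrow> ('a::euclidean_space \<Rightarrow> real) \<Rightarrow> (real \<Rightarrow> 'a \<Rightarrow> real) \<Rightarrow> bool" where
  "mild_solution a \<gamma> \<alpha> \<phi> u \<longleftrightarrow>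
     (\<forall>t>0. u t \<in> borel_measurable lebesgue) \<and>
     (\<forall>t>0. AE x in lebesgue.
        integrable lebesgue (\<lambda>y. heat_kernel t (x - y) * \<phi> y) \<and>
        (AE \<tau> in lebesgue. 0 < \<tau> \<and> \<tau> < t \<longrightarrow>
           integrable lebesgue
             (\<lambda>y. heat_kernel (t - \<tau>) (x - y) * hardy_henon_nonlinearity \<gamma> \<alpha> (u \<tau>) y)) \<and>
        set_integrable lebesgue {0<..<t}
          (\<lambda>\<tau>. heat_semigroup (t - \<tau>) (hardy_henon_nonlinearity \<gamma> \<alpha> (u \<tau>)) x) \<and>
        u t x = heat_semigroup t \<phi> x +
          a * (LINT \<tau>:{0<..<t}|lebesgue.
                 heat_semigroup (t - \<tau>) (hardy_henon_nonlinearity \<gamma> \<alpha> (u \<tau>)) x))"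

(* At the origin norm x powr k is 0 for every k, k = 0 included; this is a null set. *)
definition Linf_norm :: "real \<Rightarrow> ('a::euclidean_space \<Rightarrow> real) \<Rightarrow> ennreal" where
  "Linf_norm k f = esssup lebesgue (\<lambda>x. ennreal (norm x powr k * \<bar>f x\<bar>))"

definition K_norm ::
    "real \<Rightarrow> real \<Rightarrow> real \<Rightarrow> (real \<Rightarrow> 'a::euclidean_space \<Rightarrow> real) \<Rightarrow> ennreal" where
  "K_norm \<gamma> \<alpha> k u =
     (SUP t\<in>{0<..}. ennreal (t powr (1/2 * ((2 + \<gamma>) / (\<alpha> - 1) - k))) * Linf_norm k (u t))"

(* Uniqueness is that of functions of t with values in classes of functions of x modulo
   equality almost everywhere. *)
definition global_solution ::
    "real \<Rightarrow> real \<Rightarrow> real \<Rightarrow> real \<Rightarrow> real \<Rightarrow> ('a::euclidean_space \<Rightarrow> real) \<Rightarrow>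
     (real \<Rightarrow> 'a \<Rightarrow> real) \<Rightarrow> bool" where
  "global_solution a \<gamma> \<alpha> k M \<phi> u \<longleftrightarrow>
     mild_solution a \<gamma> \<alpha> \<phi> u \<and> K_norm \<gamma> \<alpha> k u \<le> ennreal M \<and>
     (\<forall>v. mild_solution a \<gamma> \<alpha> \<phi> v \<and> K_norm \<gamma> \<alpha> k v \<le> ennreal M \<longrightarrow>
        (\<forall>t>0. AE x in lebesgue. v t x = u t x))"

definition critical_exponent :: "nat \<Rightarrow> real \<Rightarrow> real \<Rightarrow> real" where
  "critical_exponent d \<gamma> \<alpha> = real d * (\<alpha> - 1) / (2 + \<gamma>)"

(* Homogeneity is stated almost everywhere, since it is used for elements of L-infinity. *)
definition homogeneous_deg0 :: "('a::euclidean_space \<Rightarrow> real) \<Rightarrow> bool" where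
  "homogeneous_deg0 \<omega> \<longleftrightarrow> (\<forall>r>0. AE x in lebesgue. \<omega> (r *\<^sub>R x) = \<omega> x)"

definition homogeneous_data ::
    "('a::euclidean_space \<Rightarrow> real) \<Rightarrow> real \<Rightarrow> 'a \<Rightarrow> real" where
  "homogeneous_data \<omega> \<sigma> x = \<omega> x * norm x powr (- \<sigma>)"

end

theory Submission
  imports Defs "HOL-Probability.Probability"
begin

text \<open>
  Write \<open>s = (2 + \<gamma>) / (\<alpha> - 1)\<close> and \<open>p = k (\<alpha> - 1) - \<gamma>\<close>, so that \<open>0 < p < 2\<close>. If \<open>u\<close> lies in the small ball
  of the space \<open>K\<^sub>k\<close>, the potential \<open>V = norm x powr \<gamma> * \<bar>u\<bar> powr (\<alpha> - 1)\<close> is bounded by a small multiple of the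
  scale-invariant weight \<open>t powr (-(2 - p) / 2) * norm x powr (-p)\<close>. Thus \<open>u\<close>, and likewise the difference of two
  solutions, solves a linear integral equation with a small scale-invariant potential, and it inherits the decay
  rate \<open>t powr (-(r - l) / 2) * norm x powr (-l)\<close> of its free part for every \<open>r < d\<close> (first for one weight, then for
  all weights \<open>0 \<le> l \<le> r\<close>). The data \<open>\<phi>\<close> and \<open>\<Phi>\<^sub>\<sigma>\<close> agree outside a ball, so their difference is bounded by
  \<open>norm x powr (-r)\<close> with some \<open>r > \<sigma>\<close>, which is the gain \<open>\<delta>\<close>; in the linear regime the decay of \<open>V\<close> gives a further
  gain in the Duhamel term. The lower bounds follow from the self-similarity of the limit (for \<open>u\<^sub>S\<close> by uniqueness),
  together with the injectivity of the heat semigroup, which shows that the limit does not vanish.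
\<close>

section \<open>The heat semigroup on weighted spaces\<close>

text \<open>The three bounds on k are the integrability conditions of one Duhamel integral.
  Potential times solution is a source of size
  \<open>t powr (-(s + 2 - q) / 2) * norm x powr (-q)\<close> with q = k + p. It is locally
  integrable at the origin if k + p < d, which is k < (d + \<gamma>) / \<alpha>; it is integrable at
  time 0 if s < k + p, which is the lower bound on k; and the passage back from weight k + p to
  weight k is integrable at the final time if p < 2, which is k < s. For another rate r in place of
  s the potential is kept and the solution is measured with another weight k' that satisfies the
  same conditions. The obstacle is that the integral equation holds for almost every x with an
  exceptional set depending on t, and that no joint measurability in time and space is given. Hence
  every estimate is made at a fixed t for almost every x, and time integrals are compared with
  explicit majorants. A single solution is treated as its difference from the zero solution, so that
  one estimate yields both the upper bounds on u and the bound on u - u_S.\<close>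

lemma nn_integral_ball_powr:
  fixes q :: real
  assumes q: "0 \<le> q" "q < DIM('a::euclidean_space)"
  obtains c where "c \<ge> 0" and
    "\<And>R. R > 0 \<Longrightarrow> (\<integral>\<^sup>+y. ennreal (norm (y::'a) powr (-q)) * indicator (ball 0 R) y \<partial>lborel)
        \<le> ennreal (c * R powr (DIM('a) - q))"
proof -
  define v where "v = measure lborel (ball (0::'a) 1)"
  define e where "e = DIM('a) - q"
  \<comment> \<open>A sum over dyadic shells: v is the volume of the unit ball,
    \<open>2 powr q\<close> is the loss from taking the weight at the inner radius of a shell, and
    the geometric series converges because q < d.\<close>
  define c where "c = v * 2 powr q * (\<Sum>n. (2 powr (-e)) ^ n)"
  have e: "e > 0" using q by (simp add: e_def)
  have v: "v \<ge> 0" by (simp add: v_def)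
  have r: "2 powr (-e) < 1" using e by (simp add: powr_less_one)
  have sm: "summable (\<lambda>n. (2 powr (-e)) ^ n :: real)"
    using r by (intro summable_geometric) simp
  have c0: "c \<ge> 0" unfolding c_def using v sm by (intro mult_nonneg_nonneg suminf_nonneg) auto
  show thesis
  proof (rule that[OF c0])
    fix R :: real assume R: "R > 0"
    define a where "a n = R * 2 powr (- real n)" for n
    have a: "a n > 0" for n using R by (simp add: a_def)
    have meas: "emeasure lborel (ball (0::'a) (a n)) = ennreal (a n ^ DIM('a) * v)" for n
    proof -
      have "emeasure lborel (ball (0::'a) (a n)) < top" using emeasure_lborel_ball_finite[of "0::'a" "a n"] by simp
      thus ?thesis
        using a[of n] content_ball_conv_unit_ball[of "a n" "0::'a"]
        by (simp add: v_def emeasure_eq_ennreal_measure)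
    qed
    \<comment> \<open>At y = 0 the left side is 0, since \<open>0 powr (-q) = 0\<close>. Every other
      point of the ball lies in the shell between \<open>a (Suc n)\<close> and \<open>a n\<close>,
      where \<open>Suc n\<close> is the first index with radius at most
      \<open>norm y\<close>.\<close>
    have pt: "ennreal (norm y powr (-q)) * indicator (ball 0 R) y
       \<le> (\<Sum>n. ennreal (a (Suc n) powr (-q)) * indicator (ball 0 (a n)) y)" for y :: 'a
    proof (cases "y = 0 \<or> norm y \<ge> R")
      case True thus ?thesis by auto
    next
      case False
      hence y: "norm y > 0" "norm y < R" by auto
      have "(\<lambda>n. a n) \<longlonglongrightarrow> R * 0" unfolding a_def
        by (intro tendsto_intros) real_asymp
      hence "eventually (\<lambda>n. a n < norm y) sequentially"
        using y by (intro order_tendstoD) auto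
      hence ex: "\<exists>n. a n \<le> norm y" by (auto simp: eventually_sequentially intro: less_imp_le)
      define m where "m = (LEAST n. a n \<le> norm y)"
      have m: "a m \<le> norm y" unfolding m_def by (rule LeastI_ex[OF ex])
      have "m \<noteq> 0"
      proof
        assume "m = 0"
        hence "R \<le> norm y" using m R by (simp add: a_def)
        thus False using y by simp
      qed
      then obtain n where n: "m = Suc n" by (cases m) auto
      have "\<not> a n \<le> norm y" using not_less_Least[of n "\<lambda>n. a n \<le> norm y"] n by (simp add: m_def)
      hence yn: "norm y < a n" by simp
      define g where "g k = ennreal (a (Suc k) powr (-q)) * indicator (ball 0 (a k)) y" for k
      have "ennreal (norm y powr (-q)) * indicator (ball 0 R) y \<le> g n"
        using m n yn y a[of "Suc n"] q by (auto simp: g_def intro!: ennreal_leI powr_mono2')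
      also have "g n = (\<Sum>k\<in>{n}. g k)" by simp
      also have "\<dots> \<le> (\<Sum>k. g k)"
        by (rule sum_le_suminf) auto
      also have "\<dots> = (\<Sum>n. ennreal (a (Suc n) powr (-q)) * indicator (ball 0 (a n)) y)"
        by (simp only: g_def)
      finally show ?thesis .
    qed
    have ev: "a (Suc n) powr (-q) * (a n ^ DIM('a) * v)
        = R powr e * (v * 2 powr q) * (2 powr (-e)) ^ n" for n
    proof -
      have "a (Suc n) powr (-q) = R powr (-q) * 2 powr (q + q * n)"
        using R by (simp add: a_def powr_mult powr_powr algebra_simps)
      moreover have "a n ^ DIM('a) = R powr DIM('a) * 2 powr (- real n * DIM('a))"
        using R a[of n] by (simp add: a_def powr_mult powr_powr flip: powr_realpow)
      moreover have "(2 powr (-e)) ^ n = 2 powr (-e * n)"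
        by (simp add: powr_powr flip: powr_realpow)
      moreover have "R powr e = R powr (-q) * R powr DIM('a)" by (simp add: e_def flip: powr_add)
      moreover have "2 powr (q + q * n) * 2 powr (- real n * DIM('a)) = 2 powr q * 2 powr (-e * n)"
        by (simp add: e_def algebra_simps flip: powr_add)
      ultimately show ?thesis by (simp add: algebra_simps)
    qed
    have h: "(\<lambda>y. ennreal (a (Suc n) powr (-q)) * indicator (ball (0::'a) (a n)) y)
        \<in> borel_measurable lborel" for n
      by (intro borel_measurable_times_ennreal borel_measurable_const borel_measurable_indicator) simp
    have "(\<integral>\<^sup>+y. ennreal (norm (y::'a) powr (-q)) * indicator (ball 0 R) y \<partial>lborel)
      \<le> (\<integral>\<^sup>+y. (\<Sum>n. ennreal (a (Suc n) powr (-q)) * indicator (ball (0::'a) (a n)) y) \<partial>lborel)"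
      by (intro nn_integral_mono pt)
    also have "\<dots> = (\<Sum>n. \<integral>\<^sup>+y. ennreal (a (Suc n) powr (-q)) * indicator (ball (0::'a) (a n)) y \<partial>lborel)"
      using nn_integral_suminf[OF h] by (simp only:)
    also have "\<dots> = (\<Sum>n. ennreal (R powr e * (v * 2 powr q) * (2 powr (-e)) ^ n))"
    proof (rule suminf_cong)
      fix n
      have "(\<integral>\<^sup>+y. ennreal (a (Suc n) powr (-q)) * indicator (ball (0::'a) (a n)) y \<partial>lborel)
        = ennreal (a (Suc n) powr (-q)) * ennreal (a n ^ DIM('a) * v)"
        by (subst nn_integral_cmult_indicator) (simp_all add: meas)
      also have "\<dots> = ennreal (a (Suc n) powr (-q) * (a n ^ DIM('a) * v))"
        using v a[of n] by (intro ennreal_mult[symmetric]) auto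
      finally show "(\<integral>\<^sup>+y. ennreal (a (Suc n) powr (-q)) * indicator (ball (0::'a) (a n)) y \<partial>lborel)
        = ennreal (R powr e * (v * 2 powr q) * (2 powr (-e)) ^ n)" by (simp only: ev)
    qed
    also have "\<dots> = ennreal (\<Sum>n. R powr e * (v * 2 powr q) * (2 powr (-e)) ^ n)"
      using v sm by (intro suminf_ennreal2 summable_mult) auto
    also have "(\<Sum>n. R powr e * (v * 2 powr q) * (2 powr (-e)) ^ n) = c * R powr (DIM('a) - q)"
      using sm by (subst suminf_mult) (auto simp: c_def e_def)
    finally show "(\<integral>\<^sup>+y. ennreal (norm (y::'a) powr (-q)) * indicator (ball 0 R) y \<partial>lborel)
        \<le> ennreal (c * R powr (DIM('a) - q))" .
  qed
qed

section \<open>Mass and pointwise bounds of the Gaussian kernel\<close>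

lemma heat_kernel_measurable [measurable]: "heat_kernel t \<in> borel_measurable borel"
  unfolding heat_kernel_def[abs_def] by measurable

lemma heat_kernel_nonneg [simp]: "heat_kernel t z \<ge> 0"
  by (simp add: heat_kernel_def)

lemma heat_kernel_minus_commute: "heat_kernel t (x - y) = heat_kernel t (y - x)"
  by (simp add: heat_kernel_def norm_minus_commute)

text \<open>The kernel is a centred Gaussian with independent coordinates of variance 2 t, so its
  total mass reduces to that of the one-dimensional densities.\<close>

lemma heat_kernel_eq_prod_normal_density:
  assumes "t > 0"
  shows "heat_kernel t (z::'a::euclidean_space) = (\<Prod>b\<in>Basis. normal_density 0 (sqrt (2 * t)) (z \<bullet> b))"
proof -
  have "(\<Prod>b\<in>Basis. normal_density 0 (sqrt (2 * t)) (z \<bullet> b))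
     = (1 / sqrt (4 * pi * t)) ^ DIM('a) * exp (\<Sum>b\<in>Basis. - (z \<bullet> b)\<^sup>2 / (4 * t))"
    using assms by (simp add: normal_density_def prod.distrib exp_sum prod_dividef field_simps)
  also have "(\<Sum>b\<in>Basis. - (z \<bullet> b)\<^sup>2 / (4 * t)) = - (norm z)\<^sup>2 / (4 * t)"
  proof -
    have "(norm z)\<^sup>2 = (\<Sum>b\<in>Basis. (z \<bullet> b)\<^sup>2)"
      unfolding power2_norm_eq_inner by (subst euclidean_inner) (simp add: power2_eq_square)
    thus ?thesis by (simp add: sum_divide_distrib sum_negf)
  qed
  also have "(1 / sqrt (4 * pi * t)) ^ DIM('a) = (4 * pi * t) powr (- real DIM('a) / 2)"
  proof -
    have "1 / sqrt (4 * pi * t) = (4 * pi * t) powr (- 1 / 2)"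
      using assms by (simp add: powr_half_sqrt[symmetric] powr_minus_divide)
    moreover have "((4 * pi * t) powr (- 1 / 2)) ^ DIM('a) = (4 * pi * t) powr (- real DIM('a) / 2)"
      using assms by (simp add: powr_powr flip: powr_realpow)
    ultimately show ?thesis by simp
  qed
  finally show ?thesis by (simp add: heat_kernel_def)
qed

lemma nn_integral_heat_kernel:
  assumes "t > 0"
  shows "(\<integral>\<^sup>+z. ennreal (heat_kernel t (z::'a::euclidean_space)) \<partial>lborel) = 1"
proof -
  have 1: "(\<integral>\<^sup>+x. ennreal (normal_density 0 (sqrt (2 * t)) x) \<partial>lborel) = 1"
    using assms by (subst nn_integral_eq_integral) auto
  have "(\<integral>\<^sup>+z. ennreal (heat_kernel t (z::'a)) \<partial>lborel)
     = (\<integral>\<^sup>+z. (\<Prod>b\<in>Basis. ennreal (normal_density 0 (sqrt (2 * t)) ((z::'a) \<bullet> b))) \<partial>lborel)"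
    using assms by (simp add: heat_kernel_eq_prod_normal_density prod_ennreal)
  also have "\<dots> = 1" by (subst nn_integral_lborel_prod) (auto simp: 1)
  finally show ?thesis .
qed

lemma nn_integral_heat_kernel_diff:
  assumes "t > 0"
  shows "(\<integral>\<^sup>+y. ennreal (heat_kernel t (x - y::'a::euclidean_space)) \<partial>lborel) = 1"
proof -
  have "(\<integral>\<^sup>+z. ennreal (heat_kernel t (z::'a)) \<partial>lborel)
     = (\<integral>\<^sup>+z. ennreal (heat_kernel t z) \<partial>(distr lborel borel ((+) (-x))))"
    by (simp add: lborel_distr_plus)
  also have "\<dots> = (\<integral>\<^sup>+y. ennreal (heat_kernel t (y - x)) \<partial>lborel)"
    by (subst nn_integral_distr) auto
  finally show ?thesis using nn_integral_heat_kernel[OF assms, where 'a='a]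
    by (simp add: heat_kernel_minus_commute)
qed

lemma heat_kernel_le_time:
  assumes "t > 0"
  shows "heat_kernel t (z::'a::euclidean_space) \<le> t powr (- real DIM('a) / 2)"
proof -
  have "(4 * pi * t) powr (- real DIM('a) / 2) \<le> t powr (- real DIM('a) / 2)"
  proof (rule powr_mono2')
    show "t \<le> 4 * pi * t" using assms pi_gt3 mult_right_mono[of 1 "4 * pi" t] by simp
  qed (use assms in auto)
  moreover have "exp (- (norm z)\<^sup>2 / (4 * t)) \<le> 1" using assms by simp
  ultimately show ?thesis unfolding heat_kernel_def
    using mult_mono[of _ "t powr (- real DIM('a) / 2)" _ 1] by simp
qed

lemma powr_le_exp:
  fixes s a :: real
  assumes "s > 0" "a > 0"
  shows "s powr a \<le> a powr a * exp s"
proof -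
  have "s / a \<le> exp (s / a)" using exp_ge_add_one_self[of "s / a"] by linarith
  hence "(s / a) powr a \<le> exp (s / a) powr a" using assms by (intro powr_mono2) auto
  thus ?thesis using assms by (simp add: powr_divide exp_powr_real field_simps)
qed

text \<open>With s = |z|^2 / (4 t) the kernel equals pi^(-d/2) |z|^(-d) s^(d/2) exp (-s), and s^a
  exp (-s) is at most a^a. The time disappears from the bound.\<close>

lemma heat_kernel_le_space:
  assumes t: "t > 0" and z: "z \<noteq> 0"
  shows "heat_kernel t (z::'a::euclidean_space)
     \<le> (DIM('a) / 2) powr (DIM('a) / 2) * norm z powr (- real DIM('a))"
proof -
  define a where "a = real DIM('a) / 2"
  define s where "s = (norm z)\<^sup>2 / (4 * t)"
  have a: "a > 0" by (simp add: a_def)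
  have s: "s > 0" using t z by (simp add: s_def)
  have "s powr a = norm z powr real DIM('a) * (4 * t) powr (-a)"
  proof -
    have "(norm z)\<^sup>2 powr a = norm z powr real DIM('a)"
      using z by (simp add: a_def powr_powr flip: powr_numeral)
    thus ?thesis using t by (simp add: s_def powr_divide powr_minus divide_simps)
  qed
  hence "(4 * t) powr (-a) = norm z powr (- real DIM('a)) * s powr a"
    using z by (simp add: powr_minus field_simps)
  hence eq: "heat_kernel t z = pi powr (-a) * (norm z powr (- real DIM('a)) * (s powr a * exp (-s)))"
    using t by (simp add: heat_kernel_def a_def s_def powr_mult algebra_simps)
  have "pi powr (-a) \<le> 1" using pi_gt3 a powr_mono2'[of "-a" 1 pi] by simp
  moreover have "s powr a * exp (-s) \<le> a powr a"
    using powr_le_exp[OF s a] by (simp add: exp_minus field_simps)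
  ultimately have "heat_kernel t z \<le> 1 * (norm z powr (- real DIM('a)) * a powr a)"
    unfolding eq by (intro mult_mono) auto
  thus ?thesis by (simp add: a_def mult.commute)
qed

text \<open>Outside the ball of radius \<open>R\<close> the weight is at most \<open>R powr (-q)\<close>; inside it the kernel is
  bounded and the weight is integrable. The choices \<open>R = sqrt t\<close> and \<open>R = norm x / 2\<close> give the two
  bounds below.\<close>

lemma heat_potential_split:
  fixes q :: real and x :: "'a::euclidean_space"
  assumes q: "0 \<le> q" and t: "t > 0" and R: "R > 0"
    and J: "(\<integral>\<^sup>+y. ennreal (norm (y::'a) powr (-q)) * indicator (ball 0 R) y \<partial>lborel) \<le> ennreal J" "J \<ge> 0"
    and K: "\<And>y. norm y < R \<Longrightarrow> heat_kernel t (x - y) \<le> K" "K \<ge> 0"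
  shows "(\<integral>\<^sup>+y. ennreal (heat_kernel t (x - y) * norm y powr (-q)) \<partial>lborel) \<le> ennreal (R powr (-q) + K * J)"
proof -
  have "ennreal (heat_kernel t (x - y) * norm y powr (-q))
     \<le> ennreal (R powr (-q)) * ennreal (heat_kernel t (x - y))
       + ennreal K * (ennreal (norm y powr (-q)) * indicator (ball 0 R) y)" for y
  proof (cases "norm y < R")
    case True
    hence "ennreal (heat_kernel t (x - y) * norm y powr (-q)) \<le> ennreal (K * norm y powr (-q))"
      using K(1)[of y] by (intro ennreal_leI mult_right_mono) auto
    also have "\<dots> = ennreal K * (ennreal (norm y powr (-q)) * indicator (ball 0 R) y)"
      using True K(2) by (simp add: ennreal_mult)
    finally show ?thesis by (rule order_trans) simp
  next
    case False
    hence "heat_kernel t (x - y) * norm y powr (-q) \<le> R powr (-q) * heat_kernel t (x - y)"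
      using q R by (subst mult.commute, intro mult_right_mono powr_mono2') auto
    hence "ennreal (heat_kernel t (x - y) * norm y powr (-q))
        \<le> ennreal (R powr (-q)) * ennreal (heat_kernel t (x - y))"
      by (simp add: ennreal_leI flip: ennreal_mult)
    thus ?thesis by (rule order_trans) simp
  qed
  moreover have m: "(\<lambda>y. ennreal (norm y powr (-q)) * indicator (ball (0::'a) R) y) \<in> borel_measurable lborel"
    by (intro borel_measurable_times_ennreal borel_measurable_indicator) measurable
  ultimately have "(\<integral>\<^sup>+y. ennreal (heat_kernel t (x - y) * norm y powr (-q)) \<partial>lborel)
    \<le> (\<integral>\<^sup>+y. ennreal (R powr (-q)) * ennreal (heat_kernel t (x - y))
       + ennreal K * (ennreal (norm y powr (-q)) * indicator (ball 0 R) y) \<partial>lborel)"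
    by (intro nn_integral_mono) auto
  also have "\<dots> = ennreal (R powr (-q))
       + ennreal K * (\<integral>\<^sup>+y. ennreal (norm (y::'a) powr (-q)) * indicator (ball 0 R) y \<partial>lborel)"
    using m by (subst nn_integral_add)
      (simp_all add: nn_integral_cmult nn_integral_heat_kernel_diff[OF t])
  also have "\<dots> \<le> ennreal (R powr (-q)) + ennreal K * ennreal J"
    using J(1) by (intro add_left_mono mult_left_mono) auto
  also have "\<dots> = ennreal (R powr (-q) + K * J)"
    using K(2) J(2) by (simp add: ennreal_mult)
  finally show ?thesis .
qed

text \<open>The potential is bounded by a multiple of t^(-q/2) where
  \<open>norm x \<le> sqrt t\<close> and of |x|^(-q) elsewhere, that is, by the smaller of the two.
  The right-hand side is a weighted geometric mean of both, so one constant serves all l.\<close>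

lemma heat_potential_bound:
  fixes q :: real
  assumes q: "0 \<le> q" "q < DIM('a::euclidean_space)"
  obtains C where "C > 0" and
    "\<And>t (x::'a) l. t > 0 \<Longrightarrow> x \<noteq> 0 \<Longrightarrow> 0 \<le> l \<Longrightarrow> l \<le> q \<Longrightarrow>
      (\<integral>\<^sup>+y. ennreal (heat_kernel t (x - y) * norm y powr (-q)) \<partial>lborel)
        \<le> ennreal (C * t powr (-(q - l) / 2) * norm x powr (-l))"
proof -
  let ?d = "real DIM('a)"
  obtain c where c: "c \<ge> 0" and ball: "\<And>R. R > 0 \<Longrightarrow>
     (\<integral>\<^sup>+y. ennreal (norm (y::'a) powr (-q)) * indicator (ball 0 R) y \<partial>lborel)
        \<le> ennreal (c * R powr (DIM('a) - q))"
    using nn_integral_ball_powr[OF q] by blast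
  define K where "K = (?d / 2) powr (?d / 2)"
  define C1 where "C1 = 1 + c"
  define C2 where "C2 = (1 / 2) powr (-q) * (1 + K * c)"
  have K: "K \<ge> 0" by (simp add: K_def)
  define C where "C = max C1 C2"
  have "C > 0" using c by (auto simp: C_def C1_def less_max_iff_disj)
  moreover have "(\<integral>\<^sup>+y. ennreal (heat_kernel t (x - y) * norm y powr (-q)) \<partial>lborel)
        \<le> ennreal (C * t powr (-(q - l) / 2) * norm x powr (-l))"
    if t: "t > 0" and x: "x \<noteq> 0" and l: "0 \<le> l" "l \<le> q" for t l and x :: 'a
  proof (cases "norm x \<le> sqrt t")
    case True
    have "(\<integral>\<^sup>+y. ennreal (heat_kernel t (x - y) * norm y powr (-q)) \<partial>lborel)
       \<le> ennreal (sqrt t powr (-q) + t powr (- ?d / 2) * (c * sqrt t powr (?d - q)))"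
      using q t c by (intro heat_potential_split ball heat_kernel_le_time) auto
    also have "sqrt t powr (-q) + t powr (- ?d / 2) * (c * sqrt t powr (?d - q)) = C1 * t powr (-q / 2)"
    proof -
      have "sqrt t powr e = t powr (e / 2)" for e
        using t by (simp add: powr_powr flip: powr_half_sqrt)
      moreover have "t powr (- ?d / 2) * t powr ((?d - q) / 2) = t powr (-q / 2)"
        by (simp add: diff_divide_distrib flip: powr_add)
      ultimately show ?thesis by (simp add: C1_def algebra_simps)
    qed
    also have "ennreal (C1 * t powr (-q / 2)) \<le> ennreal (C * t powr (-(q - l) / 2) * norm x powr (-l))"
    proof (rule ennreal_leI)
      have "t powr (-q / 2) = t powr (-(q - l) / 2) * sqrt t powr (-l)"
        using t by (simp add: powr_powr diff_divide_distrib flip: powr_half_sqrt powr_add)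
      also have "\<dots> \<le> t powr (-(q - l) / 2) * norm x powr (-l)"
        using True l x by (intro mult_left_mono powr_mono2') auto
      finally show "C1 * t powr (-q / 2) \<le> C * t powr (-(q - l) / 2) * norm x powr (-l)"
        using c unfolding mult.assoc by (intro mult_mono) (auto simp: C_def C1_def)
    qed
    finally show ?thesis .
  next
    case False
    define R where "R = norm x / 2"
    have R: "R > 0" using x by (simp add: R_def)
    have "heat_kernel t (x - y) \<le> K * R powr (- ?d)" if "norm y < R" for y
    proof -
      have ge: "norm (x - y) \<ge> R" using that norm_triangle_ineq2[of x y] by (simp add: R_def)
      hence "heat_kernel t (x - y) \<le> K * norm (x - y) powr (- ?d)"
        unfolding K_def using R t by (intro heat_kernel_le_space) auto
      also have "\<dots> \<le> K * R powr (- ?d)"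
        using ge R K by (intro mult_left_mono powr_mono2') auto
      finally show ?thesis .
    qed
    hence "(\<integral>\<^sup>+y. ennreal (heat_kernel t (x - y) * norm y powr (-q)) \<partial>lborel)
       \<le> ennreal (R powr (-q) + (K * R powr (- ?d)) * (c * R powr (?d - q)))"
      using q t c R K by (intro heat_potential_split ball) auto
    also have "R powr (-q) + (K * R powr (- ?d)) * (c * R powr (?d - q)) = C2 * norm x powr (-q)"
    proof -
      have "R powr (- ?d) * R powr (?d - q) = R powr (-q)" by (simp flip: powr_add)
      moreover have "R powr (-q) = (1 / 2) powr (-q) * norm x powr (-q)"
        by (simp add: R_def powr_divide powr_minus divide_simps)
      ultimately show ?thesis by (simp add: C2_def algebra_simps)
    qed
    also have "ennreal (C2 * norm x powr (-q)) \<le> ennreal (C * t powr (-(q - l) / 2) * norm x powr (-l))"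
    proof (rule ennreal_leI)
      have "norm x powr (-q) = norm x powr (-(q - l)) * norm x powr (-l)" by (simp flip: powr_add)
      also have "\<dots> \<le> sqrt t powr (-(q - l)) * norm x powr (-l)"
        using False l t by (intro mult_right_mono powr_mono2') auto
      also have "sqrt t powr (-(q - l)) = t powr (-(q - l) / 2)"
        using t by (simp add: powr_powr flip: powr_half_sqrt)
      finally show "C2 * norm x powr (-q) \<le> C * t powr (-(q - l) / 2) * norm x powr (-l)"
        using c K unfolding mult.assoc using \<open>C > 0\<close> by (intro mult_mono) (auto simp: C_def)
    qed
    finally show ?thesis .
  qed
  ultimately show thesis by (rule that)
qed

text \<open>Two weights are carried along because the majorants of the bootstrap are sums of two
  powers. If the integral defining the semigroup diverges, its value is 0 by convention and the
  second bound still holds.\<close>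

lemma heat_semigroup_abs_le2:
  fixes x :: "'a::euclidean_space"
  assumes h: "AE y in lebesgue. \<bar>h y\<bar> \<le> D1 * norm y powr (-q1) + D2 * norm y powr (-q2)"
    and D: "D1 \<ge> 0" "D2 \<ge> 0" and I: "I1 \<ge> 0" "I2 \<ge> 0"
    and 1: "(\<integral>\<^sup>+y. ennreal (heat_kernel t (x - y) * norm y powr (-q1)) \<partial>lborel) \<le> ennreal I1"
    and 2: "(\<integral>\<^sup>+y. ennreal (heat_kernel t (x - y) * norm y powr (-q2)) \<partial>lborel) \<le> ennreal I2"
  shows "(\<integral>\<^sup>+y. ennreal \<bar>heat_kernel t (x - y) * h y\<bar> \<partial>lebesgue) \<le> ennreal (D1 * I1 + D2 * I2)"
    and "\<bar>heat_semigroup t h x\<bar> \<le> D1 * I1 + D2 * I2"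
proof -
  have "(\<integral>\<^sup>+y. ennreal \<bar>heat_kernel t (x - y) * h y\<bar> \<partial>lebesgue)
     \<le> (\<integral>\<^sup>+y. ennreal D1 * ennreal (heat_kernel t (x - y) * norm y powr (-q1))
          + ennreal D2 * ennreal (heat_kernel t (x - y) * norm y powr (-q2)) \<partial>lebesgue)"
  proof (rule nn_integral_mono_AE, use h in eventually_elim)
    fix y assume "\<bar>h y\<bar> \<le> D1 * norm y powr (-q1) + D2 * norm y powr (-q2)"
    hence "heat_kernel t (x - y) * \<bar>h y\<bar>
        \<le> heat_kernel t (x - y) * (D1 * norm y powr (-q1) + D2 * norm y powr (-q2))"
      by (rule mult_left_mono) simp
    thus "ennreal \<bar>heat_kernel t (x - y) * h y\<bar>
      \<le> ennreal D1 * ennreal (heat_kernel t (x - y) * norm y powr (-q1))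
          + ennreal D2 * ennreal (heat_kernel t (x - y) * norm y powr (-q2))"
      using D by (auto simp: abs_mult algebra_simps intro!: ennreal_leI
        simp flip: ennreal_mult ennreal_plus)
  qed
  also have "\<dots> = ennreal D1 * (\<integral>\<^sup>+y. ennreal (heat_kernel t (x - y) * norm y powr (-q1)) \<partial>lborel)
      + ennreal D2 * (\<integral>\<^sup>+y. ennreal (heat_kernel t (x - y) * norm y powr (-q2)) \<partial>lborel)"
    unfolding nn_integral_completion by (subst nn_integral_add) (simp_all add: nn_integral_cmult)
  also have "\<dots> \<le> ennreal D1 * ennreal I1 + ennreal D2 * ennreal I2"
    using 1 2 by (intro add_mono mult_left_mono) auto
  also have "\<dots> = ennreal (D1 * I1 + D2 * I2)" using D I by (simp add: ennreal_mult)
  finally show *: "(\<integral>\<^sup>+y. ennreal \<bar>heat_kernel t (x - y) * h y\<bar> \<partial>lebesgue) \<le> ennreal (D1 * I1 + D2 * I2)" .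
  show "\<bar>heat_semigroup t h x\<bar> \<le> D1 * I1 + D2 * I2"
  proof (cases "integrable lebesgue (\<lambda>y. heat_kernel t (x - y) * h y)")
    case True
    from integral_norm_bound_ennreal[OF this] *
    have "ennreal \<bar>heat_semigroup t h x\<bar> \<le> ennreal (D1 * I1 + D2 * I2)"
      by (simp add: heat_semigroup_def)
    thus ?thesis using D I by (subst (asm) ennreal_le_iff) auto
  next
    case False
    thus ?thesis using D I by (simp add: heat_semigroup_def not_integrable_integral_eq)
  qed
qed

lemma heat_semigroup_bound2:
  fixes q1 q2 :: real
  assumes q: "0 \<le> q1" "q1 < DIM('a::euclidean_space)" "0 \<le> q2" "q2 < DIM('a)"
  obtains C where "C > 0" and
    "\<And>t (x::'a) l1 l2 D1 D2 h. t > 0 \<Longrightarrow> x \<noteq> 0 \<Longrightarrow> 0 \<le> l1 \<Longrightarrow> l1 \<le> q1 \<Longrightarrow> 0 \<le> l2 \<Longrightarrow> l2 \<le> q2 \<Longrightarrow>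
      D1 \<ge> 0 \<Longrightarrow> D2 \<ge> 0 \<Longrightarrow>
      AE y in lebesgue. \<bar>h y\<bar> \<le> D1 * norm y powr (-q1) + D2 * norm y powr (-q2) \<Longrightarrow>
      \<bar>heat_semigroup t h x\<bar> \<le> C * (D1 * (t powr (-(q1 - l1) / 2) * norm x powr (-l1))
        + D2 * (t powr (-(q2 - l2) / 2) * norm x powr (-l2)))"
proof -
  obtain C1 where C1: "C1 > 0" "\<And>t (x::'a) l. t > 0 \<Longrightarrow> x \<noteq> 0 \<Longrightarrow> 0 \<le> l \<Longrightarrow> l \<le> q1 \<Longrightarrow>
      (\<integral>\<^sup>+y. ennreal (heat_kernel t (x - y) * norm y powr (-q1)) \<partial>lborel)
        \<le> ennreal (C1 * t powr (-(q1 - l) / 2) * norm x powr (-l))"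
    using heat_potential_bound[OF q(1,2)] by blast
  obtain C2 where C2: "C2 > 0" "\<And>t (x::'a) l. t > 0 \<Longrightarrow> x \<noteq> 0 \<Longrightarrow> 0 \<le> l \<Longrightarrow> l \<le> q2 \<Longrightarrow>
      (\<integral>\<^sup>+y. ennreal (heat_kernel t (x - y) * norm y powr (-q2)) \<partial>lborel)
        \<le> ennreal (C2 * t powr (-(q2 - l) / 2) * norm x powr (-l))"
    using heat_potential_bound[OF q(3,4)] by blast
  show thesis
  proof (rule that[of "max C1 C2"])
    fix t :: real and x :: 'a and l1 l2 D1 D2 and h :: "'a \<Rightarrow> real"
    assume *: "t > 0" "x \<noteq> 0" "0 \<le> l1" "l1 \<le> q1" "0 \<le> l2" "l2 \<le> q2" "D1 \<ge> (0::real)" "D2 \<ge> (0::real)"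
      and h: "AE y in lebesgue. \<bar>h y\<bar> \<le> D1 * norm y powr (-q1) + D2 * norm y powr (-q2)"
    have "\<bar>heat_semigroup t h x\<bar> \<le> D1 * (C1 * t powr (-(q1 - l1) / 2) * norm x powr (-l1))
        + D2 * (C2 * t powr (-(q2 - l2) / 2) * norm x powr (-l2))"
      using * C1 C2 by (intro heat_semigroup_abs_le2[OF h]) auto
    also have "\<dots> = C1 * (D1 * (t powr (-(q1 - l1) / 2) * norm x powr (-l1)))
        + C2 * (D2 * (t powr (-(q2 - l2) / 2) * norm x powr (-l2)))"
      by (simp add: mult_ac)
    also have "\<dots> \<le> max C1 C2 * (D1 * (t powr (-(q1 - l1) / 2) * norm x powr (-l1)))
        + max C1 C2 * (D2 * (t powr (-(q2 - l2) / 2) * norm x powr (-l2)))"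
      using * by (intro add_mono mult_right_mono) auto
    finally show "\<bar>heat_semigroup t h x\<bar> \<le> max C1 C2 * (D1 * (t powr (-(q1 - l1) / 2) * norm x powr (-l1))
        + D2 * (t powr (-(q2 - l2) / 2) * norm x powr (-l2)))"
      by (simp only: distrib_left)
  qed (use C1(1) in auto)
qed

lemma heat_semigroup_bound:
  fixes q :: real
  assumes q: "0 \<le> q" "q < DIM('a::euclidean_space)"
  obtains C where "C > 0" and
    "\<And>t (x::'a) l D h. t > 0 \<Longrightarrow> x \<noteq> 0 \<Longrightarrow> 0 \<le> l \<Longrightarrow> l \<le> q \<Longrightarrow> D \<ge> 0 \<Longrightarrow>
      AE y in lebesgue. \<bar>h y\<bar> \<le> D * norm y powr (-q) \<Longrightarrow>
      \<bar>heat_semigroup t h x\<bar> \<le> C * (D * (t powr (-(q - l) / 2) * norm x powr (-l)))"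
proof -
  obtain C where C: "C > 0" and
    *: "\<And>t (x::'a) l1 l2 D1 D2 h. t > 0 \<Longrightarrow> x \<noteq> 0 \<Longrightarrow> 0 \<le> l1 \<Longrightarrow> l1 \<le> q \<Longrightarrow> 0 \<le> l2 \<Longrightarrow> l2 \<le> q \<Longrightarrow>
      D1 \<ge> 0 \<Longrightarrow> D2 \<ge> 0 \<Longrightarrow>
      AE y in lebesgue. \<bar>h y\<bar> \<le> D1 * norm y powr (-q) + D2 * norm y powr (-q) \<Longrightarrow>
      \<bar>heat_semigroup t h x\<bar> \<le> C * (D1 * (t powr (-(q - l1) / 2) * norm x powr (-l1))
        + D2 * (t powr (-(q - l2) / 2) * norm x powr (-l2)))"
    using heat_semigroup_bound2[OF q q] by blast
  show thesis
    by (rule that[OF C]) (use *[where ?D2.0 = 0] in auto)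
qed

lemma heat_integrable:
  fixes q :: real and x :: "'a::euclidean_space"
  assumes q: "0 \<le> q" "q < DIM('a)" and t: "t > 0" and x: "x \<noteq> 0"
    and m: "h \<in> borel_measurable lebesgue" and D: "D \<ge> 0"
    and h: "AE y in lebesgue. \<bar>h y\<bar> \<le> D * norm y powr (-q)"
  shows "integrable lebesgue (\<lambda>y. heat_kernel t (x - y) * h y)"
proof (rule integrableI_bounded)
  have "(\<lambda>y. heat_kernel t (x - y)) \<in> borel_measurable lborel" by measurable
  hence "(\<lambda>y. heat_kernel t (x - y)) \<in> borel_measurable lebesgue" by (rule measurable_completion)
  thus "(\<lambda>y. heat_kernel t (x - y) * h y) \<in> borel_measurable lebesgue" using m by measurable
  obtain C where C: "C > 0" "\<And>t (x::'a) l. t > 0 \<Longrightarrow> x \<noteq> 0 \<Longrightarrow> 0 \<le> l \<Longrightarrow> l \<le> q \<Longrightarrow>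
      (\<integral>\<^sup>+y. ennreal (heat_kernel t (x - y) * norm y powr (-q)) \<partial>lborel)
        \<le> ennreal (C * t powr (-(q - l) / 2) * norm x powr (-l))"
    using heat_potential_bound[OF q] by blast
  define I where "I = C * t powr (-(q - 0) / 2) * norm x powr (-0)"
  have "(\<integral>\<^sup>+y. ennreal \<bar>heat_kernel t (x - y) * h y\<bar> \<partial>lebesgue) \<le> ennreal (D * I + 0 * I)"
    using h D C(1) C(2)[OF t x order_refl q(1)]
    by (intro heat_semigroup_abs_le2) (auto simp: I_def)
  also have "\<dots> < \<infinity>" by simp
  finally show "(\<integral>\<^sup>+y. ennreal (norm (heat_kernel t (x - y) * h y)) \<partial>lebesgue) < \<infinity>" by simp
qed

section \<open>Time integrals with power singularities at the end points\<close>

lemma has_bochner_integral_powr_Ioo: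
  fixes b t :: real
  assumes "b < 1" "t > 0"
  shows "has_bochner_integral lebesgue (\<lambda>s. indicator {0<..<t} s * s powr (-b)) (t powr (1 - b) / (1 - b))"
proof -
  have "((\<lambda>s. s powr (-b)) has_integral (t powr (-b + 1) / (-b + 1))) {0..t}"
    using assms by (intro has_integral_powr_from_0) auto
  hence i: "((\<lambda>s. s powr (-b)) has_integral (t powr (1 - b) / (1 - b))) {0<..<t}"
    by (simp add: has_integral_Icc_iff_Ioo add.commute)
  hence "(\<lambda>s. s powr (-b)) absolutely_integrable_on {0<..<t}"
    by (intro nonnegative_absolutely_integrable_1) (auto simp: has_integral_integrable)
  moreover from set_lebesgue_integral_eq_integral(2)[OF this]
  have "(LINT s:{0<..<t}|lebesgue. s powr (-b)) = t powr (1 - b) / (1 - b)"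
    using i by (simp add: integral_unique)
  ultimately show ?thesis
    by (simp add: has_bochner_integral_iff set_integrable_def set_lebesgue_integral_def)
qed

lemma has_bochner_integral_powr_Ioo_reflect:
  fixes a t :: real
  assumes "a < 1" "t > 0"
  shows "has_bochner_integral lebesgue (\<lambda>s. indicator {0<..<t} s * (t - s) powr (-a)) (t powr (1 - a) / (1 - a))"
proof -
  have "(\<lambda>s. indicator {0<..<t} s * (t - s) powr (-a))
     = (\<lambda>s. indicator {0<..<t} (t + (-1) * s) * (t + (-1) * s) powr (-a))"
    by (auto simp: fun_eq_iff indicator_def)
  thus ?thesis
    using has_bochner_integral_lebesgue_real_affine_iff[of "-1"
        "\<lambda>s. indicator {0<..<t} s * s powr (-a)" "t powr (1 - a) / (1 - a)" t]
      has_bochner_integral_powr_Ioo[OF assms] by simp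
qed

text \<open>The majorant has two singular powers at each end point, which suffices for a source with
  two weights. A source with fewer singularities sets the spare coefficients to 0.\<close>

lemma time_integral_bound:
  fixes g :: "real \<Rightarrow> real"
  assumes t: "t > 0" and g: "set_integrable lebesgue {0<..<t} g"
    and ab: "b1 < 1" "b2 < 1" "a1 < 1" "a2 < 1"
    and bd: "AE s in lebesgue. 0 < s \<and> s < t \<longrightarrow> \<bar>g s\<bar> \<le> P1 * s powr (-b1) + Q1 * (t - s) powr (-a1)
        + (P2 * s powr (-b2) + Q2 * (t - s) powr (-a2))"
  shows "\<bar>LINT s:{0<..<t}|lebesgue. g s\<bar>
     \<le> P1 * (t powr (1 - b1) / (1 - b1)) + Q1 * (t powr (1 - a1) / (1 - a1))
      + (P2 * (t powr (1 - b2) / (1 - b2)) + Q2 * (t powr (1 - a2) / (1 - a2)))" (is "_ \<le> ?V")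
proof -
  let ?m = "\<lambda>s. P1 * (indicator {0<..<t} s * s powr (-b1)) + Q1 * (indicator {0<..<t} s * (t - s) powr (-a1))
        + (P2 * (indicator {0<..<t} s * s powr (-b2)) + Q2 * (indicator {0<..<t} s * (t - s) powr (-a2)))"
  have m: "has_bochner_integral lebesgue ?m ?V"
    using t ab by (intro has_bochner_integral_add has_bochner_integral_mult_right
      has_bochner_integral_powr_Ioo has_bochner_integral_powr_Ioo_reflect)
  have "\<bar>LINT s:{0<..<t}|lebesgue. g s\<bar> \<le> (LINT s|lebesgue. \<bar>indicator {0<..<t} s *\<^sub>R g s\<bar>)"
    unfolding set_lebesgue_integral_def by (rule integral_abs_bound)
  also have "\<dots> \<le> (LINT s|lebesgue. ?m s)"
  proof (rule integral_mono_AE)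
    show "integrable lebesgue (\<lambda>s. \<bar>indicator {0<..<t} s *\<^sub>R g s\<bar>)"
      using g unfolding set_integrable_def by (rule integrable_abs)
    show "integrable lebesgue ?m" using m by (rule integrable.intros)
    show "AE s in lebesgue. \<bar>indicator {0<..<t} s *\<^sub>R g s\<bar> \<le> ?m s"
      using bd by eventually_elim (auto simp: indicator_def)
  qed
  also have "\<dots> = ?V" using m by (rule has_bochner_integral_integral_eq)
  finally show ?thesis .
qed

text \<open>Cutting at t / 2 leaves a single singularity on each half, where the other factor is at
  most its value at the midpoint. This replaces the Beta integral by two integrals of pure
  powers.\<close>

lemma beta_integrand_le:
  fixes a b s t :: real
  assumes "0 \<le> a" "0 \<le> b" "0 < s" "s < t"
  shows "(t - s) powr (-a) * s powr (-b) \<le> (t / 2) powr (-a) * s powr (-b) + (t / 2) powr (-b) * (t - s) powr (-a)"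
proof (cases "s \<le> t / 2")
  case True
  hence "(t - s) powr (-a) \<le> (t / 2) powr (-a)" using assms by (intro powr_mono2') auto
  hence "(t - s) powr (-a) * s powr (-b) \<le> (t / 2) powr (-a) * s powr (-b)"
    by (intro mult_right_mono) auto
  thus ?thesis by (rule order_trans) simp
next
  case False
  hence "s powr (-b) \<le> (t / 2) powr (-b)" using assms by (intro powr_mono2') auto
  hence "s powr (-b) * (t - s) powr (-a) \<le> (t / 2) powr (-b) * (t - s) powr (-a)"
    by (intro mult_right_mono) auto
  thus ?thesis by (subst mult.commute, rule order_trans) simp_all
qed

section \<open>Duhamel terms with a scale-invariant potential\<close>

text \<open>The majorant is homogeneous of degree -r under (t, x) -> (c^2 t, c x): r is the decay
  rate, and l only distributes it between time and space. A bound M on \<open>K_norm\<close> is the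
  case r = (2 + \<gamma>) / (\<alpha> - 1), l = k. The quantifier over t stands outside because the
  exceptional null set varies with t.\<close>

definition decays :: "real \<Rightarrow> real \<Rightarrow> real \<Rightarrow> (real \<Rightarrow> 'a::euclidean_space \<Rightarrow> real) \<Rightarrow> bool" where
  "decays r l C w \<longleftrightarrow>
     (\<forall>t>0. AE x in lebesgue. \<bar>w t x\<bar> \<le> C * (t powr (-(r - l) / 2) * norm x powr (-l)))"

text \<open>The integrand is only prescribed for almost every time, so that Duhamel terms can be subtracted
  without a measurability hypothesis on the sources.\<close>

definition duhamel_term ::
    "(real \<Rightarrow> 'a::euclidean_space \<Rightarrow> real) \<Rightarrow> (real \<Rightarrow> 'a \<Rightarrow> real) \<Rightarrow> bool" where
  "duhamel_term h v \<longleftrightarrow> (\<forall>t>0. AE x in lebesgue. \<exists>g.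
     set_integrable lebesgue {0<..<t} g \<and>
     (AE s in lebesgue. 0 < s \<and> s < t \<longrightarrow> g s = heat_semigroup (t - s) (h s) x) \<and>
     v t x = (LINT s:{0<..<t}|lebesgue. g s))"

section \<open>Calculus of weighted decay rates\<close>

lemma AE_lebesgue_nonzero: "AE x::'a::euclidean_space in lebesgue. x \<noteq> 0"
  by (intro AE_completion AE_lborel_singleton)

lemma decaysD:
  "decays r l C w \<Longrightarrow> t > 0 \<Longrightarrow>
    AE x in lebesgue. \<bar>w t x\<bar> \<le> C * (t powr (-(r - l) / 2) * norm x powr (-l))"
  by (simp add: decays_def)

lemma decays_mono:
  assumes "decays r l C w" "C \<le> C'"
  shows "decays r l C' w"
  unfolding decays_def
proof (intro allI impI)
  fix t :: real assume "t > 0"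
  from decaysD[OF assms(1) this] show "AE x in lebesgue. \<bar>w t x\<bar> \<le> C' * (t powr (-(r - l) / 2) * norm x powr (-l))"
  proof eventually_elim
    case (elim x)
    also have "C * (t powr (-(r - l) / 2) * norm x powr (-l)) \<le> C' * (t powr (-(r - l) / 2) * norm x powr (-l))"
      using assms(2) by (rule mult_right_mono) simp
    finally show ?case .
  qed
qed

lemma decays_add:
  assumes "decays r l C1 w1" "decays r l C2 w2"
    and "\<And>t. t > 0 \<Longrightarrow> AE x in lebesgue. \<bar>w t x\<bar> \<le> \<bar>w1 t x\<bar> + \<bar>w2 t x\<bar>"
  shows "decays r l (C1 + C2) w"
  unfolding decays_def
proof (intro allI impI)
  fix t :: real assume t: "t > 0"
  from decaysD[OF assms(1) t] decaysD[OF assms(2) t] assms(3)[OF t]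
  show "AE x in lebesgue. \<bar>w t x\<bar> \<le> (C1 + C2) * (t powr (-(r - l) / 2) * norm x powr (-l))"
    by eventually_elim (simp add: distrib_right)
qed

text \<open>Where \<open>norm x \<le> sqrt t\<close> the bound with the smaller weight is the stronger one, elsewhere the bound
  with the larger weight; so the two extreme weights control all intermediate ones with the same
  constant.\<close>

lemma decays_interpolate:
  assumes "decays r 0 C w" "decays r m C w" "0 \<le> l" "l \<le> m" "C \<ge> 0"
  shows "decays r l C w"
  unfolding decays_def
proof (intro allI impI)
  fix t :: real assume t: "t > 0"
  from decaysD[OF assms(1) t] decaysD[OF assms(2) t] AE_lebesgue_nonzero
  show "AE x in lebesgue. \<bar>w t x\<bar> \<le> C * (t powr (-(r - l) / 2) * norm x powr (-l))"
  proof eventually_elim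
    case (elim x)
    have e: "t powr (-(r - k) / 2) * norm x powr (-k) = t powr (-r / 2) * (sqrt t / norm x) powr k" for k
    proof -
      have "t powr (-(r - k) / 2) = t powr (-r / 2) * sqrt t powr k"
        using t by (simp add: powr_powr diff_divide_distrib flip: powr_half_sqrt powr_add)
      thus ?thesis using t elim by (simp add: powr_divide powr_minus divide_simps)
    qed
    have b0: "\<bar>w t x\<bar> \<le> C * (t powr (-r / 2) * 1)" using elim by simp
    have bm: "\<bar>w t x\<bar> \<le> C * (t powr (-r / 2) * (sqrt t / norm x) powr m)"
      using elim(2) unfolding e .
    have z: "0 < sqrt t / norm x" using t elim by simp
    show ?case unfolding e
    proof (cases "1 \<le> sqrt t / norm x")
      case True
      have "1 \<le> (sqrt t / norm x) powr l" using True assms(3) by (rule ge_one_powr_ge_zero)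
      hence "C * (t powr (-r / 2) * 1) \<le> C * (t powr (-r / 2) * (sqrt t / norm x) powr l)"
        using assms(5) by (intro mult_left_mono) auto
      with b0 show "\<bar>w t x\<bar> \<le> C * (t powr (-r / 2) * (sqrt t / norm x) powr l)" by linarith
    next
      case False
      have "(sqrt t / norm x) powr m \<le> (sqrt t / norm x) powr l"
        using False z assms(4) by (intro powr_mono') auto
      hence "C * (t powr (-r / 2) * (sqrt t / norm x) powr m) \<le> C * (t powr (-r / 2) * (sqrt t / norm x) powr l)"
        using assms(5) by (intro mult_left_mono) auto
      with bm show "\<bar>w t x\<bar> \<le> C * (t powr (-r / 2) * (sqrt t / norm x) powr l)" by linarith
    qed
  qed
qed

lemma heat_decays:
  fixes q :: real
  assumes "0 \<le> q" "q < DIM('a::euclidean_space)"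
  obtains C where "C > 0" and
    "\<And>(h :: 'a \<Rightarrow> real) D l. D \<ge> 0 \<Longrightarrow> AE y in lebesgue. \<bar>h y\<bar> \<le> D * norm y powr (-q) \<Longrightarrow>
      0 \<le> l \<Longrightarrow> l \<le> q \<Longrightarrow> decays q l (C * D) (\<lambda>t. heat_semigroup t h)"
proof -
  obtain C where C: "C > 0"
    "\<And>t (x::'a) l D h. t > 0 \<Longrightarrow> x \<noteq> 0 \<Longrightarrow> 0 \<le> l \<Longrightarrow> l \<le> q \<Longrightarrow> D \<ge> 0 \<Longrightarrow>
      AE y in lebesgue. \<bar>h y\<bar> \<le> D * norm y powr (-q) \<Longrightarrow>
      \<bar>heat_semigroup t h x\<bar> \<le> C * (D * (t powr (-(q - l) / 2) * norm x powr (-l)))"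
    using heat_semigroup_bound[OF assms] by blast
  show thesis
  proof (rule that[OF C(1)])
    fix h :: "'a \<Rightarrow> real" and D l :: real
    assume h: "D \<ge> 0" "AE y in lebesgue. \<bar>h y\<bar> \<le> D * norm y powr (-q)" "0 \<le> l" "l \<le> q"
    show "decays q l (C * D) (\<lambda>t. heat_semigroup t h)"
      unfolding decays_def
    proof (intro allI impI)
      fix t :: real assume t: "t > 0"
      from AE_lebesgue_nonzero
      show "AE x in lebesgue. \<bar>heat_semigroup t h x\<bar> \<le> C * D * (t powr (-(q - l) / 2) * norm x powr (-l))"
        by eventually_elim (use C(2)[OF t _ h(3,4,1,2)] in \<open>simp add: mult.assoc\<close>)
    qed
  qed
qed

text \<open>The source is bounded through \<open>q1\<close> on the first half of the time interval, where the heat kernel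
  is regular, and through \<open>q2\<close> on the second half, where the source is.\<close>

lemma duhamel_decays:
  fixes R q1 q2 l :: real
  assumes l: "0 \<le> l" "l \<le> q1" "l \<le> q2" and q: "q1 < DIM('a::euclidean_space)" "q2 < DIM('a)"
    and R: "R - 2 < q1" "q2 \<le> R" "q2 < l + 2"
  obtains C where "C > 0" and
    "\<And>(h :: real \<Rightarrow> 'a \<Rightarrow> real) v D1 D2. D1 \<ge> 0 \<Longrightarrow> D2 \<ge> 0 \<Longrightarrow> duhamel_term h v \<Longrightarrow>
       decays R q1 D1 h \<Longrightarrow> decays R q2 D2 h \<Longrightarrow> decays (R - 2) l (C * (D1 + D2)) v"
proof -
  have q0: "0 \<le> q1" "0 \<le> q2" using l by auto
  obtain C1 where C1: "C1 > 0"
    "\<And>t (x::'a) l D h. t > 0 \<Longrightarrow> x \<noteq> 0 \<Longrightarrow> 0 \<le> l \<Longrightarrow> l \<le> q1 \<Longrightarrow> D \<ge> 0 \<Longrightarrow>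
      AE y in lebesgue. \<bar>h y\<bar> \<le> D * norm y powr (-q1) \<Longrightarrow>
      \<bar>heat_semigroup t h x\<bar> \<le> C1 * (D * (t powr (-(q1 - l) / 2) * norm x powr (-l)))"
    using heat_semigroup_bound[OF q0(1) q(1)] by blast
  obtain C2 where C2: "C2 > 0"
    "\<And>t (x::'a) l D h. t > 0 \<Longrightarrow> x \<noteq> 0 \<Longrightarrow> 0 \<le> l \<Longrightarrow> l \<le> q2 \<Longrightarrow> D \<ge> 0 \<Longrightarrow>
      AE y in lebesgue. \<bar>h y\<bar> \<le> D * norm y powr (-q2) \<Longrightarrow>
      \<bar>heat_semigroup t h x\<bar> \<le> C2 * (D * (t powr (-(q2 - l) / 2) * norm x powr (-l)))"
    using heat_semigroup_bound[OF q0(2) q(2)] by blast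
  \<comment> \<open>The exponents b belong to the source at time 0, the exponents a to the kernel at
    the final time. \<open>b1 < 1\<close> and \<open>a2 < 1\<close> give integrability;
    \<open>a1\<close> and \<open>b2\<close> have to be nonnegative, so that on the half where they
    occur their factor is at most its value at the midpoint.\<close>
  define b1 where "b1 = (R - q1) / 2"
  define b2 where "b2 = (R - q2) / 2"
  define a1 where "a1 = (q1 - l) / 2"
  define a2 where "a2 = (q2 - l) / 2"
  have ab: "b1 < 1" "0 \<le> b2" "0 \<le> a1" "a2 < 1" using l R by (auto simp: a1_def a2_def b1_def b2_def)
  define K1 where "K1 = C1 * (1/2) powr (-a1) / (1 - b1)"
  define K2 where "K2 = C2 * (1/2) powr (-b2) / (1 - a2)"
  have K: "K1 > 0" "K2 > 0" using C1(1) C2(1) ab by (auto simp: K1_def K2_def)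
  show thesis
  proof (rule that[of "max K1 K2"])
    show "max K1 K2 > 0" using K by simp
    fix h v :: "real \<Rightarrow> 'a \<Rightarrow> real" and D1 D2 :: real
    assume D: "D1 \<ge> 0" "D2 \<ge> 0" and v: "duhamel_term h v" and h: "decays R q1 D1 h" "decays R q2 D2 h"
    show "decays (R - 2) l (max K1 K2 * (D1 + D2)) v"
      unfolding decays_def
    proof (intro allI impI)
      fix t :: real assume t: "t > 0"
      from v t have "AE x in lebesgue. \<exists>g. set_integrable lebesgue {0<..<t} g \<and>
         (AE s in lebesgue. 0 < s \<and> s < t \<longrightarrow> g s = heat_semigroup (t - s) (h s) x) \<and>
         v t x = (LINT s:{0<..<t}|lebesgue. g s)" by (simp add: duhamel_term_def)
      thus "AE x in lebesgue. \<bar>v t x\<bar> \<le> max K1 K2 * (D1 + D2) * (t powr (-(R - 2 - l) / 2) * norm x powr (-l))"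
        using AE_lebesgue_nonzero
      proof eventually_elim
        case (elim x)
        then obtain g where g: "set_integrable lebesgue {0<..<t} g"
          "AE s in lebesgue. 0 < s \<and> s < t \<longrightarrow> g s = heat_semigroup (t - s) (h s) x"
          "v t x = (LINT s:{0<..<t}|lebesgue. g s)" by blast
        have x: "x \<noteq> 0" using elim by simp
        define n where "n = norm x powr (-l)"
        have n: "n \<ge> 0" by (simp add: n_def)
        define P where "P = C1 * D1 * n * (t / 2) powr (-a1)"
        define Q where "Q = C2 * D2 * n * (t / 2) powr (-b2)"
        have PQ: "P \<ge> 0" "Q \<ge> 0" using C1(1) C2(1) D n by (auto simp: P_def Q_def)
        have "AE s in lebesgue. 0 < s \<and> s < t \<longrightarrow> \<bar>g s\<bar> \<le> P * s powr (-b1) + 0 * (t - s) powr (-0)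
              + (0 * s powr (-0) + Q * (t - s) powr (-a2))"
          using g(2)
        proof (eventually_elim, intro impI)
          fix s assume "0 < s \<and> s < t \<longrightarrow> g s = heat_semigroup (t - s) (h s) x" "0 < s \<and> s < t"
          hence s: "0 < s" "s < t" and gs: "g s = heat_semigroup (t - s) (h s) x" by auto
          show "\<bar>g s\<bar> \<le> P * s powr (-b1) + 0 * (t - s) powr (-0)
              + (0 * s powr (-0) + Q * (t - s) powr (-a2))"
          proof (cases "s \<le> t / 2")
            case True
            have "\<bar>g s\<bar> \<le> C1 * (D1 * s powr (-b1) * ((t - s) powr (-(q1 - l) / 2) * norm x powr (-l)))"
              unfolding gs using s x l D decaysD[OF h(1) s(1)]
              by (intro C1(2)) (auto simp: b1_def mult.assoc minus_divide_left)
            also have "\<dots> = C1 * D1 * n * s powr (-b1) * (t - s) powr (-a1)"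
              by (simp add: n_def a1_def mult_ac minus_divide_left)
            also have "\<dots> \<le> C1 * D1 * n * s powr (-b1) * (t / 2) powr (-a1)"
              using True s ab C1(1) D n by (intro mult_left_mono powr_mono2') auto
            also have "\<dots> = P * s powr (-b1)" by (simp add: P_def mult_ac)
            finally show ?thesis using PQ by (simp add: add_increasing2)
          next
            case False
            have "\<bar>g s\<bar> \<le> C2 * (D2 * s powr (-b2) * ((t - s) powr (-(q2 - l) / 2) * norm x powr (-l)))"
              unfolding gs using s x l D decaysD[OF h(2) s(1)]
              by (intro C2(2)) (auto simp: b2_def mult.assoc minus_divide_left)
            also have "\<dots> = C2 * D2 * n * (t - s) powr (-a2) * s powr (-b2)"
              by (simp add: n_def a2_def mult_ac minus_divide_left)
            also have "\<dots> \<le> C2 * D2 * n * (t - s) powr (-a2) * (t / 2) powr (-b2)"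
              using False s t ab C2(1) D n by (intro mult_left_mono powr_mono2') auto
            also have "\<dots> = Q * (t - s) powr (-a2)" by (simp add: Q_def mult_ac)
            finally show ?thesis using PQ by (simp add: add_increasing)
          qed
        qed
        from time_integral_bound[OF t g(1) ab(1) zero_less_one zero_less_one ab(4) this]
        have "\<bar>v t x\<bar> \<le> P * (t powr (1 - b1) / (1 - b1)) + Q * (t powr (1 - a2) / (1 - a2))"
          by (simp add: g(3))
        also have "P * (t powr (1 - b1) / (1 - b1)) = K1 * D1 * (t powr (-(R - 2 - l) / 2) * n)"
        proof -
          have "(t / 2) powr (-a1) * t powr (1 - b1) = (1/2) powr (-a1) * t powr (-(R - 2 - l) / 2)"
          proof -
            have "-a1 + (1 - b1) = -(R - 2 - l) / 2" by (simp add: a1_def b1_def field_simps)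
            hence "t powr (-a1) * t powr (1 - b1) = t powr (-(R - 2 - l) / 2)"
              by (simp only: powr_add[symmetric])
            moreover have "(t / 2) powr (-a1) = (1/2) powr (-a1) * t powr (-a1)"
              using t powr_mult[of "1/2" t "-a1"] by simp
            ultimately show ?thesis by simp
          qed
          thus ?thesis by (simp add: P_def K1_def field_simps)
        qed
        also have "Q * (t powr (1 - a2) / (1 - a2)) = K2 * D2 * (t powr (-(R - 2 - l) / 2) * n)"
        proof -
          have "(t / 2) powr (-b2) * t powr (1 - a2) = (1/2) powr (-b2) * t powr (-(R - 2 - l) / 2)"
          proof -
            have "-b2 + (1 - a2) = -(R - 2 - l) / 2" by (simp add: b2_def a2_def field_simps)
            hence "t powr (-b2) * t powr (1 - a2) = t powr (-(R - 2 - l) / 2)"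
              by (simp only: powr_add[symmetric])
            moreover have "(t / 2) powr (-b2) = (1/2) powr (-b2) * t powr (-b2)"
              using t powr_mult[of "1/2" t "-b2"] by simp
            ultimately show ?thesis by simp
          qed
          thus ?thesis by (simp add: Q_def K2_def field_simps)
        qed
        also have "K1 * D1 * (t powr (-(R - 2 - l) / 2) * n) + K2 * D2 * (t powr (-(R - 2 - l) / 2) * n)
           \<le> max K1 K2 * D1 * (t powr (-(R - 2 - l) / 2) * n) + max K1 K2 * D2 * (t powr (-(R - 2 - l) / 2) * n)"
          using D n by (intro add_mono mult_right_mono) auto
        finally show ?case by (simp add: n_def algebra_simps)
      qed
    qed
  qed
qed

text \<open>The bootstrap controls its source only by a sum of two majorants of different degrees,
  and the source itself is not split. Each majorant keeps its weight on the whole time interval, so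
  both of its end point singularities have to be integrable.\<close>

lemma duhamel_decays_sum:
  fixes R1 q1 l1 R2 q2 l2 :: real
  assumes 1: "0 \<le> l1" "l1 \<le> q1" "q1 < DIM('a::euclidean_space)" "R1 - 2 < q1" "q1 \<le> R1" "q1 < l1 + 2"
    and 2: "0 \<le> l2" "l2 \<le> q2" "q2 < DIM('a)" "R2 - 2 < q2" "q2 \<le> R2" "q2 < l2 + 2"
  obtains C where "C > 0" and
    "\<And>(h :: real \<Rightarrow> 'a \<Rightarrow> real) v D1 D2 t. D1 \<ge> 0 \<Longrightarrow> D2 \<ge> 0 \<Longrightarrow> duhamel_term h v \<Longrightarrow>
       (\<And>t. t > 0 \<Longrightarrow> AE y in lebesgue. \<bar>h t y\<bar> \<le> D1 * (t powr (-(R1 - q1) / 2) * norm y powr (-q1))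
          + D2 * (t powr (-(R2 - q2) / 2) * norm y powr (-q2))) \<Longrightarrow> t > 0 \<Longrightarrow>
       AE x in lebesgue. \<bar>v t x\<bar> \<le> C * (D1 * (t powr (-(R1 - 2 - l1) / 2) * norm x powr (-l1))
          + D2 * (t powr (-(R2 - 2 - l2) / 2) * norm x powr (-l2)))"
proof -
  have q0: "0 \<le> q1" "0 \<le> q2" using 1 2 by auto
  obtain C0 where C0: "C0 > 0"
    "\<And>t (x::'a) l1 l2 D1 D2 h. t > 0 \<Longrightarrow> x \<noteq> 0 \<Longrightarrow> 0 \<le> l1 \<Longrightarrow> l1 \<le> q1 \<Longrightarrow> 0 \<le> l2 \<Longrightarrow> l2 \<le> q2 \<Longrightarrow>
      D1 \<ge> 0 \<Longrightarrow> D2 \<ge> 0 \<Longrightarrow>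
      AE y in lebesgue. \<bar>h y\<bar> \<le> D1 * norm y powr (-q1) + D2 * norm y powr (-q2) \<Longrightarrow>
      \<bar>heat_semigroup t h x\<bar> \<le> C0 * (D1 * (t powr (-(q1 - l1) / 2) * norm x powr (-l1))
        + D2 * (t powr (-(q2 - l2) / 2) * norm x powr (-l2)))"
    using heat_semigroup_bound2[OF q0(1) 1(3) q0(2) 2(3)] by blast
  define b1 where "b1 = (R1 - q1) / 2"
  define b2 where "b2 = (R2 - q2) / 2"
  define a1 where "a1 = (q1 - l1) / 2"
  define a2 where "a2 = (q2 - l2) / 2"
  have ab: "b1 < 1" "b2 < 1" "a1 < 1" "a2 < 1" "0 \<le> b1" "0 \<le> b2" "0 \<le> a1" "0 \<le> a2"
    using 1 2 by (auto simp: a1_def a2_def b1_def b2_def)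
  \<comment> \<open>An upper bound for the Beta integral of (1 - s)^(-a) s^(-b) over (0, 1), as it
    results from \<open>beta_integrand_le\<close>.\<close>
  define L where "L a b = (1/2) powr (-a) / (1 - b) + (1/2) powr (-b) / (1 - a)" for a b :: real
  have L: "L a1 b1 > 0" "L a2 b2 > 0" using ab unfolding L_def by (intro add_pos_pos divide_pos_pos; simp)+
  have Leq: "(t / 2) powr (-a) * (t powr (1 - b) / (1 - b)) + (t / 2) powr (-b) * (t powr (1 - a) / (1 - a))
      = L a b * t powr (1 - a - b)" if "t > 0" for a b t :: real
  proof -
    have e: "-a + (1 - b) = 1 - a - b" "-b + (1 - a) = 1 - a - b" by auto
    have "t powr (-a) * t powr (1 - b) = t powr (1 - a - b)" "t powr (-b) * t powr (1 - a) = t powr (1 - a - b)"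
      by (simp_all only: powr_add[symmetric] e)
    moreover have "(t / 2) powr (-c) = (1/2) powr (-c) * t powr (-c)" for c
      using that powr_mult[of "1/2" t "-c"] by simp
    ultimately have "(t / 2) powr (-a) * t powr (1 - b) = (1/2) powr (-a) * t powr (1 - a - b)"
      "(t / 2) powr (-b) * t powr (1 - a) = (1/2) powr (-b) * t powr (1 - a - b)"
      by (simp_all only: mult.assoc)
    thus ?thesis by (simp add: L_def distrib_right)
  qed
  define C where "C = C0 * max (L a1 b1) (L a2 b2)"
  have "C > 0" using C0(1) L by (simp add: C_def)
  moreover have "AE x in lebesgue. \<bar>v t x\<bar> \<le> C * (D1 * (t powr (-(R1 - 2 - l1) / 2) * norm x powr (-l1))
          + D2 * (t powr (-(R2 - 2 - l2) / 2) * norm x powr (-l2)))"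
    if D: "D1 \<ge> 0" "D2 \<ge> 0" and v: "duhamel_term h v"
      and h: "\<And>t. t > 0 \<Longrightarrow> AE y in lebesgue. \<bar>h t y\<bar> \<le> D1 * (t powr (-(R1 - q1) / 2) * norm y powr (-q1))
          + D2 * (t powr (-(R2 - q2) / 2) * norm y powr (-q2))"
      and t: "t > 0" for h v :: "real \<Rightarrow> 'a \<Rightarrow> real" and D1 D2 t
  proof -
    from v t have "AE x in lebesgue. \<exists>g. set_integrable lebesgue {0<..<t} g \<and>
       (AE s in lebesgue. 0 < s \<and> s < t \<longrightarrow> g s = heat_semigroup (t - s) (h s) x) \<and>
       v t x = (LINT s:{0<..<t}|lebesgue. g s)" by (simp add: duhamel_term_def)
    thus ?thesis
      using AE_lebesgue_nonzero
    proof eventually_elim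
      case (elim x)
      then obtain g where g: "set_integrable lebesgue {0<..<t} g"
        "AE s in lebesgue. 0 < s \<and> s < t \<longrightarrow> g s = heat_semigroup (t - s) (h s) x"
        "v t x = (LINT s:{0<..<t}|lebesgue. g s)" by blast
      have x: "x \<noteq> 0" using elim by simp
      define M1 where "M1 = C0 * D1 * norm x powr (-l1)"
      define M2 where "M2 = C0 * D2 * norm x powr (-l2)"
      have M: "M1 \<ge> 0" "M2 \<ge> 0" using C0(1) D by (auto simp: M1_def M2_def)
      have "AE s in lebesgue. 0 < s \<and> s < t \<longrightarrow> \<bar>g s\<bar>
           \<le> M1 * (t / 2) powr (-a1) * s powr (-b1) + M1 * (t / 2) powr (-b1) * (t - s) powr (-a1)
           + (M2 * (t / 2) powr (-a2) * s powr (-b2) + M2 * (t / 2) powr (-b2) * (t - s) powr (-a2))"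
        using g(2)
      proof (eventually_elim, intro impI)
        fix s assume "0 < s \<and> s < t \<longrightarrow> g s = heat_semigroup (t - s) (h s) x" "0 < s \<and> s < t"
        hence s: "0 < s" "s < t" and gs: "g s = heat_semigroup (t - s) (h s) x" by auto
        have "\<bar>g s\<bar> \<le> C0 * (D1 * s powr (-b1) * ((t - s) powr (-(q1 - l1) / 2) * norm x powr (-l1))
            + D2 * s powr (-b2) * ((t - s) powr (-(q2 - l2) / 2) * norm x powr (-l2)))"
          unfolding gs using s x 1 2 D h[OF s(1)]
          by (intro C0(2)) (auto simp: b1_def b2_def mult.assoc minus_divide_left)
        also have "\<dots> = M1 * ((t - s) powr (-a1) * s powr (-b1)) + M2 * ((t - s) powr (-a2) * s powr (-b2))"
          by (simp add: M1_def M2_def a1_def a2_def algebra_simps minus_divide_left)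
        also have "\<dots> \<le> M1 * ((t / 2) powr (-a1) * s powr (-b1) + (t / 2) powr (-b1) * (t - s) powr (-a1))
          + M2 * ((t / 2) powr (-a2) * s powr (-b2) + (t / 2) powr (-b2) * (t - s) powr (-a2))"
          using ab s M by (intro add_mono mult_left_mono beta_integrand_le)
        finally show "\<bar>g s\<bar>
           \<le> M1 * (t / 2) powr (-a1) * s powr (-b1) + M1 * (t / 2) powr (-b1) * (t - s) powr (-a1)
           + (M2 * (t / 2) powr (-a2) * s powr (-b2) + M2 * (t / 2) powr (-b2) * (t - s) powr (-a2))"
          by (simp only: distrib_left mult.assoc)
      qed
      from time_integral_bound[OF t g(1) ab(1,2,3,4) this]
      have "\<bar>v t x\<bar> \<le> M1 * ((t / 2) powr (-a1) * (t powr (1 - b1) / (1 - b1)) + (t / 2) powr (-b1) * (t powr (1 - a1) / (1 - a1)))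
         + M2 * ((t / 2) powr (-a2) * (t powr (1 - b2) / (1 - b2)) + (t / 2) powr (-b2) * (t powr (1 - a2) / (1 - a2)))"
        unfolding g(3) by (simp only: distrib_left mult.assoc)
      also have "\<dots> = M1 * (L a1 b1 * t powr (1 - a1 - b1)) + M2 * (L a2 b2 * t powr (1 - a2 - b2))"
        by (simp only: Leq[OF t])
      also have "1 - a1 - b1 = -(R1 - 2 - l1) / 2" by (simp add: a1_def b1_def field_simps)
      also have "1 - a2 - b2 = -(R2 - 2 - l2) / 2" by (simp add: a2_def b2_def field_simps)
      also have "M1 * (L a1 b1 * t powr (-(R1 - 2 - l1) / 2)) + M2 * (L a2 b2 * t powr (-(R2 - 2 - l2) / 2))
        \<le> M1 * (max (L a1 b1) (L a2 b2) * t powr (-(R1 - 2 - l1) / 2))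
          + M2 * (max (L a1 b1) (L a2 b2) * t powr (-(R2 - 2 - l2) / 2))"
        using M by (intro add_mono mult_left_mono mult_right_mono) auto
      also have "\<dots> = C * (D1 * (t powr (-(R1 - 2 - l1) / 2) * norm x powr (-l1))
          + D2 * (t powr (-(R2 - 2 - l2) / 2) * norm x powr (-l2)))"
        by (simp add: C_def M1_def M2_def algebra_simps)
      finally show ?case .
    qed
  qed
  ultimately show thesis by (rule that)
qed

text \<open>If \<open>w = f + v\<close>, where \<open>v\<close> is the Duhamel term of a small scale-invariant potential applied to \<open>w\<close>,
  then \<open>w\<close> inherits the decay of \<open>f\<close>. The defect halves at each passage through the integral equation,
  measured by explicit majorants: no Picard iterates occur, whose measurability in time would be an
  issue.\<close>

lemma decays_bootstrap:
  fixes p k s k' r :: real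
  assumes p: "0 < p" "p < 2"
    and k: "0 \<le> k" "k \<le> s" "s < k + p" "k + p < DIM('a::euclidean_space)"
    and k': "0 \<le> k'" "k' \<le> r" "r < k' + p" "k' + p < DIM('a)"
  obtains B0 where "B0 > 0" and
    "\<And>(w :: real \<Rightarrow> 'a \<Rightarrow> real) f h v B F K. 0 \<le> B \<Longrightarrow> B \<le> B0 \<Longrightarrow> F \<ge> 0 \<Longrightarrow> K \<ge> 0 \<Longrightarrow>
      decays s k K w \<Longrightarrow> decays r k' F f \<Longrightarrow> duhamel_term h v \<Longrightarrow>
      (\<And>t. t > 0 \<Longrightarrow> AE y in lebesgue. \<bar>h t y\<bar> \<le> B * (t powr (-(2 - p) / 2) * norm y powr (-p) * \<bar>w t y\<bar>)) \<Longrightarrow>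
      (\<And>t. t > 0 \<Longrightarrow> AE x in lebesgue. \<bar>w t x\<bar> \<le> \<bar>f t x\<bar> + \<bar>v t x\<bar>) \<Longrightarrow>
      decays r k' (2 * F) w"
proof -
  \<comment> \<open>Multiplication by the potential raises the degree by 2 and the weight by p; the
    Duhamel integral takes the 2 back and returns to the original weight.\<close>
  obtain C where C: "C > 0" and est:
    "\<And>(h :: real \<Rightarrow> 'a \<Rightarrow> real) v D1 D2 t. D1 \<ge> 0 \<Longrightarrow> D2 \<ge> 0 \<Longrightarrow> duhamel_term h v \<Longrightarrow>
       (\<And>t. t > 0 \<Longrightarrow> AE y in lebesgue. \<bar>h t y\<bar>
            \<le> D1 * (t powr (-(r + 2 - (k' + p)) / 2) * norm y powr (-(k' + p)))
          + D2 * (t powr (-(s + 2 - (k + p)) / 2) * norm y powr (-(k + p)))) \<Longrightarrow> t > 0 \<Longrightarrow>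
       AE x in lebesgue. \<bar>v t x\<bar> \<le> C * (D1 * (t powr (-(r + 2 - 2 - k') / 2) * norm x powr (-k'))
          + D2 * (t powr (-(s + 2 - 2 - k) / 2) * norm x powr (-k)))"
    by (rule duhamel_decays_sum[where 'a='a and ?l1.0=k' and ?q1.0="k'+p" and ?R1.0="r+2"
        and ?l2.0=k and ?q2.0="k+p" and ?R2.0="s+2"]) (use p k k' in auto)
  show thesis
  \<comment> \<open>With this threshold C * B is at most 1/2, so a passage through the Duhamel term
    halves both majorants.\<close>
  proof (rule that[of "1 / (2 * C)"])
    show "1 / (2 * C) > 0" using C by simp
    fix w f h v :: "real \<Rightarrow> 'a \<Rightarrow> real" and B F K :: real
    assume B: "0 \<le> B" "B \<le> 1 / (2 * C)" and FK: "F \<ge> 0" "K \<ge> 0"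
      and w: "decays s k K w" and f: "decays r k' F f" and v: "duhamel_term h v"
      and h: "\<And>t. t > 0 \<Longrightarrow> AE y in lebesgue. \<bar>h t y\<bar> \<le> B * (t powr (-(2 - p) / 2) * norm y powr (-p) * \<bar>w t y\<bar>)"
      and wfv: "\<And>t. t > 0 \<Longrightarrow> AE x in lebesgue. \<bar>w t x\<bar> \<le> \<bar>f t x\<bar> + \<bar>v t x\<bar>"
    have CB: "C * B \<le> 1 / 2" using B C by (simp add: field_simps)
    define T1 where "T1 t x = t powr (-(r - k') / 2) * norm x powr (-k')" for t and x :: 'a
    define T2 where "T2 t x = t powr (-(s - k) / 2) * norm x powr (-k)" for t and x :: 'a
    have T: "T1 t x \<ge> 0" "T2 t x \<ge> 0" for t x by (simp_all add: T1_def T2_def)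
    \<comment> \<open>The value 2 F is the fixed point of X -> F + X / 2, so the first term
      reproduces itself while the a priori bound K is halved. In the limit K disappears, which is
      why the final constant depends on F alone.\<close>
    have step: "AE x in lebesgue. \<bar>w t x\<bar> \<le> 2 * F * T1 t x + K / 2 ^ n * T2 t x" if "t > 0" for n t
      using that
    proof (induction n arbitrary: t)
      case 0
      from decaysD[OF w 0] show ?case
      proof eventually_elim
        case (elim x)
        thus ?case using FK T[of t x] by (simp add: T2_def add_increasing)
      qed
    next
      case (Suc n)
      have "AE y in lebesgue. \<bar>h t y\<bar>
            \<le> (B * (2 * F)) * (t powr (-(r + 2 - (k' + p)) / 2) * norm y powr (-(k' + p)))
          + (B * (K / 2 ^ n)) * (t powr (-(s + 2 - (k + p)) / 2) * norm y powr (-(k + p)))"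
        if t: "t > 0" for t
        using h[OF t] Suc.IH[OF t]
      proof eventually_elim
        case (elim y)
        have "\<bar>h t y\<bar> \<le> B * (t powr (-(2 - p) / 2) * norm y powr (-p) * (2 * F * T1 t y + K / 2 ^ n * T2 t y))"
          using elim B(1) by (elim order_trans) (intro mult_left_mono; simp)
        moreover have "t powr (-(2 - p) / 2) * norm y powr (-p) * T1 t y
            = t powr (-(r + 2 - (k' + p)) / 2) * norm y powr (-(k' + p))"
        proof -
          have "-(2 - p) / 2 + -(r - k') / 2 = -(r + 2 - (k' + p)) / 2" "-p + -k' = -(k' + p)"
            by (simp_all add: field_simps)
          moreover have "t powr (-(2 - p) / 2) * norm y powr (-p) * T1 t y
             = (t powr (-(2 - p) / 2) * t powr (-(r - k') / 2)) * (norm y powr (-p) * norm y powr (-k'))"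
            unfolding T1_def by (simp only: mult_ac)
          ultimately show ?thesis by (simp only: powr_add[symmetric])
        qed
        moreover have "t powr (-(2 - p) / 2) * norm y powr (-p) * T2 t y
            = t powr (-(s + 2 - (k + p)) / 2) * norm y powr (-(k + p))"
        proof -
          have "-(2 - p) / 2 + -(s - k) / 2 = -(s + 2 - (k + p)) / 2" "-p + -k = -(k + p)"
            by (simp_all add: field_simps)
          moreover have "t powr (-(2 - p) / 2) * norm y powr (-p) * T2 t y
             = (t powr (-(2 - p) / 2) * t powr (-(s - k) / 2)) * (norm y powr (-p) * norm y powr (-k))"
            unfolding T2_def by (simp only: mult_ac)
          ultimately show ?thesis by (simp only: powr_add[symmetric])
        qed
        ultimately show ?case by (simp add: algebra_simps)
      qed
      from est[OF _ _ v this Suc.prems] B FK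
      have "AE x in lebesgue. \<bar>v t x\<bar> \<le> C * (B * (2 * F) * T1 t x + B * (K / 2 ^ n) * T2 t x)"
        by (simp add: T1_def T2_def)
      with wfv[OF Suc.prems] decaysD[OF f Suc.prems] show ?case
      proof eventually_elim
        case (elim x)
        have "C * (B * (2 * F) * T1 t x + B * (K / 2 ^ n) * T2 t x)
           = (C * B) * (2 * F * T1 t x + K / 2 ^ n * T2 t x)" by (simp add: algebra_simps)
        also have "\<dots> \<le> (1 / 2) * (2 * F * T1 t x + K / 2 ^ n * T2 t x)"
          using CB FK T[of t x] by (intro mult_right_mono add_nonneg_nonneg mult_nonneg_nonneg) auto
        also have "\<dots> = F * T1 t x + K / 2 ^ Suc n * T2 t x" by simp
        finally show ?case using elim by (simp add: T1_def)
      qed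
    qed
    show "decays r k' (2 * F) w"
      unfolding decays_def
    proof (intro allI impI)
      fix t :: real assume t: "t > 0"
      have "AE x in lebesgue. \<forall>n. \<bar>w t x\<bar> \<le> 2 * F * T1 t x + K / 2 ^ n * T2 t x"
        using step[OF t] by (simp add: AE_all_countable)
      thus "AE x in lebesgue. \<bar>w t x\<bar> \<le> 2 * F * (t powr (-(r - k') / 2) * norm x powr (-k'))"
      proof eventually_elim
        case (elim x)
        have "(\<lambda>n. 2 * F * T1 t x + K / 2 ^ n * T2 t x) \<longlonglongrightarrow> 2 * F * T1 t x + 0 * T2 t x"
          by (intro tendsto_intros) real_asymp
        hence "\<bar>w t x\<bar> \<le> 2 * F * T1 t x + 0 * T2 t x"
          by (rule LIMSEQ_le_const) (use elim in auto)
        thus ?case by (simp add: T1_def)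
      qed
    qed
  qed
qed

text \<open>Majorants multiply by adding degrees and weights, and the potential has degree 2 + 2
  \<eta> and weight p. Since the Duhamel integral gives back 2, the net gain is 2 \<eta>.\<close>

lemma source_decays:
  assumes w: "decays r l X w" and B: "B \<ge> 0"
    and h: "\<And>t. t > 0 \<Longrightarrow>
      AE y in lebesgue. \<bar>h t y\<bar> \<le> B * (t powr (-(2 - p) / 2 - \<eta>) * norm y powr (-p) * \<bar>w t y\<bar>)"
  shows "decays (r + 2 + 2 * \<eta>) (l + p) (B * X) h"
  unfolding decays_def
proof (intro allI impI)
  fix t :: real assume t: "t > 0"
  from h[OF t] decaysD[OF w t]
  show "AE y in lebesgue. \<bar>h t y\<bar> \<le> B * X * (t powr (-(r + 2 + 2 * \<eta> - (l + p)) / 2) * norm y powr (-(l + p)))"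
  proof eventually_elim
    case (elim y)
    have "\<bar>h t y\<bar> \<le> B * (t powr (-(2 - p) / 2 - \<eta>) * norm y powr (-p) *
        (X * (t powr (-(r - l) / 2) * norm y powr (-l))))"
      using elim B by (elim order_trans) (intro mult_left_mono; simp)
    also have "\<dots> = B * X * ((t powr (-(2 - p) / 2 - \<eta>) * t powr (-(r - l) / 2)) * (norm y powr (-p) * norm y powr (-l)))"
      by (simp only: mult_ac)
    also have "\<dots> = B * X * (t powr (-(2 - p) / 2 - \<eta> + -(r - l) / 2) * norm y powr (-p + -l))"
      by (simp only: powr_add)
    also have "-(2 - p) / 2 - \<eta> + -(r - l) / 2 = -(r + 2 + 2 * \<eta> - (l + p)) / 2" by (simp add: field_simps)
    also have "-p + -l = -(l + p)" by simp
    finally show ?case .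
  qed
qed

text \<open>One passage through the integral equation lowers the weight by up to \<open>2 - p\<close>.\<close>

lemma decays_all_weights:
  fixes w f h v :: "real \<Rightarrow> 'a::euclidean_space \<Rightarrow> real" and p k r :: real
  assumes p: "0 < p" "p < 2"
    and k: "0 \<le> k" "k \<le> r" "r < k + p" "k + p < DIM('a)"
    and w: "decays r k X w" "X \<ge> 0"
    and f: "F \<ge> 0" "\<And>l. 0 \<le> l \<Longrightarrow> l \<le> r \<Longrightarrow> decays r l F f"
    and v: "duhamel_term h v" and B: "B \<ge> 0"
    and h: "\<And>t. t > 0 \<Longrightarrow> AE y in lebesgue. \<bar>h t y\<bar> \<le> B * (t powr (-(2 - p) / 2) * norm y powr (-p) * \<bar>w t y\<bar>)"
    and wfv: "\<And>t. t > 0 \<Longrightarrow> AE x in lebesgue. \<bar>w t x\<bar> \<le> \<bar>f t x\<bar> + \<bar>v t x\<bar>"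
  shows "\<exists>C>0. \<forall>l. 0 \<le> l \<and> l \<le> r \<longrightarrow> decays r l C w"
proof -
  have src: "decays (r + 2) (l + p) (B * Y) h" if "decays r l Y w" for l Y
    using source_decays[OF that B, of h p 0] h by simp
  \<comment> \<open>The original weight k treats the source on the first half of the time interval,
    where r < k + p makes it integrable at 0; the weight l1 reached so far treats it on the second
    half.\<close>
  have step: "\<exists>Z\<ge>0. decays r l Z w"
    if l1: "decays r l1 Y w" "Y \<ge> 0" "l1 + p < DIM('a)" "l1 + p \<le> r + 2" and l: "0 \<le> l" "l \<le> r" "l \<le> l1 + p" "l1 + p < l + 2"
    for l l1 Y
  proof -
    obtain C where C: "C > 0"
      "\<And>(h :: real \<Rightarrow> 'a \<Rightarrow> real) v D1 D2. D1 \<ge> 0 \<Longrightarrow> D2 \<ge> 0 \<Longrightarrow> duhamel_term h v \<Longrightarrow>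
       decays (r + 2) (k + p) D1 h \<Longrightarrow> decays (r + 2) (l1 + p) D2 h \<Longrightarrow> decays (r + 2 - 2) l (C * (D1 + D2)) v"
      by (rule duhamel_decays[where 'a='a and R="r+2" and ?q1.0="k+p" and ?q2.0="l1+p" and l=l])
        (use p k l l1 in auto)
    have "decays (r + 2 - 2) l (C * (B * X + B * Y)) v"
      using B w l1 by (intro C(2)[OF _ _ v src src]) auto
    hence "decays r l (F + C * (B * X + B * Y)) w"
      by (intro decays_add[OF f(2)[OF l(1,2)] _ wfv]) simp_all
    thus ?thesis using f(1) C(1) B w l1 by (intro exI[of _ "F + C * (B * X + B * Y)"]) auto
  qed
  \<comment> \<open>Each step uses only half of the possible decrease 2 - p, which keeps the
    inequality l1 + p < l + 2 strict.\<close>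
  have down: "\<exists>Z\<ge>0. decays r l Z w" if "0 \<le> l" "l \<le> k" "k - real n * ((2 - p) / 2) \<le> l" for l n
    using that
  proof (induction n arbitrary: l)
    case 0
    hence "l = k" by simp
    thus ?case using w by blast
  next
    case (Suc n)
    define l1 where "l1 = min k (l + (2 - p) / 2)"
    have l1: "0 \<le> l1" "l1 \<le> k" "k - real n * ((2 - p) / 2) \<le> l1" "l \<le> l1" "l1 \<le> l + (2 - p) / 2"
    proof -
      have "real n * ((2 - p) / 2) \<ge> 0" using p by simp
      moreover have "k - real n * ((2 - p) / 2) \<le> l + (2 - p) / 2"
        using Suc.prems(3) by (simp add: field_simps)
      ultimately show "0 \<le> l1" "l1 \<le> k" "k - real n * ((2 - p) / 2) \<le> l1" "l \<le> l1" "l1 \<le> l + (2 - p) / 2"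
        using Suc.prems p by (auto simp: l1_def)
    qed
    obtain Y where "Y \<ge> 0" "decays r l1 Y w" using Suc.IH[OF l1(1-3)] by blast
    thus ?case using l1 Suc.prems k p by (intro step[of l1 Y]) (auto simp: field_simps)
  qed
  obtain n where n: "k < real n * ((2 - p) / 2)"
    using p reals_Archimedean3[of "(2 - p) / 2"] by auto
  obtain Z0 where Z0: "Z0 \<ge> 0" "decays r 0 Z0 w" using down[of 0 n] n k by auto
  \<comment> \<open>Upwards a single passage from k reaches the weight r, because r < k + p. The
    weights between 0 and r then follow by interpolation.\<close>
  obtain Z1 where Z1: "Z1 \<ge> 0" "decays r r Z1 w"
    using step[of k X r] w k p by auto
  define C where "C = max Z0 Z1 + 1"
  have "C > 0" using Z0 by (simp add: C_def)
  moreover have "decays r l C w" if "0 \<le> l" "l \<le> r" for l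
    using that Z0 Z1 \<open>C > 0\<close>
    by (intro decays_interpolate[of r C w r l]) (auto intro: decays_mono simp: C_def)
  ultimately show ?thesis by blast
qed

text \<open>As w is already controlled with all weights, the two extreme weights of v can be treated
  directly: near the final time the source has weight p for the target 0 and weight k + p for the
  target r. The source has degree r + 2 + 2 \<eta>, and r + 2 \<eta> < k + p is its integrability at
  time 0.\<close>

lemma duhamel_decays_all_weights:
  fixes w h v :: "real \<Rightarrow> 'a::euclidean_space \<Rightarrow> real" and p k r \<eta> :: real
  assumes p: "0 < p" "p < 2" and \<eta>: "\<eta> \<ge> 0"
    and k: "0 \<le> k" "k \<le> r" "r + 2 * \<eta> < k + p" "k + p < DIM('a)"
    and w: "X \<ge> 0" "\<And>l. 0 \<le> l \<Longrightarrow> l \<le> r \<Longrightarrow> decays r l X w"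
    and v: "duhamel_term h v" and B: "B \<ge> 0"
    and h: "\<And>t. t > 0 \<Longrightarrow>
      AE y in lebesgue. \<bar>h t y\<bar> \<le> B * (t powr (-(2 - p) / 2 - \<eta>) * norm y powr (-p) * \<bar>w t y\<bar>)"
  shows "\<exists>C>0. \<forall>l. 0 \<le> l \<and> l \<le> r \<longrightarrow> decays (r + 2 * \<eta>) l C v"
proof -
  define R where "R = r + 2 + 2 * \<eta>"
  have src: "decays R (l + p) (B * X) h" if "0 \<le> l" "l \<le> r" for l
    unfolding R_def using source_decays[OF w(2)[OF that] B h] .
  obtain C0 where C0: "C0 > 0"
    "\<And>(h :: real \<Rightarrow> 'a \<Rightarrow> real) v D1 D2. D1 \<ge> 0 \<Longrightarrow> D2 \<ge> 0 \<Longrightarrow> duhamel_term h v \<Longrightarrow>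
       decays R (k + p) D1 h \<Longrightarrow> decays R (0 + p) D2 h \<Longrightarrow> decays (R - 2) 0 (C0 * (D1 + D2)) v"
    by (rule duhamel_decays[where 'a='a and R=R and ?q1.0="k+p" and ?q2.0="0+p" and l=0])
      (use p k \<eta> in \<open>auto simp: R_def\<close>)
  obtain C1 where C1: "C1 > 0"
    "\<And>(h :: real \<Rightarrow> 'a \<Rightarrow> real) v D1 D2. D1 \<ge> 0 \<Longrightarrow> D2 \<ge> 0 \<Longrightarrow> duhamel_term h v \<Longrightarrow>
       decays R (k + p) D1 h \<Longrightarrow> decays R (k + p) D2 h \<Longrightarrow> decays (R - 2) r (C1 * (D1 + D2)) v"
    by (rule duhamel_decays[where 'a='a and R=R and ?q1.0="k+p" and ?q2.0="k+p" and l=r])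
      (use p k \<eta> in \<open>auto simp: R_def\<close>)
  have BX: "B * X \<ge> 0" using B w(1) by simp
  have d0: "decays (R - 2) 0 (C0 * (B * X + B * X)) v" using k BX by (intro C0(2)[OF _ _ v src src]) auto
  have d1: "decays (R - 2) r (C1 * (B * X + B * X)) v" using k BX by (intro C1(2)[OF _ _ v src src]) auto
  define C where "C = max (C0 * (B * X + B * X)) (C1 * (B * X + B * X)) + 1"
  have "C0 * (B * X + B * X) \<ge> 0" using C0(1) BX by (intro mult_nonneg_nonneg) auto
  hence C: "C > 0" unfolding C_def by linarith
  have R2: "R - 2 = r + 2 * \<eta>" by (simp add: R_def)
  have "decays (R - 2) l C v" if "0 \<le> l" "l \<le> r" for l
    by (rule decays_interpolate[OF decays_mono[OF d0] decays_mono[OF d1]])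
      (use that C in \<open>auto simp: C_def\<close>)
  thus ?thesis using C unfolding R2 by blast
qed

text \<open>Provides, for any rate r below the dimension, a weight that plays the role of k for the
  rate of the scaling.\<close>

lemma exists_admissible_weight:
  fixes p r d :: real
  assumes "0 < p" "p < d" "0 < r" "r < d"
  obtains k where "0 \<le> k" "k \<le> r" "r < k + p" "k + p < d"
proof -
  have "max 0 (r - p) < min r (d - p)" using assms by auto
  then obtain k where "max 0 (r - p) < k" "k < min r (d - p)" using dense by blast
  thus thesis using that[of k] by auto
qed

section \<open>Mild solutions of the Hardy-Henon equation\<close>

lemma norm_powr_measurable_lebesgue [measurable]:
  "(\<lambda>x::'a::euclidean_space. norm x powr l) \<in> borel_measurable lebesgue"
  by (rule measurable_completion) measurable

lemma Linf_norm_le_of_decays: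
  assumes "w t \<in> borel_measurable lebesgue" "decays r l C w" "t > 0"
  shows "Linf_norm l (w t) \<le> ennreal (C * t powr (-(r - l) / 2))"
  unfolding Linf_norm_def
proof (rule esssup_I)
  show "(\<lambda>x. ennreal (norm x powr l * \<bar>w t x\<bar>)) \<in> borel_measurable lebesgue"
    using assms(1) by measurable
  from decaysD[OF assms(2,3)] AE_lebesgue_nonzero
  show "AE x in lebesgue. ennreal (norm x powr l * \<bar>w t x\<bar>) \<le> ennreal (C * t powr (-(r - l) / 2))"
  proof eventually_elim
    case (elim x)
    have "norm x powr l * \<bar>w t x\<bar> \<le> norm x powr l * (C * (t powr (-(r - l) / 2) * norm x powr (-l)))"
      using elim by (intro mult_left_mono) auto
    also have "\<dots> = C * t powr (-(r - l) / 2) * (norm x powr l * norm x powr (-l))" by (simp only: mult_ac)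
    also have "norm x powr l * norm x powr (-l) = 1" using elim by (simp flip: powr_add)
    finally show ?case by (intro ennreal_leI) simp
  qed
qed

lemma Linf_norm_ge:
  assumes "\<not> (AE x in lebesgue. norm x powr l * \<bar>f x\<bar> < b)"
  shows "ennreal b \<le> Linf_norm l f"
proof (rule ccontr)
  assume "\<not> ennreal b \<le> Linf_norm l f"
  hence lt: "Linf_norm l f < ennreal b" by simp
  have "AE x in lebesgue. ennreal (norm x powr l * \<bar>f x\<bar>) \<le> Linf_norm l f"
    unfolding Linf_norm_def by (rule esssup_AE)
  hence "AE x in lebesgue. norm x powr l * \<bar>f x\<bar> < b"
  proof eventually_elim
    case (elim x)
    hence "ennreal (norm x powr l * \<bar>f x\<bar>) < ennreal b" using lt by (rule le_less_trans)
    thus ?case by (subst (asm) ennreal_less_iff) auto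
  qed
  thus False using assms by blast
qed

lemma K_norm_le_iff_decays:
  fixes u :: "real \<Rightarrow> 'a::euclidean_space \<Rightarrow> real"
  assumes "\<And>t. t > 0 \<Longrightarrow> u t \<in> borel_measurable lebesgue" "M \<ge> 0"
  shows "K_norm \<gamma> \<alpha> k u \<le> ennreal M \<longleftrightarrow> decays ((2 + \<gamma>) / (\<alpha> - 1)) k M u"
proof -
  define s where "s = (2 + \<gamma>) / (\<alpha> - 1)"
  have "ennreal (t powr (1/2 * (s - k))) * Linf_norm k (u t) \<le> ennreal M \<longleftrightarrow>
     (AE x in lebesgue. \<bar>u t x\<bar> \<le> M * (t powr (-(s - k) / 2) * norm x powr (-k)))" if t: "t > 0" for t
  proof
    assume L: "ennreal (t powr (1/2 * (s - k))) * Linf_norm k (u t) \<le> ennreal M"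
    have "AE x in lebesgue. ennreal (norm x powr k * \<bar>u t x\<bar>) \<le> Linf_norm k (u t)"
      unfolding Linf_norm_def by (rule esssup_AE)
    thus "AE x in lebesgue. \<bar>u t x\<bar> \<le> M * (t powr (-(s - k) / 2) * norm x powr (-k))"
      using AE_lebesgue_nonzero
    proof eventually_elim
      case (elim x)
      have "ennreal (t powr (1/2 * (s - k)) * (norm x powr k * \<bar>u t x\<bar>))
         = ennreal (t powr (1/2 * (s - k))) * ennreal (norm x powr k * \<bar>u t x\<bar>)" by (simp add: ennreal_mult)
      also have "\<dots> \<le> ennreal (t powr (1/2 * (s - k))) * Linf_norm k (u t)"
        using elim by (intro mult_left_mono) auto
      also note L
      finally have "t powr (1/2 * (s - k)) * (norm x powr k * \<bar>u t x\<bar>) \<le> M" using assms(2) by simp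
      hence "t powr (1/2 * (s - k)) * (norm x powr k * \<bar>u t x\<bar>) * (t powr (-(s - k) / 2) * norm x powr (-k))
          \<le> M * (t powr (-(s - k) / 2) * norm x powr (-k))"
        by (rule mult_right_mono) simp
      moreover have "t powr (1/2 * (s - k)) * t powr (-(s - k) / 2) = 1"
        using t by (simp flip: powr_add add: field_simps)
      moreover have "norm x powr k * norm x powr (-k) = 1" using elim by (simp flip: powr_add)
      moreover have "t powr (1/2 * (s - k)) * (norm x powr k * \<bar>u t x\<bar>) * (t powr (-(s - k) / 2) * norm x powr (-k))
         = (t powr (1/2 * (s - k)) * t powr (-(s - k) / 2)) * (norm x powr k * norm x powr (-k)) * \<bar>u t x\<bar>"
        by (simp only: mult_ac)
      ultimately show ?case by (simp only: mult_1)
    qed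
  next
    assume "AE x in lebesgue. \<bar>u t x\<bar> \<le> M * (t powr (-(s - k) / 2) * norm x powr (-k))"
    \<comment> \<open>The function is extended by 0 to all other times, so that the estimate at the
      single time t becomes an instance of \<open>decays\<close>.\<close>
    hence "decays s k M (\<lambda>t'. if t' = t then u t else (\<lambda>_. 0))"
      using assms(2) by (auto simp: decays_def)
    from Linf_norm_le_of_decays[OF _ this t] assms(1)[OF t]
    have "Linf_norm k (u t) \<le> ennreal (M * t powr (-(s - k) / 2))" by simp
    hence "ennreal (t powr (1/2 * (s - k))) * Linf_norm k (u t)
       \<le> ennreal (t powr (1/2 * (s - k))) * ennreal (M * t powr (-(s - k) / 2))"
      by (intro mult_left_mono) auto
    also have "\<dots> = ennreal (M * (t powr (1/2 * (s - k)) * t powr (-(s - k) / 2)))"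
      using assms(2) by (simp add: mult_ac flip: ennreal_mult)
    also have "t powr (1/2 * (s - k)) * t powr (-(s - k) / 2) = t powr 0"
      by (simp flip: powr_add add: field_simps)
    finally show "ennreal (t powr (1/2 * (s - k))) * Linf_norm k (u t) \<le> ennreal M" using t by simp
  qed
  thus ?thesis by (auto simp: K_norm_def SUP_le_iff decays_def s_def)
qed

section \<open>Duhamel terms of solutions, and the nonlinearity as a potential\<close>

lemma mild_solution_duhamel_term:
  assumes "mild_solution a \<gamma> \<alpha> \<phi> u"
  obtains v where "duhamel_term (\<lambda>s. hardy_henon_nonlinearity \<gamma> \<alpha> (u s)) v"
    and "\<And>t. t > 0 \<Longrightarrow> AE x in lebesgue. u t x = heat_semigroup t \<phi> x + a * v t x"
proof (rule that)
  show "duhamel_term (\<lambda>s. hardy_henon_nonlinearity \<gamma> \<alpha> (u s))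
    (\<lambda>t x. LINT s:{0<..<t}|lebesgue. heat_semigroup (t - s) (hardy_henon_nonlinearity \<gamma> \<alpha> (u s)) x)"
    unfolding duhamel_term_def
  proof (intro allI impI)
    fix t :: real assume "t > 0"
    with assms have "AE x in lebesgue. set_integrable lebesgue {0<..<t}
        (\<lambda>s. heat_semigroup (t - s) (hardy_henon_nonlinearity \<gamma> \<alpha> (u s)) x)"
      by (auto simp: mild_solution_def elim: AE_mp)
    thus "AE x in lebesgue. \<exists>g. set_integrable lebesgue {0<..<t} g \<and>
       (AE s in lebesgue. 0 < s \<and> s < t \<longrightarrow> g s = heat_semigroup (t - s) (hardy_henon_nonlinearity \<gamma> \<alpha> (u s)) x) \<and>
       (LINT s:{0<..<t}|lebesgue. heat_semigroup (t - s) (hardy_henon_nonlinearity \<gamma> \<alpha> (u s)) x)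
         = (LINT s:{0<..<t}|lebesgue. g s)"
      by eventually_elim auto
  qed
qed (use assms in \<open>auto simp: mild_solution_def elim: AE_mp\<close>)

lemma mild_solution_diff:
  assumes 1: "mild_solution a \<gamma> \<alpha> \<phi>1 u1" and 2: "mild_solution a \<gamma> \<alpha> \<phi>2 u2"
  obtains v where
    "duhamel_term (\<lambda>s y. hardy_henon_nonlinearity \<gamma> \<alpha> (u1 s) y - hardy_henon_nonlinearity \<gamma> \<alpha> (u2 s) y) v"
    and "\<And>t. t > 0 \<Longrightarrow>
      AE x in lebesgue. u1 t x - u2 t x = heat_semigroup t (\<lambda>y. \<phi>1 y - \<phi>2 y) x + a * v t x"
proof -
  let ?N1 = "\<lambda>s. hardy_henon_nonlinearity \<gamma> \<alpha> (u1 s)"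
  let ?N2 = "\<lambda>s. hardy_henon_nonlinearity \<gamma> \<alpha> (u2 s)"
  let ?h = "\<lambda>s y. ?N1 s y - ?N2 s y"
  let ?I = "\<lambda>N t x. LINT s:{0<..<t}|lebesgue. heat_semigroup (t - s) (N s) x"
  define v where "v t x = ?I ?N1 t x - ?I ?N2 t x" for t x
  have main: "AE x in lebesgue. (\<exists>g. set_integrable lebesgue {0<..<t} g \<and>
       (AE s in lebesgue. 0 < s \<and> s < t \<longrightarrow> g s = heat_semigroup (t - s) (?h s) x) \<and>
       v t x = (LINT s:{0<..<t}|lebesgue. g s)) \<and>
      u1 t x - u2 t x = heat_semigroup t (\<lambda>y. \<phi>1 y - \<phi>2 y) x + a * v t x" if t: "t > 0" for t
  proof -
    from 1 t have "AE x in lebesgue. integrable lebesgue (\<lambda>y. heat_kernel t (x - y) * \<phi>1 y) \<and>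
        (AE s in lebesgue. 0 < s \<and> s < t \<longrightarrow> integrable lebesgue (\<lambda>y. heat_kernel (t - s) (x - y) * ?N1 s y)) \<and>
        set_integrable lebesgue {0<..<t} (\<lambda>s. heat_semigroup (t - s) (?N1 s) x) \<and>
        u1 t x = heat_semigroup t \<phi>1 x + a * ?I ?N1 t x"
      by (simp add: mild_solution_def)
    moreover from 2 t have "AE x in lebesgue. integrable lebesgue (\<lambda>y. heat_kernel t (x - y) * \<phi>2 y) \<and>
        (AE s in lebesgue. 0 < s \<and> s < t \<longrightarrow> integrable lebesgue (\<lambda>y. heat_kernel (t - s) (x - y) * ?N2 s y)) \<and>
        set_integrable lebesgue {0<..<t} (\<lambda>s. heat_semigroup (t - s) (?N2 s) x) \<and>
        u2 t x = heat_semigroup t \<phi>2 x + a * ?I ?N2 t x"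
      by (simp add: mild_solution_def)
    ultimately show ?thesis
    proof eventually_elim
      case (elim x)
      have lin: "heat_semigroup \<tau> (\<lambda>y. f1 y - f2 y) x = heat_semigroup \<tau> f1 x - heat_semigroup \<tau> f2 x"
        if "integrable lebesgue (\<lambda>y. heat_kernel \<tau> (x - y) * f1 y)"
           "integrable lebesgue (\<lambda>y. heat_kernel \<tau> (x - y) * f2 y)" for \<tau> f1 f2
        using that by (simp add: heat_semigroup_def right_diff_distrib)
      \<comment> \<open>The difference of the two integrands is integrable for this x. It equals the
        heat extension of the difference of the sources only at times where both spatial integrals
        converge, that is, at almost every s.\<close>
      define g where "g s = heat_semigroup (t - s) (?N1 s) x - heat_semigroup (t - s) (?N2 s) x" for s
      have "set_integrable lebesgue {0<..<t} g"
        using elim unfolding g_def by (intro set_integral_diff) auto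
      moreover have "v t x = (LINT s:{0<..<t}|lebesgue. g s)"
        using elim unfolding g_def v_def by (subst set_integral_diff) auto
      moreover have "AE s in lebesgue. 0 < s \<and> s < t \<longrightarrow> g s = heat_semigroup (t - s) (?h s) x"
      proof -
        have "AE s in lebesgue. 0 < s \<and> s < t \<longrightarrow> integrable lebesgue (\<lambda>y. heat_kernel (t - s) (x - y) * ?N1 s y)"
          "AE s in lebesgue. 0 < s \<and> s < t \<longrightarrow> integrable lebesgue (\<lambda>y. heat_kernel (t - s) (x - y) * ?N2 s y)"
          using elim by auto
        thus ?thesis by eventually_elim (simp add: g_def lin)
      qed
      moreover have "u1 t x - u2 t x = heat_semigroup t (\<lambda>y. \<phi>1 y - \<phi>2 y) x + a * v t x"
        using elim by (simp add: lin v_def algebra_simps)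
      ultimately show ?case by blast
    qed
  qed
  show thesis
  proof (rule that[of v])
    show "duhamel_term ?h v"
      unfolding duhamel_term_def using main by (auto elim: AE_mp)
  qed (use main in \<open>auto elim: AE_mp\<close>)
qed

text \<open>On either side of 0 the function is a power up to sign, and the mean value theorem
  applies; the end point 0 is separate because the derivative of \<open>powr\<close> is taken at
  positive arguments. For opposite signs each term is at most m^\<beta> times its modulus, and the
  moduli add up to |x - y|.\<close>

lemma abs_powr_mult_diff_le:
  fixes x y m \<beta> :: real
  assumes b: "\<beta> > 0" and x: "\<bar>x\<bar> \<le> m" and y: "\<bar>y\<bar> \<le> m"
  shows "\<bar>\<bar>x\<bar> powr \<beta> * x - \<bar>y\<bar> powr \<beta> * y\<bar> \<le> (1 + \<beta>) * m powr \<beta> * \<bar>x - y\<bar>"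
proof -
  have pos: "\<bar>z powr \<beta> * z - w powr \<beta> * w\<bar> \<le> (1 + \<beta>) * m powr \<beta> * \<bar>z - w\<bar>"
    if "0 \<le> w" "w < z" "z \<le> m" for z w :: real
  proof -
    have f: "c powr \<beta> * c = c powr (1 + \<beta>)" if "c \<ge> 0" for c :: real
      using that b by (simp add: powr_mult_base mult.commute)
    have mono: "w powr (1 + \<beta>) \<le> z powr (1 + \<beta>)" using that b by (intro powr_mono2) auto
    have "z powr (1 + \<beta>) - w powr (1 + \<beta>) \<le> (z - w) * ((1 + \<beta>) * m powr \<beta>)"
    proof (cases "w = 0")
      case True
      have "z * z powr \<beta> \<le> z * ((1 + \<beta>) * m powr \<beta>)"
      proof (rule mult_left_mono)
        have "z powr \<beta> \<le> 1 * m powr \<beta>" using that b powr_mono2[of \<beta> z m] by simp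
        also have "\<dots> \<le> (1 + \<beta>) * m powr \<beta>" using b by (intro mult_right_mono) auto
        finally show "z powr \<beta> \<le> (1 + \<beta>) * m powr \<beta>" .
      qed (use that in simp)
      moreover have "z powr (1 + \<beta>) = z * z powr \<beta>" using f[of z] that by (simp only: mult.commute)
      ultimately show ?thesis using True b by simp
    next
      case False
      have "\<exists>c>w. c < z \<and> z powr (1 + \<beta>) - w powr (1 + \<beta>) = (z - w) * ((1 + \<beta>) * c powr \<beta>)"
        using that False by (intro MVT2) (auto intro!: derivative_eq_intros)
      then obtain c where c: "w < c" "c < z"
        "z powr (1 + \<beta>) - w powr (1 + \<beta>) = (z - w) * ((1 + \<beta>) * c powr \<beta>)" by blast
      show ?thesis unfolding c(3) using c that b by (intro mult_left_mono powr_mono2) auto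
    qed
    moreover have "z powr \<beta> * z = z powr (1 + \<beta>)" "w powr \<beta> * w = w powr (1 + \<beta>)"
      using that by (auto intro: f)
    ultimately show ?thesis using mono that by (simp add: mult.commute[of "z - w"])
  qed
  have opp: "\<bar>\<bar>z\<bar> powr \<beta> * z - \<bar>w\<bar> powr \<beta> * w\<bar> \<le> (1 + \<beta>) * m powr \<beta> * \<bar>z - w\<bar>"
    if "w \<le> 0" "0 \<le> z" "\<bar>z\<bar> \<le> m" "\<bar>w\<bar> \<le> m" for z w :: real
  proof -
    have "\<bar>z\<bar> powr \<beta> * z \<le> m powr \<beta> * z" "\<bar>w\<bar> powr \<beta> * (-w) \<le> m powr \<beta> * (-w)"
      using that b by (intro mult_right_mono powr_mono2; simp)+
    moreover have "0 \<le> \<bar>z\<bar> powr \<beta> * z" "0 \<le> \<bar>w\<bar> powr \<beta> * (-w)" using that by (intro mult_nonneg_nonneg; simp)+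
    ultimately have "\<bar>\<bar>z\<bar> powr \<beta> * z - \<bar>w\<bar> powr \<beta> * w\<bar> \<le> 1 * (m powr \<beta> * (z - w))"
      by (simp add: right_diff_distrib)
    also have "\<dots> \<le> (1 + \<beta>) * (m powr \<beta> * (z - w))" using b that by (intro mult_right_mono) auto
    finally show ?thesis using that by simp
  qed
  consider "x = y" | "0 \<le> x" "x < y" | "0 \<le> y" "y < x" | "y \<le> 0" "x < y" | "x \<le> 0" "y < x"
    | "x \<le> 0" "0 \<le> y" | "y \<le> 0" "0 \<le> x" by linarith
  thus ?thesis
  proof cases
    case 1 thus ?thesis by simp
  next
    case 2 thus ?thesis using pos[of x y] y by (simp add: abs_minus_commute)
  next
    case 3 thus ?thesis using pos[of y x] x by simp
  next
    case 4 thus ?thesis using pos[of "-y" "-x"] x by (simp add: abs_minus_commute add.commute)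
  next
    case 5 thus ?thesis using pos[of "-x" "-y"] y by (simp add: abs_minus_commute add.commute)
  next
    case 6 thus ?thesis using opp[of x y] x y by (simp add: abs_minus_commute)
  next
    case 7 thus ?thesis using opp[of y x] x y by simp
  qed
qed

text \<open>Here \<eta> is (\<alpha> - 1) / 2 times the excess of the rate s over (2 + \<gamma>) /
  (\<alpha> - 1). At excess 0 the potential is scale invariant; a positive excess makes it decay
  faster in time.\<close>

lemma hardy_henon_nonlinearity_diff_le:
  fixes u1 u2 :: "real \<Rightarrow> 'a::euclidean_space \<Rightarrow> real"
  assumes \<alpha>: "\<alpha> > 1" and M: "M \<ge> 0" and u: "decays s k M u1" "decays s k M u2" and t: "t > 0"
    and p: "p = k * (\<alpha> - 1) - \<gamma>" and \<eta>: "\<eta> = (\<alpha> - 1) * (s - (2 + \<gamma>) / (\<alpha> - 1)) / 2"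
  shows "AE y in lebesgue.
    \<bar>hardy_henon_nonlinearity \<gamma> \<alpha> (u1 t) y - hardy_henon_nonlinearity \<gamma> \<alpha> (u2 t) y\<bar>
      \<le> \<alpha> * M powr (\<alpha> - 1) * (t powr (-(2 - p) / 2 - \<eta>) * norm y powr (-p) * \<bar>u1 t y - u2 t y\<bar>)"
  using decaysD[OF u(1) t] decaysD[OF u(2) t]
proof eventually_elim
  case (elim y)
  define m where "m = M * (t powr (-(s - k) / 2) * norm y powr (-k))"
  have "\<bar>\<bar>u1 t y\<bar> powr (\<alpha> - 1) * u1 t y - \<bar>u2 t y\<bar> powr (\<alpha> - 1) * u2 t y\<bar>
      \<le> (1 + (\<alpha> - 1)) * m powr (\<alpha> - 1) * \<bar>u1 t y - u2 t y\<bar>"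
    using \<alpha> elim unfolding m_def by (intro abs_powr_mult_diff_le) auto
  note le = this
  have N: "hardy_henon_nonlinearity \<gamma> \<alpha> (u1 t) y - hardy_henon_nonlinearity \<gamma> \<alpha> (u2 t) y
      = norm y powr \<gamma> * (\<bar>u1 t y\<bar> powr (\<alpha> - 1) * u1 t y - \<bar>u2 t y\<bar> powr (\<alpha> - 1) * u2 t y)"
    by (simp add: hardy_henon_nonlinearity_def algebra_simps)
  have m: "norm y powr \<gamma> * m powr (\<alpha> - 1)
      = M powr (\<alpha> - 1) * (t powr (-(2 - p) / 2 - \<eta>) * norm y powr (-p))"
  proof -
    have e: "-(s - k) / 2 * (\<alpha> - 1) = -(2 - p) / 2 - \<eta>" "\<gamma> + -k * (\<alpha> - 1) = -p"
      using \<alpha> by (simp_all add: p \<eta> field_simps)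
    have "m powr (\<alpha> - 1) = M powr (\<alpha> - 1) * (t powr (-(s - k) / 2 * (\<alpha> - 1)) * norm y powr (-k * (\<alpha> - 1)))"
      using M t by (simp add: m_def powr_mult powr_powr)
    moreover have "norm y powr \<gamma> * norm y powr (-k * (\<alpha> - 1)) = norm y powr (-p)"
      by (simp only: powr_add[symmetric] e)
    ultimately show ?thesis unfolding e by (metis mult.left_commute)
  qed
  have "\<bar>hardy_henon_nonlinearity \<gamma> \<alpha> (u1 t) y - hardy_henon_nonlinearity \<gamma> \<alpha> (u2 t) y\<bar>
      \<le> norm y powr \<gamma> * ((1 + (\<alpha> - 1)) * m powr (\<alpha> - 1) * \<bar>u1 t y - u2 t y\<bar>)"
    unfolding N abs_mult using le by (intro mult_mono) auto
  also have "\<dots> = \<alpha> * (norm y powr \<gamma> * m powr (\<alpha> - 1)) * \<bar>u1 t y - u2 t y\<bar>" by (simp add: mult_ac)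
  finally show ?case unfolding m by (simp only: mult.assoc)
qed

lemma hardy_henon_nonlinearity_le:
  fixes u :: "real \<Rightarrow> 'a::euclidean_space \<Rightarrow> real"
  assumes "\<alpha> > 1" "M \<ge> 0" "decays s k M u" "t > 0"
    and "p = k * (\<alpha> - 1) - \<gamma>" "\<eta> = (\<alpha> - 1) * (s - (2 + \<gamma>) / (\<alpha> - 1)) / 2"
  shows "AE y in lebesgue. \<bar>hardy_henon_nonlinearity \<gamma> \<alpha> (u t) y\<bar>
      \<le> \<alpha> * M powr (\<alpha> - 1) * (t powr (-(2 - p) / 2 - \<eta>) * norm y powr (-p) * \<bar>u t y\<bar>)"
proof -
  have "decays s k M (\<lambda>(t::real) (x::'a). 0 :: real)"
    using assms(2) by (simp add: decays_def)
  from hardy_henon_nonlinearity_diff_le[OF assms(1,2,3) this assms(4-6)]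
  show ?thesis by (simp add: hardy_henon_nonlinearity_def)
qed

section \<open>Scaling\<close>

lemma lebesgue_scale:
  assumes "c > 0"
  shows "(lebesgue :: 'a::euclidean_space measure)
    = density (distr lebesgue lebesgue ((*\<^sub>R) c)) (\<lambda>_. ennreal (c ^ DIM('a)))"
proof -
  have "(\<lambda>x::'a. 0 + (\<Sum>j\<in>Basis. (c * (x \<bullet> j)) *\<^sub>R j)) = (*\<^sub>R) c"
    unfolding scaleR_scaleR[symmetric] scaleR_sum_right[symmetric] euclidean_representation by simp
  thus ?thesis
    using lebesgue_affine_euclidean[of "\<lambda>_. c" "0::'a"] assms by (simp add: prod_ennreal ennreal_power)
qed

lemma AE_lebesgue_scale:
  assumes "c > 0" "AE x::'a::euclidean_space in lebesgue. P x"
  shows "AE x::'a in lebesgue. P (c *\<^sub>R x)"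
proof -
  have "AE x in density (distr lebesgue lebesgue ((*\<^sub>R) c)) (\<lambda>_. ennreal (c ^ DIM('a))). P (x::'a)"
    using assms lebesgue_scale[OF assms(1), where 'a='a] by metis
  hence "AE x in distr lebesgue lebesgue ((*\<^sub>R) c). P (x::'a)"
    using assms(1) by (subst (asm) AE_density) auto
  thus ?thesis by (rule AE_distrD[OF lebesgue_measurable_scaling])
qed

lemma integrable_lebesgue_scale:
  fixes f :: "'a::euclidean_space \<Rightarrow> real"
  assumes c: "c > 0" and f: "integrable lebesgue f"
  shows "integrable lebesgue (\<lambda>x. f (c *\<^sub>R x))"
    and "(LINT x|lebesgue. f x) = c ^ DIM('a) * (LINT x|lebesgue. f (c *\<^sub>R x))"
proof -
  have [measurable]: "f \<in> borel_measurable lebesgue" using f by (rule borel_measurable_integrable)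
  have m: "f \<in> borel_measurable (distr lebesgue lebesgue ((*\<^sub>R) c))" by simp
  have i: "integrable (density (distr lebesgue lebesgue ((*\<^sub>R) c)) (\<lambda>_. ennreal (c ^ DIM('a)))) f"
    using f lebesgue_scale[OF c, where 'a='a] by metis
  hence "integrable (distr lebesgue lebesgue ((*\<^sub>R) c)) f"
    using c m by (subst (asm) integrable_density) auto
  thus "integrable lebesgue (\<lambda>x. f (c *\<^sub>R x))"
    by (subst (asm) integrable_distr_eq) (auto intro: lebesgue_measurable_scaling)
  have "(LINT x|lebesgue. f x) = (LINT x|density (distr lebesgue lebesgue ((*\<^sub>R) c)) (\<lambda>_. ennreal (c ^ DIM('a))). f x)"
    using lebesgue_scale[OF c, where 'a='a] by metis
  also have "\<dots> = (LINT x|distr lebesgue lebesgue ((*\<^sub>R) c). c ^ DIM('a) * f x)"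
    using c m by (subst integral_density) auto
  also have "\<dots> = (LINT x|lebesgue. c ^ DIM('a) * f (c *\<^sub>R x))"
    by (subst integral_distr) (auto intro: lebesgue_measurable_scaling)
  finally show "(LINT x|lebesgue. f x) = c ^ DIM('a) * (LINT x|lebesgue. f (c *\<^sub>R x))" by simp
qed

text \<open>Scaling by 1 / c shows that both integrands are integrable or neither is, and in the
  latter case both integrals are 0. This lets the semigroup be rescaled for arbitrary data.\<close>

lemma integral_lebesgue_scale:
  fixes f :: "'a::euclidean_space \<Rightarrow> real"
  assumes c: "c > 0"
  shows "(LINT x|lebesgue. f x) = c ^ DIM('a) * (LINT x|lebesgue. f (c *\<^sub>R x))"
proof (cases "integrable lebesgue f")
  case True
  thus ?thesis by (rule integrable_lebesgue_scale[OF c])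
next
  case False
  have "\<not> integrable lebesgue (\<lambda>x. f (c *\<^sub>R x))"
  proof
    assume "integrable lebesgue (\<lambda>x. f (c *\<^sub>R x))"
    from integrable_lebesgue_scale(1)[OF _ this, of "1 / c"] c False show False by simp
  qed
  with False show ?thesis by (simp add: not_integrable_integral_eq)
qed

section \<open>Parabolic scaling of the kernel, the nonlinearity and the solutions\<close>

lemma heat_kernel_scale:
  assumes "c > 0" "t \<ge> 0"
  shows "heat_kernel (c\<^sup>2 * t) (c *\<^sub>R (z::'a::euclidean_space)) = c powr (- real DIM('a)) * heat_kernel t z"
proof -
  have "(4 * pi * (c\<^sup>2 * t)) powr (- real DIM('a) / 2) = (c\<^sup>2 * (4 * pi * t)) powr (- real DIM('a) / 2)"
    by (simp add: mult_ac)
  also have "\<dots> = (c\<^sup>2) powr (- real DIM('a) / 2) * (4 * pi * t) powr (- real DIM('a) / 2)"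
    using assms by (subst powr_mult) auto
  also have "(c\<^sup>2) powr (- real DIM('a) / 2) = c powr (- real DIM('a))"
    using assms by (simp add: powr_powr flip: powr_numeral)
  finally show ?thesis using assms by (simp add: heat_kernel_def power_mult_distrib)
qed

lemma heat_kernel_scale_diff:
  assumes "c > 0" "t \<ge> 0"
  shows "c ^ DIM('a) * heat_kernel (c\<^sup>2 * t) (c *\<^sub>R x - c *\<^sub>R y) = heat_kernel t (x - (y::'a::euclidean_space))"
proof -
  have "c ^ DIM('a) * c powr (- real DIM('a)) = 1" using assms by (simp flip: powr_realpow powr_add)
  thus ?thesis
    using heat_kernel_scale[OF assms, of "x - y"] by (simp add: scaleR_diff_right flip: mult.assoc)
qed

lemma heat_semigroup_scale:
  fixes h :: "'a::euclidean_space \<Rightarrow> real"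
  assumes c: "c > 0" and t: "t \<ge> 0"
  shows "heat_semigroup (c\<^sup>2 * t) h (c *\<^sub>R x) = heat_semigroup t (\<lambda>y. h (c *\<^sub>R y)) x"
proof -
  have "heat_semigroup (c\<^sup>2 * t) h (c *\<^sub>R x)
     = (LINT y|lebesgue. c ^ DIM('a) * (heat_kernel (c\<^sup>2 * t) (c *\<^sub>R x - c *\<^sub>R y) * h (c *\<^sub>R y)))"
    unfolding heat_semigroup_def by (subst integral_lebesgue_scale[OF c]) simp
  thus ?thesis unfolding mult.assoc[symmetric] heat_kernel_scale_diff[OF c t] by (simp add: heat_semigroup_def)
qed

lemma heat_integrable_scale:
  fixes h :: "'a::euclidean_space \<Rightarrow> real"
  assumes c: "c > 0" and t: "t \<ge> 0" and h: "integrable lebesgue (\<lambda>y. heat_kernel (c\<^sup>2 * t) (c *\<^sub>R x - y) * h y)"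
  shows "integrable lebesgue (\<lambda>y. heat_kernel t (x - y) * h (c *\<^sub>R y))"
proof -
  have "integrable lebesgue (\<lambda>y. c ^ DIM('a) * (heat_kernel (c\<^sup>2 * t) (c *\<^sub>R x - c *\<^sub>R y) * h (c *\<^sub>R y)))"
    using integrable_lebesgue_scale(1)[OF c h] by simp
  thus ?thesis unfolding mult.assoc[symmetric] heat_kernel_scale_diff[OF c t] .
qed

lemma heat_kernel_measurable_lebesgue [measurable]:
  "(\<lambda>y. heat_kernel t (x - y)) \<in> borel_measurable lebesgue"
  by (rule measurable_completion) measurable

lemma heat_semigroup_homogeneous:
  fixes \<Phi> :: "'a::euclidean_space \<Rightarrow> real"
  assumes c: "c > 0" and t: "t \<ge> 0" and m[measurable]: "\<Phi> \<in> borel_measurable lebesgue"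
    and hom: "AE y in lebesgue. \<Phi> (c *\<^sub>R y) = c powr (-s) * \<Phi> y"
  shows "heat_semigroup (c\<^sup>2 * t) \<Phi> (c *\<^sub>R x) = c powr (-s) * heat_semigroup t \<Phi> x"
proof -
  have [measurable]: "(\<lambda>y. \<Phi> (c *\<^sub>R y)) \<in> borel_measurable lebesgue"
    by (rule measurable_compose[OF lebesgue_measurable_scaling m])
  have "heat_semigroup (c\<^sup>2 * t) \<Phi> (c *\<^sub>R x) = heat_semigroup t (\<lambda>y. \<Phi> (c *\<^sub>R y)) x"
    by (rule heat_semigroup_scale[OF c t])
  also have "\<dots> = (LINT y|lebesgue. c powr (-s) * (heat_kernel t (x - y) * \<Phi> y))"
    unfolding heat_semigroup_def
  proof (rule integral_cong_AE)
    show "AE y in lebesgue. heat_kernel t (x - y) * \<Phi> (c *\<^sub>R y) = c powr (-s) * (heat_kernel t (x - y) * \<Phi> y)"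
      using hom by eventually_elim simp
  qed measurable
  finally show ?thesis by (simp add: heat_semigroup_def)
qed

text \<open>The exponent s is the one with s \<alpha> - \<gamma> = s + 2: the nonlinearity scales
  like the solution up to a factor c^2, which the time variable absorbs.\<close>

lemma hardy_henon_nonlinearity_scale:
  assumes \<alpha>: "\<alpha> > 1" and c: "c > 0" and s: "s = (2 + \<gamma>) / (\<alpha> - 1)"
  shows "hardy_henon_nonlinearity \<gamma> \<alpha> (\<lambda>x. c powr s * f (c *\<^sub>R x)) y
     = c powr (s + 2) * hardy_henon_nonlinearity \<gamma> \<alpha> f (c *\<^sub>R (y::'a::euclidean_space))"
proof -
  have "s * (\<alpha> - 1) + s = s + 2 + \<gamma>" using \<alpha> by (simp add: s)
  hence "c powr (s * (\<alpha> - 1)) * c powr s = c powr (s + 2) * c powr \<gamma>" by (simp only: powr_add[symmetric])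
  hence "c powr (s * (\<alpha> - 1)) * c powr s * z = c powr (s + 2) * c powr \<gamma> * z" for z by simp
  thus ?thesis using c
    by (simp add: hardy_henon_nonlinearity_def abs_mult powr_mult powr_powr mult_ac)
qed

lemma mild_solution_scale:
  fixes \<Phi> :: "'a::euclidean_space \<Rightarrow> real"
  assumes u: "mild_solution a \<gamma> \<alpha> \<Phi> u" and \<alpha>: "\<alpha> > 1" and c: "c > 0"
    and s: "s = (2 + \<gamma>) / (\<alpha> - 1)" and m[measurable]: "\<Phi> \<in> borel_measurable lebesgue"
    and hom: "AE y in lebesgue. \<Phi> (c *\<^sub>R y) = c powr (-s) * \<Phi> y"
  shows "mild_solution a \<gamma> \<alpha> \<Phi> (\<lambda>t x. c powr s * u (c\<^sup>2 * t) (c *\<^sub>R x))"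
proof -
  let ?N = "hardy_henon_nonlinearity \<gamma> \<alpha> :: ('a \<Rightarrow> real) \<Rightarrow> _"
  let ?v = "\<lambda>t x. c powr s * u (c\<^sup>2 * t) (c *\<^sub>R x)"
  have c2: "c\<^sup>2 > 0" using c by simp
  have N: "?N (?v \<tau>) y = c powr (s + 2) * ?N (u (c\<^sup>2 * \<tau>)) (c *\<^sub>R y)" for \<tau> y
    by (rule hardy_henon_nonlinearity_scale[OF \<alpha> c s])
  have heatN: "heat_semigroup (t - \<tau>) (?N (?v \<tau>)) x
      = c powr (s + 2) * heat_semigroup (c\<^sup>2 * t - c\<^sup>2 * \<tau>) (?N (u (c\<^sup>2 * \<tau>))) (c *\<^sub>R x)" if "\<tau> < t" for t \<tau> x
  proof -
    have "heat_semigroup (c\<^sup>2 * t - c\<^sup>2 * \<tau>) (?N (u (c\<^sup>2 * \<tau>))) (c *\<^sub>R x)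
       = heat_semigroup (t - \<tau>) (\<lambda>y. ?N (u (c\<^sup>2 * \<tau>)) (c *\<^sub>R y)) x"
      unfolding right_diff_distrib[symmetric] by (rule heat_semigroup_scale) (use c that in auto)
    moreover have "heat_semigroup (t - \<tau>) (?N (?v \<tau>)) x
      = (LINT y|lebesgue. c powr (s + 2) * (heat_kernel (t - \<tau>) (x - y) * ?N (u (c\<^sup>2 * \<tau>)) (c *\<^sub>R y)))"
      unfolding heat_semigroup_def N by (simp only: mult.left_commute)
    ultimately show ?thesis by (simp add: heat_semigroup_def)
  qed
  show ?thesis
    unfolding mild_solution_def
  proof (intro conjI allI impI)
    fix t :: real assume t: "t > 0"
    have "u (c\<^sup>2 * t) \<in> borel_measurable lebesgue" using u t c2 by (simp add: mild_solution_def)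
    from measurable_compose[OF lebesgue_measurable_scaling this]
    show "?v t \<in> borel_measurable lebesgue" by measurable
    define F where "F x = (\<lambda>\<tau>. heat_semigroup (c\<^sup>2 * t - \<tau>) (?N (u \<tau>)) (c *\<^sub>R x))" for x
    from u t c2 have "AE x in lebesgue.
        integrable lebesgue (\<lambda>y. heat_kernel (c\<^sup>2 * t) (x - y) * \<Phi> y) \<and>
        (AE \<tau> in lebesgue. 0 < \<tau> \<and> \<tau> < c\<^sup>2 * t \<longrightarrow>
           integrable lebesgue (\<lambda>y. heat_kernel (c\<^sup>2 * t - \<tau>) (x - y) * ?N (u \<tau>) y)) \<and>
        set_integrable lebesgue {0<..<c\<^sup>2 * t} (\<lambda>\<tau>. heat_semigroup (c\<^sup>2 * t - \<tau>) (?N (u \<tau>)) x) \<and>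
        u (c\<^sup>2 * t) x = heat_semigroup (c\<^sup>2 * t) \<Phi> x +
          a * (LINT \<tau>:{0<..<c\<^sup>2 * t}|lebesgue. heat_semigroup (c\<^sup>2 * t - \<tau>) (?N (u \<tau>)) x)"
      by (simp add: mild_solution_def)
    from AE_lebesgue_scale[OF c this]
    show "AE x in lebesgue.
        integrable lebesgue (\<lambda>y. heat_kernel t (x - y) * \<Phi> y) \<and>
        (AE \<tau> in lebesgue. 0 < \<tau> \<and> \<tau> < t \<longrightarrow>
           integrable lebesgue (\<lambda>y. heat_kernel (t - \<tau>) (x - y) * ?N (?v \<tau>) y)) \<and>
        set_integrable lebesgue {0<..<t} (\<lambda>\<tau>. heat_semigroup (t - \<tau>) (?N (?v \<tau>)) x) \<and>
        ?v t x = heat_semigroup t \<Phi> x +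
          a * (LINT \<tau>:{0<..<t}|lebesgue. heat_semigroup (t - \<tau>) (?N (?v \<tau>)) x)"
    proof eventually_elim
      case (elim x)
      have "integrable lebesgue (\<lambda>y. heat_kernel t (x - y) * \<Phi> (c *\<^sub>R y))"
        using elim t by (intro heat_integrable_scale[OF c]) auto
      hence "integrable lebesgue (\<lambda>y. c powr s * (heat_kernel t (x - y) * \<Phi> (c *\<^sub>R y)))" by simp
      moreover have "AE y in lebesgue. c powr s * (heat_kernel t (x - y) * \<Phi> (c *\<^sub>R y)) = heat_kernel t (x - y) * \<Phi> y"
        using hom
      proof eventually_elim
        case (elim y)
        have "c powr s * c powr (-s) = 1" using c by (simp flip: powr_add)
        thus ?case unfolding elim by (simp add: mult_ac)
      qed
      moreover have "(\<lambda>y. heat_kernel t (x - y) * \<Phi> y) \<in> borel_measurable lebesgue" by measurable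
      ultimately have 1: "integrable lebesgue (\<lambda>y. heat_kernel t (x - y) * \<Phi> y)"
        using integrable_cong_AE_imp by blast
      have "AE \<tau> in lebesgue. 0 < \<tau> \<and> \<tau> < c\<^sup>2 * t \<longrightarrow>
           integrable lebesgue (\<lambda>y. heat_kernel (c\<^sup>2 * t - \<tau>) (c *\<^sub>R x - y) * ?N (u \<tau>) y)" using elim by blast
      from AE_lebesgue_scale[OF c2 this]
      have 2: "AE \<tau> in lebesgue. 0 < \<tau> \<and> \<tau> < t \<longrightarrow>
           integrable lebesgue (\<lambda>y. heat_kernel (t - \<tau>) (x - y) * ?N (?v \<tau>) y)"
      proof (eventually_elim, intro impI)
        fix \<tau> assume *: "0 < c\<^sup>2 *\<^sub>R \<tau> \<and> c\<^sup>2 *\<^sub>R \<tau> < c\<^sup>2 * t \<longrightarrow>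
           integrable lebesgue (\<lambda>y. heat_kernel (c\<^sup>2 * t - c\<^sup>2 *\<^sub>R \<tau>) (c *\<^sub>R x - y) * ?N (u (c\<^sup>2 *\<^sub>R \<tau>)) y)"
          and \<tau>: "0 < \<tau> \<and> \<tau> < t"
        have "integrable lebesgue (\<lambda>y. heat_kernel (c\<^sup>2 * (t - \<tau>)) (c *\<^sub>R x - y) * ?N (u (c\<^sup>2 * \<tau>)) y)"
          using * \<tau> c by (simp add: right_diff_distrib)
        from heat_integrable_scale[OF c _ this] \<tau>
        have "integrable lebesgue (\<lambda>y. c powr (s + 2) * (heat_kernel (t - \<tau>) (x - y) * ?N (u (c\<^sup>2 * \<tau>)) (c *\<^sub>R y)))"
          by simp
        thus "integrable lebesgue (\<lambda>y. heat_kernel (t - \<tau>) (x - y) * ?N (?v \<tau>) y)"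
          unfolding N by (simp only: mult.left_commute)
      qed
      have F: "integrable lebesgue (\<lambda>\<tau>. indicator {0<..<c\<^sup>2 * t} \<tau> * F x \<tau>)"
        using elim by (simp add: F_def set_integrable_def)
      have eq: "c powr (s + 2) * (indicator {0<..<c\<^sup>2 * t} (c\<^sup>2 *\<^sub>R \<tau>) * F x (c\<^sup>2 *\<^sub>R \<tau>))
          = indicator {0<..<t} \<tau> *\<^sub>R heat_semigroup (t - \<tau>) (?N (?v \<tau>)) x" for \<tau>
        using c heatN[of \<tau> t x] by (auto simp: indicator_def F_def zero_less_mult_iff)
      have 3: "set_integrable lebesgue {0<..<t} (\<lambda>\<tau>. heat_semigroup (t - \<tau>) (?N (?v \<tau>)) x)"
        unfolding set_integrable_def eq[symmetric]
        using integrable_lebesgue_scale(1)[OF c2 F] by simp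
      \<comment> \<open>The substitution \<tau> -> c^2 \<tau> contributes the c^2 that turns the
        factor \<open>c powr (s + 2)\<close> of the nonlinearity into
        \<open>c powr s\<close>.\<close>
      have I: "(LINT \<tau>:{0<..<t}|lebesgue. heat_semigroup (t - \<tau>) (?N (?v \<tau>)) x)
         = c powr s * (LINT \<tau>:{0<..<c\<^sup>2 * t}|lebesgue. F x \<tau>)"
      proof -
        have "c powr s * (LINT \<tau>:{0<..<c\<^sup>2 * t}|lebesgue. F x \<tau>)
           = c powr s * (c\<^sup>2 * (LINT \<tau>|lebesgue. indicator {0<..<c\<^sup>2 * t} (c\<^sup>2 *\<^sub>R \<tau>) * F x (c\<^sup>2 *\<^sub>R \<tau>)))"
          using integrable_lebesgue_scale(2)[OF c2 F] by (simp add: set_lebesgue_integral_def)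
        also have "\<dots> = c powr (s + 2) * (LINT \<tau>|lebesgue. indicator {0<..<c\<^sup>2 * t} (c\<^sup>2 *\<^sub>R \<tau>) * F x (c\<^sup>2 *\<^sub>R \<tau>))"
          using c by (simp add: powr_add)
        also have "\<dots> = (LINT \<tau>|lebesgue. c powr (s + 2) * (indicator {0<..<c\<^sup>2 * t} (c\<^sup>2 *\<^sub>R \<tau>) * F x (c\<^sup>2 *\<^sub>R \<tau>)))"
          by simp
        finally show ?thesis unfolding eq by (simp add: set_lebesgue_integral_def)
      qed
      have "c powr s * c powr (-s) = 1" using c by (simp flip: powr_add)
      hence "c powr s * heat_semigroup (c\<^sup>2 * t) \<Phi> (c *\<^sub>R x) = heat_semigroup t \<Phi> x"
        using heat_semigroup_homogeneous[OF c _ m hom, of t x] t by (simp flip: mult.assoc)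
      hence 4: "?v t x = heat_semigroup t \<Phi> x +
          a * (LINT \<tau>:{0<..<t}|lebesgue. heat_semigroup (t - \<tau>) (?N (?v \<tau>)) x)"
        using elim unfolding I by (simp add: F_def algebra_simps)
      from 1 2 3 4 show ?case by blast
    qed
  qed
qed

section \<open>Injectivity of the heat semigroup\<close>

text \<open>Boxes are stable under intersection and generate the Borel sets, so the sets over which
  the integral vanishes include all Borel sets, and uniqueness of densities applies.\<close>

lemma AE_zero_if_box_integrals_zero:
  fixes f :: "'a::euclidean_space \<Rightarrow> real"
  assumes int: "\<And>a b. set_integrable lborel (box a b) f"
    and zero: "\<And>a b. (LINT x:box a b|lborel. f x) = 0"
  shows "AE x in lborel. f x = 0"
proof -
  \<comment> \<open>Since f is only locally integrable, it is cut off to cubes; the intersection of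
    a box with a cube is a box again.\<close>
  define Q where "Q n = box (- real n *\<^sub>R One) (real n *\<^sub>R One :: 'a)" for n
  define g where "g n x = indicator (Q n) x * f x" for n x
  have gi: "integrable lborel (g n)" for n
    using int[of "- real n *\<^sub>R One" "real n *\<^sub>R One"] by (simp add: g_def[abs_def] Q_def set_integrable_def)
  have "(LINT x:A|lborel. g n x) = 0" if A: "A \<in> sigma_sets UNIV (range (\<lambda>(a, b). box a b :: 'a set))" for A n
  proof -
    have G: "Int_stable (range (\<lambda>(a, b). box a b :: 'a set))"
      by (auto simp: Int_stable_def box_Int_box)
    have sub: "range (\<lambda>(a, b). box a b :: 'a set) \<subseteq> Pow UNIV" by simp
    have sets: "sigma_sets UNIV (range (\<lambda>(a, b). box a b :: 'a set)) = sets lborel"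
      by (simp add: borel_eq_box)
    have gs: "set_integrable lborel A (g n)" if "A \<in> sets lborel" for A
      unfolding set_integrable_def using integrable_mult_indicator[OF that gi] .
    show ?thesis using G sub A
    proof (induction rule: sigma_sets_induct_disjoint)
      case (basic A)
      then obtain a b where A: "A = box a b" by auto
      obtain a' b' where ab: "box a b \<inter> Q n = box a' b'" by (auto simp: Q_def box_Int_box)
      have "(LINT x:A|lborel. g n x) = (LINT x:box a b \<inter> Q n|lborel. f x)"
        unfolding set_lebesgue_integral_def A g_def
        by (intro Bochner_Integration.integral_cong) (auto simp: indicator_def)
      thus ?case using zero[of a' b'] by (simp add: ab)
    next
      case empty
      show ?case by (simp add: set_lebesgue_integral_def)
    next
      case (compl A)
      have "(LINT x:UNIV|lborel. g n x) = (LINT x:A \<union> (UNIV - A)|lborel. g n x)" by simp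
      also have "\<dots> = (LINT x:A|lborel. g n x) + (LINT x:UNIV - A|lborel. g n x)"
        using compl(1) unfolding sets by (intro set_integral_Un gs) auto
      finally have "(LINT x:UNIV - A|lborel. g n x) = (LINT x:UNIV|lborel. g n x)"
        using compl by simp
      also have "\<dots> = (LINT x:Q n|lborel. f x)" by (simp add: set_lebesgue_integral_def g_def[abs_def])
      also have "\<dots> = 0" using zero by (simp add: Q_def)
      finally show ?case .
    next
      case (union A)
      have "(LINT x:(\<Union>i. A i)|lborel. g n x) = (\<Sum>i. (LINT x:(A i)|lborel. g n x))"
        using union(1,2) unfolding sets
        by (intro lebesgue_integral_countable_add gs) (auto simp: disjoint_family_on_def)
      thus ?case using union(3) by simp
    qed
  qed
  hence "(LINT x:A|lborel. g n x) = (LINT x:A|lborel. 0)" if "A \<in> sets lborel" for A n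
    using that by (simp add: borel_eq_box set_lebesgue_integral_def)
  hence "AE x in lborel. g n x = 0" for n
    by (intro density_unique_real gi) auto
  hence "AE x in lborel. \<forall>n. g n x = 0" by (simp add: AE_all_countable)
  thus ?thesis
  proof eventually_elim
    case (elim x)
    obtain n :: nat where "(\<Sum>b\<in>Basis. \<bar>x \<bullet> b\<bar>) < real n" using reals_Archimedean2 by blast
    moreover have "\<bar>x \<bullet> b\<bar> \<le> (\<Sum>b\<in>Basis. \<bar>x \<bullet> b\<bar>)" if "b \<in> Basis" for b
      using that by (intro member_le_sum) auto
    ultimately have "x \<in> Q n" unfolding Q_def mem_box by (fastforce simp: abs_less_iff)
    thus ?case using elim[rule_format, of n] by (simp add: g_def)
  qed
qed

text \<open>Splits off half of the Gaussian exponent. At distance at least \<rho> this half gives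
  the factor exp (-\<rho>^2 / (8 t)), and what remains is a kernel of total mass 1, up to a
  constant.\<close>

lemma heat_kernel_double_time:
  assumes "t > 0"
  shows "heat_kernel t (z::'a::euclidean_space)
    = 2 powr (DIM('a) / 2) * exp (- (norm z)\<^sup>2 / (8 * t)) * heat_kernel (2 * t) z"
proof -
  have 1: "(4 * pi * (2 * t)) powr (- real DIM('a) / 2) = 2 powr (- real DIM('a) / 2) * (4 * pi * t) powr (- real DIM('a) / 2)"
    using assms powr_mult[of 2 "4 * pi * t"] by (simp add: mult_ac)
  have 2: "2 powr (DIM('a) / 2) * 2 powr (- real DIM('a) / 2) = (1::real)" by (simp flip: powr_add)
  have 3: "exp (- (norm z)\<^sup>2 / (8 * t)) * exp (- (norm z)\<^sup>2 / (4 * (2 * t))) = exp (- (norm z)\<^sup>2 / (4 * t))"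
    using assms by (simp flip: exp_add add: field_simps)
  have "2 powr (DIM('a) / 2) * exp (- (norm z)\<^sup>2 / (8 * t)) * heat_kernel (2 * t) z
     = (2 powr (DIM('a) / 2) * 2 powr (- real DIM('a) / 2)) * (4 * pi * t) powr (- real DIM('a) / 2)
       * (exp (- (norm z)\<^sup>2 / (8 * t)) * exp (- (norm z)\<^sup>2 / (4 * (2 * t))))"
    unfolding heat_kernel_def 1 by (simp only: mult_ac)
  thus ?thesis unfolding 2 3 by (simp add: heat_kernel_def)
qed

lemma heat_kernel_tail:
  fixes y :: "'a::euclidean_space"
  assumes t: "t > 0" and S: "\<And>x. x \<in> S \<Longrightarrow> norm (x - y) \<ge> \<rho>" and \<rho>: "\<rho> \<ge> 0"
  shows "(\<integral>\<^sup>+x. ennreal (indicator S x * heat_kernel t (x - y)) \<partial>lborel)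
     \<le> ennreal (2 powr (DIM('a) / 2) * exp (- \<rho>\<^sup>2 / (8 * t)))"
proof -
  let ?K = "2 powr (DIM('a) / 2) * exp (- \<rho>\<^sup>2 / (8 * t))"
  have "ennreal (indicator S x * heat_kernel t (x - y)) \<le> ennreal ?K * ennreal (heat_kernel (2 * t) (y - x))" for x
  proof (cases "x \<in> S")
    case True
    hence "\<rho>\<^sup>2 \<le> (norm (x - y))\<^sup>2" using S \<rho> by (intro power_mono) auto
    hence "exp (- (norm (x - y))\<^sup>2 / (8 * t)) \<le> exp (- \<rho>\<^sup>2 / (8 * t))" using t by (simp add: divide_right_mono)
    hence "heat_kernel t (x - y) \<le> ?K * heat_kernel (2 * t) (x - y)"
      unfolding heat_kernel_double_time[OF t, of "x - y"] by (intro mult_mono) auto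
    thus ?thesis using True by (simp add: heat_kernel_minus_commute[of _ y x] ennreal_leI flip: ennreal_mult)
  qed simp
  hence "(\<integral>\<^sup>+x. ennreal (indicator S x * heat_kernel t (x - y)) \<partial>lborel)
     \<le> (\<integral>\<^sup>+x. ennreal ?K * ennreal (heat_kernel (2 * t) (y - x)) \<partial>lborel)" by (intro nn_integral_mono)
  also have "\<dots> = ennreal ?K" using t by (simp add: nn_integral_cmult nn_integral_heat_kernel_diff)
  finally show ?thesis .
qed

text \<open>Testing the vanishing heat extension against the indicator of a box and letting the time tend to
  \<open>0\<close> shows that the data have vanishing integral over every box.\<close>

lemma heat_semigroup_injective:
  fixes \<Phi> :: "'a::euclidean_space \<Rightarrow> real" and q :: real
  assumes m: "\<Phi> \<in> borel_measurable lebesgue" and q: "0 \<le> q" "q < DIM('a)"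
    and D: "D \<ge> 0" "AE y in lebesgue. \<bar>\<Phi> y\<bar> \<le> D * norm y powr (-q)"
    and z: "\<And>t. t > 0 \<Longrightarrow> AE x in lebesgue. heat_semigroup t \<Phi> x = 0"
  shows "AE x in lebesgue. \<Phi> x = 0"
proof -
  \<comment> \<open>Fubini's theorem is applied to the product of Borel measures, so the data are
    replaced by a Borel function that agrees with them almost everywhere. The heat extension is
    unchanged.\<close>
  obtain f where f[measurable]: "f \<in> borel_measurable borel" and \<Phi>f: "AE x in lborel. \<Phi> x = f x"
    using completion_ex_borel_measurable_real[OF m] by auto
  have \<Phi>f': "AE x in lebesgue. \<Phi> x = f x" using \<Phi>f by (rule AE_completion)
  have bd: "AE y in lebesgue. \<bar>f y\<bar> \<le> D * norm y powr (-q)" using D(2) \<Phi>f' by eventually_elim simp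
  have fm: "f \<in> borel_measurable lebesgue" by (rule measurable_completion) simp
  have heat: "heat_semigroup t \<Phi> x = (LINT y|lborel. heat_kernel t (x - y) * f y)" for t x
  proof -
    have "(\<lambda>y. heat_kernel t (x - y)) \<in> borel_measurable lebesgue" by (rule measurable_completion) measurable
    hence "heat_semigroup t \<Phi> x = (LINT y|lebesgue. heat_kernel t (x - y) * f y)"
      unfolding heat_semigroup_def using m fm \<Phi>f'
      by (intro integral_cong_AE borel_measurable_times) (auto elim: eventually_mono)
    also have "\<dots> = (LINT y|lborel. heat_kernel t (x - y) * f y)"
      by (rule integral_completion) measurable
    finally show ?thesis .
  qed
  obtain C where C: "C > 0" "\<And>t (x::'a) l. t > 0 \<Longrightarrow> x \<noteq> 0 \<Longrightarrow> 0 \<le> l \<Longrightarrow> l \<le> q \<Longrightarrow>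
      (\<integral>\<^sup>+y. ennreal (heat_kernel t (x - y) * norm y powr (-q)) \<partial>lborel)
        \<le> ennreal (C * t powr (-(q - l) / 2) * norm x powr (-l))"
    using heat_potential_bound[OF q] by blast
  have nn: "(\<integral>\<^sup>+y. ennreal \<bar>heat_kernel t (x - y) * f y\<bar> \<partial>lborel) \<le> ennreal (D * (C * t powr (-q / 2)))"
    if "t > 0" "x \<noteq> 0" for t x
  proof -
    have "(\<integral>\<^sup>+y. ennreal \<bar>heat_kernel t (x - y) * f y\<bar> \<partial>lebesgue)
       \<le> ennreal (D * (C * t powr (-q / 2)) + 0 * (C * t powr (-q / 2)))"
      using D C(1) C(2)[OF that order_refl q(1)] bd that
      by (intro heat_semigroup_abs_le2[where ?q1.0=q and ?q2.0=q]) auto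
    thus ?thesis by (simp add: nn_integral_completion)
  qed
  have main: "integrable lborel (\<lambda>y. indicator (box a b) y * f y) \<and> (LINT y|lborel. indicator (box a b) y * f y) = 0" for a b
  proof -
    define U where "U = box a b"
    have [measurable]: "U \<in> sets borel" by (simp add: U_def)
    \<comment> \<open>The heat extension of the indicator of the box: it lies between 0 and 1 and is
      Gaussian small away from the box, while 1 - W is Gaussian small inside.\<close>
    define W where "W t y = (LINT x|lborel. indicator U x * heat_kernel t (x - y))" for t and y :: 'a
    have Wnn: "ennreal (W t y) = (\<integral>\<^sup>+x. ennreal (indicator U x * heat_kernel t (x - y)) \<partial>lborel)"
      and W1: "W t y \<le> 1" and W0: "W t y \<ge> 0" if t: "t > 0" for t y
    proof -
      have le: "(\<integral>\<^sup>+x. ennreal (indicator U x * heat_kernel t (x - y)) \<partial>lborel) \<le> 1"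
        unfolding nn_integral_heat_kernel_diff[OF t, of y, symmetric]
        by (intro nn_integral_mono) (auto simp: indicator_def heat_kernel_minus_commute[of _ y])
      have "W t y = enn2real (\<integral>\<^sup>+x. ennreal (indicator U x * heat_kernel t (x - y)) \<partial>lborel)"
        unfolding W_def by (intro integral_eq_nn_integral) auto
      with le show *: "ennreal (W t y) = (\<integral>\<^sup>+x. ennreal (indicator U x * heat_kernel t (x - y)) \<partial>lborel)"
        by (simp add: ennreal_enn2real_if) (metis ennreal_one_less_top le_less_trans less_top top.not_eq_extremum)
      show "W t y \<ge> 0" by (auto simp: W_def intro!: integral_nonneg_AE)
      show "W t y \<le> 1" using le unfolding *[symmetric] by (simp add: ennreal_le_1)
    qed
    have Wtail: "W t y \<le> 2 powr (DIM('a) / 2) * exp (- \<rho>\<^sup>2 / (8 * t))"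
      if "t > 0" "\<rho> \<ge> 0" "\<And>x. x \<in> U \<Longrightarrow> norm (x - y) \<ge> \<rho>" for t \<rho> y
    proof -
      have "ennreal (W t y) \<le> ennreal (2 powr (DIM('a) / 2) * exp (- \<rho>\<^sup>2 / (8 * t)))"
        unfolding Wnn[OF that(1)] by (rule heat_kernel_tail) (use that in auto)
      thus ?thesis by simp
    qed
    have Wcotail: "1 \<le> W t y + 2 powr (DIM('a) / 2) * exp (- \<rho>\<^sup>2 / (8 * t))"
      if t: "t > 0" and \<rho>: "\<rho> \<ge> 0" "\<And>x. x \<notin> U \<Longrightarrow> norm (x - y) \<ge> \<rho>" for t \<rho> y
    proof -
      have "1 = (\<integral>\<^sup>+x. ennreal (heat_kernel t (y - x)) \<partial>lborel)" using nn_integral_heat_kernel_diff[OF t] by simp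
      also have "\<dots> = (\<integral>\<^sup>+x. ennreal (indicator U x * heat_kernel t (x - y)) + ennreal (indicator (-U) x * heat_kernel t (x - y)) \<partial>lborel)"
        by (intro nn_integral_cong) (auto simp: indicator_def heat_kernel_minus_commute[of _ y])
      also have "\<dots> = ennreal (W t y) + (\<integral>\<^sup>+x. ennreal (indicator (-U) x * heat_kernel t (x - y)) \<partial>lborel)"
        unfolding Wnn[OF t] by (intro nn_integral_add) auto
      also have "\<dots> \<le> ennreal (W t y) + ennreal (2 powr (DIM('a) / 2) * exp (- \<rho>\<^sup>2 / (8 * t)))"
        by (intro add_left_mono heat_kernel_tail) (use t \<rho> in auto)
      also have "\<dots> = ennreal (W t y + 2 powr (DIM('a) / 2) * exp (- \<rho>\<^sup>2 / (8 * t)))"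
        using W0[OF t] by simp
      finally show ?thesis using W0[OF t] by (subst (asm) ennreal_1[symmetric], subst (asm) ennreal_le_iff) auto
    qed
    \<comment> \<open>Self-adjointness of the heat semigroup, as an application of Fubini's theorem:
      the integral of W times f is the integral of the heat extension of f over the box.\<close>
    have zero: "(LINT y|lborel. W t y * f y) = 0" if t: "t > 0" for t
    proof -
      let ?F = "\<lambda>(x, y). indicator U x * (heat_kernel t (x - y) * f y)"
      have Fm: "?F \<in> borel_measurable (lborel \<Otimes>\<^sub>M lborel)" by measurable
      have "(\<integral>\<^sup>+p. ennreal (norm (?F p)) \<partial>(lborel \<Otimes>\<^sub>M lborel))
         = (\<integral>\<^sup>+x. \<integral>\<^sup>+y. ennreal (norm (?F (x, y))) \<partial>lborel \<partial>lborel)"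
        using Fm by (intro lborel.nn_integral_fst[symmetric]) measurable
      also have "\<dots> \<le> (\<integral>\<^sup>+x. ennreal (D * (C * t powr (-q / 2))) * indicator U x \<partial>lborel)"
      proof (rule nn_integral_mono_AE)
        from AE_lborel_singleton[of "0::'a"]
        show "AE x in lborel. (\<integral>\<^sup>+y. ennreal (norm (?F (x, y))) \<partial>lborel)
            \<le> ennreal (D * (C * t powr (-q / 2))) * indicator U x"
        proof eventually_elim
          case (elim x)
          show ?case using nn[OF t elim] by (cases "x \<in> U") auto
        qed
      qed
      also have "\<dots> = ennreal (D * (C * t powr (-q / 2))) * emeasure lborel U"
        by (simp add: nn_integral_cmult_indicator)
      also have "\<dots> < \<infinity>" using emeasure_bounded_finite[OF bounded_box[of a b]] unfolding U_def by (auto simp: ennreal_mult_less_top)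
      finally have Fi: "integrable (lborel \<Otimes>\<^sub>M lborel) ?F"
        using Fm by (intro integrableI_bounded)
      have "(LINT y|lborel. LINT x|lborel. indicator U x * (heat_kernel t (x - y) * f y))
         = (LINT x|lborel. LINT y|lborel. indicator U x * (heat_kernel t (x - y) * f y))"
        by (rule lborel_pair.Fubini_integral[OF Fi])
      also have "\<dots> = (LINT x|lborel. indicator U x * heat_semigroup t \<Phi> x)" by (simp add: heat)
      also have "\<dots> = (LINT x|(lborel::'a measure). 0)"
      proof (rule integral_cong_AE)
        show "(\<lambda>x. indicator U x * heat_semigroup t \<Phi> x) \<in> borel_measurable lborel"
          unfolding heat by measurable
        have "AE x in lborel. heat_semigroup t \<Phi> x = 0" using z[OF t] by (simp add: AE_completion_iff)
        thus "AE x in lborel. indicator U x * heat_semigroup t \<Phi> x = 0" by eventually_elim simp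
      qed simp
      finally show ?thesis unfolding W_def by (simp flip: mult.assoc)
    qed
    obtain R where R: "R > 0" "U \<subseteq> ball 0 R"
      using bounded_subset_ballD[OF bounded_box, of a b 0] unfolding U_def by blast
    define t where "t n = inverse (real (Suc n))" for n
    have t: "0 < t n" "t n \<le> 1" for n by (auto simp: t_def inverse_le_1_iff)
    have lim0: "(\<lambda>n. 2 powr (DIM('a) / 2) * exp (- \<rho>\<^sup>2 / (8 * t n))) \<longlonglongrightarrow> 0" if "\<rho> > 0" for \<rho> :: real
    proof -
      have "(\<lambda>n. exp (- (\<rho>\<^sup>2 / 8) * real (Suc n))) \<longlonglongrightarrow> 0" using that by real_asymp
      moreover have "- \<rho>\<^sup>2 / (8 * t n) = - (\<rho>\<^sup>2 / 8) * real (Suc n)" for n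
        unfolding t_def by (simp only: divide_inverse inverse_mult_distrib inverse_inverse_eq) (simp only: mult_ac minus_mult_left)
      ultimately have "(\<lambda>n. exp (- \<rho>\<^sup>2 / (8 * t n))) \<longlonglongrightarrow> 0" by (simp only:)
      from tendsto_mult_left[OF this, of "2 powr (DIM('a) / 2)"] show ?thesis by simp
    qed
    have lim: "AE y in lborel. (\<lambda>n. W (t n) y * f y) \<longlonglongrightarrow> indicator U y * f y"
    proof -
      \<comment> \<open>Convergence to the indicator is shown at points that have a positive
        distance either to the box or to its complement; the remaining points form the boundary, a
        null set.\<close>
      have "negligible (cbox a b - box a b)" by (rule negligible_frontier_interval)
      hence "cbox a b - box a b \<in> null_sets lborel"
        by (simp add: negligible_iff_null_sets null_sets_completion_iff)
      from AE_not_in[OF this] show ?thesis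
      proof eventually_elim
        case (elim y)
        have "(\<lambda>n. W (t n) y) \<longlonglongrightarrow> indicator U y"
        proof (cases "y \<in> U")
          case True
          then obtain \<rho> where \<rho>: "\<rho> > 0" "ball y \<rho> \<subseteq> U" using open_box unfolding U_def open_contains_ball by blast
          hence far: "norm (x - y) \<ge> \<rho>" if "x \<notin> U" for x
            using that by (force simp: subset_iff dist_norm norm_minus_commute)
          have "(\<lambda>n. W (t n) y) \<longlonglongrightarrow> 1"
          proof (rule tendsto_sandwich)
            show "(\<lambda>n. 1 - 2 powr (DIM('a) / 2) * exp (- \<rho>\<^sup>2 / (8 * t n))) \<longlonglongrightarrow> 1"
              using tendsto_diff[OF tendsto_const lim0[OF \<rho>(1)], of 1] by simp
            have "1 - 2 powr (DIM('a) / 2) * exp (- \<rho>\<^sup>2 / (8 * t n)) \<le> W (t n) y" for n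
              using Wcotail[OF t(1)[of n], of \<rho> y] \<rho> far by simp
            thus "\<forall>\<^sub>F n in sequentially. 1 - 2 powr (DIM('a) / 2) * exp (- \<rho>\<^sup>2 / (8 * t n)) \<le> W (t n) y" by simp
          qed (use W1 t in auto)
          thus ?thesis using True by simp
        next
          case False
          hence "y \<in> - cbox a b" using elim by (auto simp: U_def)
          then obtain \<rho> where \<rho>: "\<rho> > 0" "ball y \<rho> \<subseteq> - cbox a b"
            using open_Compl[OF closed_cbox] unfolding open_contains_ball by blast
          have far: "norm (x - y) \<ge> \<rho>" if "x \<in> U" for x
          proof -
            have "x \<in> cbox a b" using that box_subset_cbox unfolding U_def by blast
            thus ?thesis using \<rho>(2) by (force simp: subset_iff dist_norm norm_minus_commute)
          qed
          have "(\<lambda>n. W (t n) y) \<longlonglongrightarrow> 0"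
          proof (rule tendsto_sandwich[OF _ _ tendsto_const lim0[OF \<rho>(1)]])
            show "\<forall>\<^sub>F n in sequentially. W (t n) y \<le> 2 powr (DIM('a) / 2) * exp (- \<rho>\<^sup>2 / (8 * t n))"
              using Wtail[OF t(1), of \<rho> y] \<rho> far by simp
          qed (use W0 t in auto)
          thus ?thesis using False by simp
        qed
        thus ?case by (intro tendsto_mult tendsto_const)
      qed
    qed
    \<comment> \<open>The dominating function is a Gaussian centred at a point other than 0, because
      \<open>nn\<close> bounds the integral against f there. For |y| > 2 R the box is at distance at
      least |y| / 2 and t \<le> 1, so W is at most a multiple of exp (-|y|^2 / 32); for |y| \<le> 2
      R the factor exp (R^2 / 8) suffices. Recentring at z0 halves the exponent to |z0 - y|^2 / 64,
      which is the kernel at time 16.\<close>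
    obtain z0 :: 'a where z0: "z0 \<in> Basis" by (rule SOME_Basis[THEN that])
    hence z0n: "norm z0 = 1" "z0 \<noteq> 0" by auto
    define K where "K = max (exp (R\<^sup>2 / 8)) (2 powr (DIM('a) / 2)) * (exp (1 / 32) * (64 * pi) powr (DIM('a) / 2))"
    have dom: "W (t n) y \<le> K * heat_kernel 16 (z0 - y)" for n y
    proof -
      have "W (t n) y \<le> max (exp (R\<^sup>2 / 8)) (2 powr (DIM('a) / 2)) * exp (- (norm y)\<^sup>2 / 32)"
      proof (cases "norm y \<le> 2 * R")
        case True
        hence "(norm y)\<^sup>2 \<le> (2 * R)\<^sup>2" by (intro power_mono) auto
        hence "1 \<le> exp (R\<^sup>2 / 8) * exp (- (norm y)\<^sup>2 / 32)" by (simp flip: exp_add add: power_mult_distrib)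
        also have "\<dots> \<le> max (exp (R\<^sup>2 / 8)) (2 powr (DIM('a) / 2)) * exp (- (norm y)\<^sup>2 / 32)"
          by (intro mult_right_mono) auto
        finally show ?thesis using W1[OF t(1), of n y] by linarith
      next
        case False
        have far: "norm (x - y) \<ge> norm y / 2" if "x \<in> U" for x
        proof -
          have "norm x < R" using that R by auto
          thus ?thesis using False norm_triangle_ineq2[of y x] by (simp add: norm_minus_commute)
        qed
        have "W (t n) y \<le> 2 powr (DIM('a) / 2) * exp (- (norm y / 2)\<^sup>2 / (8 * t n))"
          by (rule Wtail[OF t(1)]) (use far in auto)
        also have "\<dots> \<le> max (exp (R\<^sup>2 / 8)) (2 powr (DIM('a) / 2)) * exp (- (norm y)\<^sup>2 / 32)"
        proof (rule mult_mono)
          have "(norm y)\<^sup>2 / 32 \<le> (norm y)\<^sup>2 / (32 * t n)" using t[of n] by (intro divide_left_mono) auto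
          thus "exp (- (norm y / 2)\<^sup>2 / (8 * t n)) \<le> exp (- (norm y)\<^sup>2 / 32)" by (simp add: power_divide)
        qed (auto simp: le_max_iff_disj)
        finally show ?thesis .
      qed
      also have "exp (- (norm y)\<^sup>2 / 32) \<le> exp (1 / 32) * (64 * pi) powr (DIM('a) / 2) * heat_kernel 16 (z0 - y)"
      proof -
        have "norm (z0 - y) \<le> 1 + norm y" using norm_triangle_ineq4[of z0 y] z0n by simp
        hence "(norm (z0 - y))\<^sup>2 \<le> (1 + norm y)\<^sup>2" by (intro power_mono) auto
        also have "\<dots> \<le> 2 * (norm y)\<^sup>2 + 2"
          using zero_le_power2[of "norm y - 1"] by (simp add: power2_eq_square algebra_simps)
        finally have "exp (- (norm y)\<^sup>2 / 32) \<le> exp (1 / 32) * exp (- (norm (z0 - y))\<^sup>2 / 64)"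
          by (simp flip: exp_add)
        moreover have "(64 * pi) powr (DIM('a) / 2) * (64 * pi) powr (- real DIM('a) / 2) = 1" by (simp flip: powr_add)
        ultimately show ?thesis by (simp add: heat_kernel_def mult_ac)
      qed
      finally show ?thesis by (simp add: K_def mult.assoc mult_left_mono le_max_iff_disj)
    qed
    have hint: "integrable lborel (\<lambda>y. K * \<bar>heat_kernel 16 (z0 - y) * f y\<bar>)"
    proof -
      have "integrable lborel (\<lambda>y. heat_kernel 16 (z0 - y) * f y)"
      proof (rule integrableI_bounded)
        have "(\<integral>\<^sup>+y. ennreal (norm (heat_kernel 16 (z0 - y) * f y)) \<partial>lborel) \<le> ennreal (D * (C * 16 powr (-q / 2)))"
          using nn[of 16 z0] z0n by simp
        also have "\<dots> < \<infinity>" by simp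
        finally show "(\<integral>\<^sup>+y. ennreal (norm (heat_kernel 16 (z0 - y) * f y)) \<partial>lborel) < \<infinity>" .
      qed measurable
      thus ?thesis by (intro integrable_mult_right integrable_abs)
    qed
    have Wm: "(\<lambda>y. W (t n) y * f y) \<in> borel_measurable lborel" for n
      unfolding W_def by measurable
    have Um: "(\<lambda>y. indicator U y * f y) \<in> borel_measurable lborel" by measurable
    have le: "AE y in lborel. norm (W (t n) y * f y) \<le> K * \<bar>heat_kernel 16 (z0 - y) * f y\<bar>" for n
    proof (rule AE_I2)
      fix y
      have "\<bar>W (t n) y\<bar> * \<bar>f y\<bar> \<le> (K * heat_kernel 16 (z0 - y)) * \<bar>f y\<bar>"
        using dom[of n y] W0[OF t(1)] by (intro mult_right_mono) auto
      thus "norm (W (t n) y * f y) \<le> K * \<bar>heat_kernel 16 (z0 - y) * f y\<bar>" by (simp add: abs_mult mult.assoc)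
    qed
    have "(\<lambda>n. LINT y|lborel. W (t n) y * f y) \<longlonglongrightarrow> (LINT y|lborel. indicator U y * f y)"
      by (rule integral_dominated_convergence[OF Um Wm hint lim le])
    hence "(LINT y|lborel. indicator U y * f y) = 0"
      using zero[OF t(1)] by (simp add: LIMSEQ_const_iff)
    moreover have "integrable lborel (\<lambda>y. indicator U y * f y)"
      by (rule integrable_dominated_convergence[OF Um Wm hint lim le])
    ultimately show ?thesis by (simp add: U_def)
  qed
  have "AE x in lborel. f x = 0"
    using main by (intro AE_zero_if_box_integrals_zero) (auto simp: set_integrable_def set_lebesgue_integral_def)
  thus ?thesis using \<Phi>f by (simp add: AE_completion_iff) (elim AE_mp; simp)
qed

section \<open>Asymptotic behavior\<close>

text \<open>The rate r is dictated by the difference of the data and may exceed the scaling rate s.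
  Membership in the ball gives the smallness of the potential and the a priori bound 2 M that starts
  the bootstrap; the threshold M0 is fixed before the data.\<close>

lemma mild_solutions_difference_decay:
  fixes p k r \<alpha> \<gamma> s :: real
  assumes \<alpha>: "\<alpha> > 1" and s: "s = (2 + \<gamma>) / (\<alpha> - 1)" and p: "p = k * (\<alpha> - 1) - \<gamma>" "0 < p" "p < 2"
    and k: "0 \<le> k" "k \<le> s" "s < k + p" "k + p < DIM('a::euclidean_space)"
    and r: "0 < r" "r < DIM('a)"
  obtains M0 where "M0 > 0" and
    "\<And>a (\<phi>1 :: 'a \<Rightarrow> real) \<phi>2 u1 u2 M D. \<bar>a\<bar> = 1 \<Longrightarrow> 0 \<le> M \<Longrightarrow> M \<le> M0 \<Longrightarrow>
      mild_solution a \<gamma> \<alpha> \<phi>1 u1 \<Longrightarrow> mild_solution a \<gamma> \<alpha> \<phi>2 u2 \<Longrightarrow>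
      decays s k M u1 \<Longrightarrow> decays s k M u2 \<Longrightarrow>
      D \<ge> 0 \<Longrightarrow> AE y in lebesgue. \<bar>\<phi>1 y - \<phi>2 y\<bar> \<le> D * norm y powr (-r) \<Longrightarrow>
      \<exists>C>0. \<forall>l. 0 \<le> l \<and> l \<le> r \<longrightarrow> decays r l C (\<lambda>t x. u1 t x - u2 t x)"
proof -
  have pd: "p < DIM('a)" using k by linarith
  obtain k' where k': "0 \<le> k'" "k' \<le> r" "r < k' + p" "k' + p < DIM('a)"
    using exists_admissible_weight[OF p(2) pd r] by blast
  obtain B0 where B0: "B0 > 0" and boot:
    "\<And>(w :: real \<Rightarrow> 'a \<Rightarrow> real) f h v B F K. 0 \<le> B \<Longrightarrow> B \<le> B0 \<Longrightarrow> F \<ge> 0 \<Longrightarrow> K \<ge> 0 \<Longrightarrow>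
      decays s k K w \<Longrightarrow> decays r k' F f \<Longrightarrow> duhamel_term h v \<Longrightarrow>
      (\<And>t. t > 0 \<Longrightarrow> AE y in lebesgue. \<bar>h t y\<bar> \<le> B * (t powr (-(2 - p) / 2) * norm y powr (-p) * \<bar>w t y\<bar>)) \<Longrightarrow>
      (\<And>t. t > 0 \<Longrightarrow> AE x in lebesgue. \<bar>w t x\<bar> \<le> \<bar>f t x\<bar> + \<bar>v t x\<bar>) \<Longrightarrow>
      decays r k' (2 * F) w"
    using decays_bootstrap[OF p(2,3) k k'] by blast
  obtain Ch where Ch: "Ch > 0"
    "\<And>(h :: 'a \<Rightarrow> real) D l. D \<ge> 0 \<Longrightarrow> AE y in lebesgue. \<bar>h y\<bar> \<le> D * norm y powr (-r) \<Longrightarrow>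
      0 \<le> l \<Longrightarrow> l \<le> r \<Longrightarrow> decays r l (Ch * D) (\<lambda>t. heat_semigroup t h)"
    using heat_decays[OF less_imp_le[OF r(1)] r(2)] by blast
  \<comment> \<open>The solution of \<alpha> * M0^(\<alpha> - 1) = B0, since a difference of two
    elements of the ball of radius M sees a potential of size \<alpha> * M^(\<alpha> - 1).\<close>
  define M0 where "M0 = (B0 / \<alpha>) powr (1 / (\<alpha> - 1))"
  have M0: "M0 powr (\<alpha> - 1) = B0 / \<alpha>" using \<alpha> B0 by (simp add: M0_def powr_powr)
  show thesis
  proof (rule that[of M0])
    show "M0 > 0" using B0 \<alpha> by (simp add: M0_def)
    fix a and \<phi>1 \<phi>2 :: "'a \<Rightarrow> real" and u1 u2 and M D :: real
    assume a: "\<bar>a\<bar> = (1::real)" and M: "0 \<le> M" "M \<le> M0"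
      and mild: "mild_solution a \<gamma> \<alpha> \<phi>1 u1" "mild_solution a \<gamma> \<alpha> \<phi>2 u2"
      and u: "decays s k M u1" "decays s k M u2"
      and D: "D \<ge> 0" "AE y in lebesgue. \<bar>\<phi>1 y - \<phi>2 y\<bar> \<le> D * norm y powr (-r)"
    let ?w = "\<lambda>t x. u1 t x - u2 t x"
    let ?h = "\<lambda>s y. hardy_henon_nonlinearity \<gamma> \<alpha> (u1 s) y - hardy_henon_nonlinearity \<gamma> \<alpha> (u2 s) y"
    let ?f = "\<lambda>t. heat_semigroup t (\<lambda>y. \<phi>1 y - \<phi>2 y)"
    define B where "B = \<alpha> * M powr (\<alpha> - 1)"
    have B: "0 \<le> B" "B \<le> B0"
    proof -
      have "M powr (\<alpha> - 1) \<le> B0 / \<alpha>" unfolding M0[symmetric] using M \<alpha> by (intro powr_mono2) auto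
      thus "0 \<le> B" "B \<le> B0" using \<alpha> by (auto simp: B_def field_simps)
    qed
    obtain v where v: "duhamel_term ?h v"
      and eq: "\<And>t. t > 0 \<Longrightarrow> AE x in lebesgue. ?w t x = ?f t x + a * v t x"
      using mild_solution_diff[OF mild] by blast
    have wfv: "AE x in lebesgue. \<bar>?w t x\<bar> \<le> \<bar>?f t x\<bar> + \<bar>v t x\<bar>" if "t > 0" for t
      using eq[OF that]
    proof eventually_elim
      case (elim x)
      show ?case unfolding elim using abs_triangle_ineq[of "?f t x" "a * v t x"] a by (simp add: abs_mult)
    qed
    have h: "AE y in lebesgue. \<bar>?h t y\<bar> \<le> B * (t powr (-(2 - p) / 2) * norm y powr (-p) * \<bar>?w t y\<bar>)"
      if "t > 0" for t
      using hardy_henon_nonlinearity_diff_le[OF \<alpha> M(1) u that p(1), of 0] by (simp add: B_def s)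
    have w: "decays s k (M + M) ?w"
      by (rule decays_add[OF u]) (intro AE_I2 abs_triangle_ineq4)
    have F: "decays r l (Ch * D) ?f" if "0 \<le> l" "l \<le> r" for l
      using Ch(2)[OF D that] .
    have CD: "Ch * D \<ge> 0" using Ch(1) D(1) by simp
    have w': "decays r k' (2 * (Ch * D)) ?w"
      using B CD M by (intro boot[OF _ _ _ _ w F[OF k'(1,2)] v h wfv]) auto
    thus "\<exists>C>0. \<forall>l. 0 \<le> l \<and> l \<le> r \<longrightarrow> decays r l C ?w"
      using CD by (intro decays_all_weights[OF p(2,3) k' w' _ CD F v B(1) h wfv]) auto
  qed
qed

text \<open>Makes the estimate of a single solution an instance of the estimate for
  differences.\<close>

lemma mild_solution_zero: "mild_solution a \<gamma> \<alpha> (\<lambda>_. 0) (\<lambda>_ _. 0)"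
  by (simp add: mild_solution_def hardy_henon_nonlinearity_def heat_semigroup_def set_integrable_def
      set_lebesgue_integral_def)

text \<open>For t \<le> 1 the bound with the smaller rate r1 is the stronger one, for t > 1 the
  bound with r2; each is then at most the bound with r.\<close>

lemma decays_interpolate_rate:
  fixes w :: "real \<Rightarrow> 'a::euclidean_space \<Rightarrow> real"
  assumes "decays r1 l C w" "decays r2 l C w" "r1 \<le> r" "r \<le> r2" "C \<ge> 0"
  shows "decays r l C w"
  unfolding decays_def
proof (intro allI impI)
  fix t :: real assume t: "t > 0"
  have "t powr (-(r1 - l) / 2) \<le> t powr (-(r - l) / 2) \<or> t powr (-(r2 - l) / 2) \<le> t powr (-(r - l) / 2)"
    using t assms(3,4) by (cases "t \<le> 1") (auto intro: powr_mono powr_mono')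
  moreover from decaysD[OF assms(1) t] decaysD[OF assms(2) t]
  have "AE x in lebesgue. \<bar>w t x\<bar> \<le> C * (t powr (-(r1 - l) / 2) * norm x powr (-l)) \<and>
     \<bar>w t x\<bar> \<le> C * (t powr (-(r2 - l) / 2) * norm x powr (-l))" by eventually_elim simp
  ultimately show "AE x in lebesgue. \<bar>w t x\<bar> \<le> C * (t powr (-(r - l) / 2) * norm x powr (-l))"
  proof (elim AE_mp, intro AE_I2 impI)
    fix x :: 'a
    let ?n = "norm x powr (-l)"
    assume *: "t powr (-(r1 - l) / 2) \<le> t powr (-(r - l) / 2) \<or> t powr (-(r2 - l) / 2) \<le> t powr (-(r - l) / 2)"
      and **: "\<bar>w t x\<bar> \<le> C * (t powr (-(r1 - l) / 2) * ?n) \<and> \<bar>w t x\<bar> \<le> C * (t powr (-(r2 - l) / 2) * ?n)"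
    have "C * (A * ?n) \<le> C * (B * ?n)" if "A \<le> B" for A B
      using that assms(5) by (intro mult_left_mono mult_right_mono) auto
    thus "\<bar>w t x\<bar> \<le> C * (t powr (-(r - l) / 2) * ?n)" using * ** by (meson order_trans)
  qed
qed

text \<open>When \<open>u\<close> decays faster than the scaling of the equation, the potential \<open>norm x powr \<gamma> * \<bar>u\<bar> powr (\<alpha> - 1)\<close>
  has an additional decay in time, which the Duhamel term gains over the linear part.\<close>

lemma mild_solution_linear_decay:
  fixes p k \<sigma> \<alpha> \<gamma> s M :: real and \<phi> \<Phi> :: "'a::euclidean_space \<Rightarrow> real"
  assumes \<alpha>: "\<alpha> > 1" and s: "s = (2 + \<gamma>) / (\<alpha> - 1)" and p: "p = k * (\<alpha> - 1) - \<gamma>" "0 < p" "p < 2"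
    and k: "0 \<le> k" "k \<le> s" "k + p < DIM('a)"
    and \<sigma>: "0 < s" "s < \<sigma>" "\<sigma> < DIM('a)"
    and a: "\<bar>a\<bar> = 1" and mild: "mild_solution a \<gamma> \<alpha> \<phi> u"
    and M: "M \<ge> 0" "decays s k M u"
    and C: "C > 0" "\<And>l. 0 \<le> l \<Longrightarrow> l \<le> \<sigma> \<Longrightarrow> decays \<sigma> l C u"
    and \<Phi>: "\<Phi> \<in> borel_measurable lebesgue" "E \<ge> 0" "AE y in lebesgue. \<bar>\<Phi> y\<bar> \<le> E * norm y powr (-\<sigma>)"
    and diff: "\<And>r. \<sigma> \<le> r \<Longrightarrow> \<exists>D\<ge>0. AE y in lebesgue. \<bar>\<phi> y - \<Phi> y\<bar> \<le> D * norm y powr (-r)"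
  shows "\<exists>C>0. \<exists>\<delta>>0. \<forall>l. 0 \<le> l \<and> l \<le> \<sigma> \<longrightarrow>
    decays (\<sigma> + 2 * \<delta>) l C (\<lambda>t x. u t x - heat_semigroup t \<Phi> x)"
proof -
  have pd: "p < DIM('a)" "0 < \<sigma>" using k \<sigma> by linarith+
  obtain k' where k': "0 \<le> k'" "k' \<le> \<sigma>" "\<sigma> < k' + p" "k' + p < DIM('a)"
    using exists_admissible_weight[OF p(2) pd(1) pd(2) \<sigma>(3)] by blast
  \<comment> \<open>An excess over the rate s: the first entry keeps s + e within the known rates s
    and \<sigma>, the second makes 2 \<eta> = (\<alpha> - 1) e at most half of k' + p - \<sigma>, so
    that the improved source stays integrable at time 0.\<close>
  define e where "e = min (\<sigma> - s) ((k' + p - \<sigma>) / (2 * (\<alpha> - 1)))"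
  have e: "e > 0" "s + e \<le> \<sigma>" using \<alpha> \<sigma> k' by (auto simp: e_def)
  have "e \<le> (k' + p - \<sigma>) / (2 * (\<alpha> - 1))" by (simp add: e_def)
  hence "(\<alpha> - 1) * e \<le> (k' + p - \<sigma>) / 2" using \<alpha> by (simp add: field_simps)
  define \<eta> where "\<eta> = (\<alpha> - 1) * e / 2"
  have \<eta>: "\<eta> > 0" "\<sigma> + 2 * \<eta> < k' + p" using \<alpha> e k' \<open>(\<alpha> - 1) * e \<le> _\<close> by (auto simp: \<eta>_def)
  have \<eta>': "\<eta> = (\<alpha> - 1) * ((s + e) - (2 + \<gamma>) / (\<alpha> - 1)) / 2" by (simp add: \<eta>_def s)
  define X where "X = max M C"
  have X: "X \<ge> 0" using M by (simp add: X_def)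
  have "decays s k X u" "decays \<sigma> k X u"
    using decays_mono[OF M(2), of X] decays_mono[OF C(2)[of k], of X] k \<sigma> by (simp_all add: X_def)
  hence ue: "decays (s + e) k X u" using e X decays_interpolate_rate[of s k X u \<sigma> "s + e"] by auto
  obtain v where v: "duhamel_term (\<lambda>t. hardy_henon_nonlinearity \<gamma> \<alpha> (u t)) v"
    and eq: "\<And>t. t > 0 \<Longrightarrow> AE x in lebesgue. u t x = heat_semigroup t \<phi> x + a * v t x"
    using mild_solution_duhamel_term[OF mild] by blast
  define B where "B = \<alpha> * X powr (\<alpha> - 1)"
  have B: "B \<ge> 0" using \<alpha> by (simp add: B_def)
  have h: "AE y in lebesgue. \<bar>hardy_henon_nonlinearity \<gamma> \<alpha> (u t) y\<bar>
      \<le> B * (t powr (-(2 - p) / 2 - \<eta>) * norm y powr (-p) * \<bar>u t y\<bar>)" if "t > 0" for t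
    using hardy_henon_nonlinearity_le[OF \<alpha> X ue that p(1) \<eta>'] by (simp add: B_def)
  obtain Cv where Cv: "Cv > 0" "\<And>l. 0 \<le> l \<Longrightarrow> l \<le> \<sigma> \<Longrightarrow> decays (\<sigma> + 2 * \<eta>) l Cv v"
    using duhamel_decays_all_weights[OF p(2,3) less_imp_le[OF \<eta>(1)] k'(1,2) \<eta>(2) k'(4) less_imp_le[OF C(1)] C(2) v B h]
    by blast
  \<comment> \<open>The data difference admits every rate from \<sigma> on, so its rate is matched
    to the one gained by the Duhamel term; it remains below the dimension.\<close>
  define r where "r = \<sigma> + 2 * \<eta>"
  have r: "0 \<le> r" "r < DIM('a)" "\<sigma> \<le> r" using \<eta> k' \<sigma> by (auto simp: r_def)
  obtain D where D: "D \<ge> 0" "AE y in lebesgue. \<bar>\<phi> y - \<Phi> y\<bar> \<le> D * norm y powr (-r)"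
    using diff[OF r(3)] by blast
  obtain Ch where Ch: "Ch > 0"
    "\<And>(h :: 'a \<Rightarrow> real) D l. D \<ge> 0 \<Longrightarrow> AE y in lebesgue. \<bar>h y\<bar> \<le> D * norm y powr (-r) \<Longrightarrow>
      0 \<le> l \<Longrightarrow> l \<le> r \<Longrightarrow> decays r l (Ch * D) (\<lambda>t. heat_semigroup t h)"
    using heat_decays[OF r(1,2)] by blast
  have "decays r l (Ch * D + Cv) (\<lambda>t x. u t x - heat_semigroup t \<Phi> x)" if l: "0 \<le> l" "l \<le> \<sigma>" for l
  proof (rule decays_add)
    show "decays r l (Ch * D) (\<lambda>t. heat_semigroup t (\<lambda>y. \<phi> y - \<Phi> y))"
      using Ch(2)[OF D l(1)] l r by simp
    show "decays r l Cv v" using Cv(2)[OF l] by (simp add: r_def)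
    fix t :: real assume t: "t > 0"
    have "AE x in lebesgue. integrable lebesgue (\<lambda>y. heat_kernel t (x - y) * \<phi> y)"
      using mild t by (auto simp: mild_solution_def elim: AE_mp)
    thus "AE x in lebesgue. \<bar>u t x - heat_semigroup t \<Phi> x\<bar> \<le> \<bar>heat_semigroup t (\<lambda>y. \<phi> y - \<Phi> y) x\<bar> + \<bar>v t x\<bar>"
      using eq[OF t] AE_lebesgue_nonzero
    proof eventually_elim
      case (elim x)
      have "integrable lebesgue (\<lambda>y. heat_kernel t (x - y) * \<Phi> y)"
        using \<Phi> \<sigma> t elim by (intro heat_integrable[of \<sigma> t x \<Phi> E]) auto
      with elim have "heat_semigroup t (\<lambda>y. \<phi> y - \<Phi> y) x = heat_semigroup t \<phi> x - heat_semigroup t \<Phi> x"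
        by (simp add: heat_semigroup_def right_diff_distrib)
      hence "u t x - heat_semigroup t \<Phi> x = heat_semigroup t (\<lambda>y. \<phi> y - \<Phi> y) x + a * v t x"
        using elim by simp
      thus ?case using abs_triangle_ineq[of "heat_semigroup t (\<lambda>y. \<phi> y - \<Phi> y) x" "a * v t x"] a
        by (simp add: abs_mult)
    qed
  qed
  moreover have "Ch * D + Cv > 0" using Ch(1) Cv(1) D(1) by (simp add: add_nonneg_pos)
  ultimately show ?thesis using \<eta>(1) unfolding r_def by blast
qed

text \<open>The points where both |x| and |g 1 x| are at least 1 / (n + 1) exhaust the set where
  \<open>g 1\<close> does not vanish, up to a null set; so for some n they are not negligible.
  Scaling moves this set to every other time.\<close>

lemma self_similar_lower_bound:
  fixes g :: "real \<Rightarrow> 'a::euclidean_space \<Rightarrow> real"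
  assumes ss: "\<And>c. c > 0 \<Longrightarrow> AE x in lebesgue. c powr s * g (c\<^sup>2) (c *\<^sub>R x) = g 1 x"
    and nz: "\<not> (AE x in lebesgue. g 1 x = 0)" and L: "L \<ge> 0"
  shows "\<exists>b>0. \<forall>t>0. \<forall>l. 0 \<le> l \<and> l \<le> L \<longrightarrow>
    \<not> (AE x in lebesgue. norm x powr l * \<bar>g t x\<bar> < b * t powr (-(s - l) / 2))"
proof -
  define S where "S n x \<longleftrightarrow> 1 / real (Suc n) \<le> norm x \<and> 1 / real (Suc n) \<le> \<bar>g 1 x\<bar>" for n x
  have "\<exists>n. \<not> (AE x in lebesgue. \<not> S n x)"
  proof (rule ccontr)
    assume "\<not> (\<exists>n. \<not> (AE x in lebesgue. \<not> S n x))"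
    hence "AE x in lebesgue. \<forall>n. \<not> S n x" by (simp add: AE_all_countable)
    hence "AE x in lebesgue. g 1 x = 0"
      using AE_lebesgue_nonzero
    proof eventually_elim
      case (elim x)
      show ?case
      proof (rule ccontr)
        assume "g 1 x \<noteq> 0"
        hence "0 < min (norm x) \<bar>g 1 x\<bar>" using elim by simp
        then obtain n where "inverse (real (Suc n)) < min (norm x) \<bar>g 1 x\<bar>" using reals_Archimedean by blast
        hence "S n x" by (simp add: S_def inverse_eq_divide)
        thus False using elim by blast
      qed
    qed
    thus False using nz by blast
  qed
  then obtain n where n: "\<not> (AE x in lebesgue. \<not> S n x)" by blast
  define e where "e = 1 / real (Suc n)"
  have e: "0 < e" "e \<le> 1" by (auto simp: e_def)
  \<comment> \<open>Uniform in the weight: as e \<le> 1 and l \<le> L, e^L \<le> e^l \<le> |x|^l on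
    the set chosen above.\<close>
  define b where "b = e powr L * e"
  have "b > 0" using e by (simp add: b_def)
  moreover have "\<not> (AE x in lebesgue. norm x powr l * \<bar>g t x\<bar> < b * t powr (-(s - l) / 2))"
    if t: "t > 0" and l: "0 \<le> l" "l \<le> L" for t l
  proof
    assume *: "AE x in lebesgue. norm x powr l * \<bar>g t x\<bar> < b * t powr (-(s - l) / 2)"
    define c where "c = sqrt t"
    have c: "c > 0" "c\<^sup>2 = t" using t by (auto simp: c_def)
    have tc: "t powr (-(s - l) / 2) = c powr (-s) * c powr l"
    proof -
      have "t powr e = c powr (2 * e)" for e
        using c(1) unfolding c(2)[symmetric] by (simp add: powr_powr flip: powr_numeral)
      moreover have "2 * (-(s - l) / 2) = -s + l" by (simp add: field_simps)
      ultimately show ?thesis by (simp only: powr_add)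
    qed
    from AE_lebesgue_scale[OF c(1) *] ss[OF c(1)]
    have "AE x in lebesgue. \<not> S n x"
    proof eventually_elim
      case (elim x)
      show ?case
      proof
        assume "S n x"
        hence x: "e \<le> norm x" "e \<le> \<bar>g 1 x\<bar>" by (auto simp: S_def e_def)
        have "c powr (-s) * c powr s = 1" using c by (simp flip: powr_add)
        moreover have "g 1 x = c powr s * g t (c *\<^sub>R x)" using elim(2) c by simp
        ultimately have "g t (c *\<^sub>R x) = c powr (-s) * g 1 x" by simp
        hence "c powr (-s) * c powr l * (norm x powr l * \<bar>g 1 x\<bar>) < c powr (-s) * c powr l * b"
          using elim(1) c(1) unfolding tc by (simp add: powr_mult abs_mult mult_ac)
        hence "norm x powr l * \<bar>g 1 x\<bar> < b" using c(1) by (subst (asm) mult_less_cancel_left_pos) auto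
        moreover have "e powr L * e \<le> norm x powr l * \<bar>g 1 x\<bar>"
        proof (rule mult_mono)
          have "e powr L \<le> e powr l" using e l by (intro powr_mono') auto
          also have "\<dots> \<le> norm x powr l" using x e l by (intro powr_mono2) auto
          finally show "e powr L \<le> norm x powr l" .
        qed (use x e in auto)
        ultimately show False by (simp add: b_def)
      qed
    qed
    thus False using n by blast
  qed
  ultimately show ?thesis by blast
qed

lemma Linf_norm_two_sided:
  fixes u g :: "real \<Rightarrow> 'a::euclidean_space \<Rightarrow> real"
  assumes ss: "\<And>c. c > 0 \<Longrightarrow> AE x in lebesgue. c powr s * g (c\<^sup>2) (c *\<^sub>R x) = g 1 x"
    and nz: "\<not> (AE x in lebesgue. g 1 x = 0)" and L: "L \<ge> 0" "m \<le> L"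
    and meas: "\<And>t. t > 0 \<Longrightarrow> u t \<in> borel_measurable lebesgue"
    and up: "C1 > 0" "\<And>l. 0 \<le> l \<Longrightarrow> l \<le> L \<Longrightarrow> decays s l C1 u"
    and diff: "C2 > 0" "\<delta> > 0" "\<And>l. 0 \<le> l \<Longrightarrow> l \<le> L \<Longrightarrow> decays (s + 2 * \<delta>) l C2 (\<lambda>t x. u t x - g t x)"
  shows "\<exists>C>0. \<exists>T>0. \<forall>t\<ge>T. \<forall>l. 0 \<le> l \<and> l < m \<longrightarrow>
      ennreal (inverse C * t powr (-(s - l) / 2)) \<le> Linf_norm l (u t) \<and>
      Linf_norm l (u t) \<le> ennreal (C * t powr (-(s - l) / 2))"
proof -
  obtain b where b: "b > 0" "\<And>t l. t > 0 \<Longrightarrow> 0 \<le> l \<Longrightarrow> l \<le> L \<Longrightarrow>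
    \<not> (AE x in lebesgue. norm x powr l * \<bar>g t x\<bar> < b * t powr (-(s - l) / 2))"
    using self_similar_lower_bound[OF ss nz L(1)] by blast
  \<comment> \<open>From this time on C2 * t^(-\<delta>) \<le> b / 2, so the error consumes at most
    half of the lower bound b of g. The other half explains 2 / b in C.\<close>
  define T where "T = (2 * C2 / b) powr (1 / \<delta>)"
  have T: "T > 0" using b diff by (simp add: T_def)
  define C where "C = max C1 (2 / b)"
  have C: "C > 0" using up by (simp add: C_def)
  have "ennreal (inverse C * t powr (-(s - l) / 2)) \<le> Linf_norm l (u t) \<and>
      Linf_norm l (u t) \<le> ennreal (C * t powr (-(s - l) / 2))" if t: "t \<ge> T" and l: "0 \<le> l" "l \<le> L" for t l
  proof
    have t0: "t > 0" using t T by linarith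
    let ?P = "t powr (-(s - l) / 2)"
    have "T powr \<delta> \<le> t powr \<delta>" using t T diff by (intro powr_mono2) auto
    hence "2 * C2 / b \<le> t powr \<delta>" using diff b by (simp add: T_def powr_powr)
    hence small: "C2 * t powr (-\<delta>) \<le> b / 2" using b t0 by (simp add: powr_minus field_simps)
    have "\<not> (AE x in lebesgue. norm x powr l * \<bar>u t x\<bar> < b / 2 * ?P)"
    proof
      assume "AE x in lebesgue. norm x powr l * \<bar>u t x\<bar> < b / 2 * ?P"
      hence "AE x in lebesgue. norm x powr l * \<bar>g t x\<bar> < b * ?P"
        using decaysD[OF diff(3)[OF l] t0] AE_lebesgue_nonzero
      proof eventually_elim
        case (elim x)
        have "norm x powr l * \<bar>u t x - g t x\<bar> \<le> norm x powr l * (C2 * (t powr (-(s + 2 * \<delta> - l) / 2) * norm x powr (-l)))"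
          using elim by (intro mult_left_mono) auto
        also have "\<dots> = (norm x powr l * norm x powr (-l)) * (C2 * t powr (-(s + 2 * \<delta> - l) / 2))" by (simp only: mult_ac)
        also have "norm x powr l * norm x powr (-l) = 1" using elim by (simp flip: powr_add)
        also have "-(s + 2 * \<delta> - l) / 2 = -\<delta> + -(s - l) / 2" by (simp add: field_simps)
        also have "1 * (C2 * t powr (-\<delta> + -(s - l) / 2)) = (C2 * t powr (-\<delta>)) * ?P"
          by (simp only: powr_add mult.assoc mult_1)
        also have "\<dots> \<le> b / 2 * ?P" using small by (intro mult_right_mono) auto
        finally have d: "norm x powr l * \<bar>u t x - g t x\<bar> \<le> b / 2 * ?P" .
        have "norm x powr l * \<bar>g t x\<bar> \<le> norm x powr l * (\<bar>u t x\<bar> + \<bar>u t x - g t x\<bar>)"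
          by (intro mult_left_mono) auto
        also have "\<dots> = norm x powr l * \<bar>u t x\<bar> + norm x powr l * \<bar>u t x - g t x\<bar>" by (rule distrib_left)
        finally show ?case using d elim by linarith
      qed
      thus False using b(2)[OF t0 l] by blast
    qed
    hence low: "ennreal (b / 2 * ?P) \<le> Linf_norm l (u t)" by (rule Linf_norm_ge)
    have "inverse C \<le> b / 2"
    proof -
      have "inverse C \<le> inverse (2 / b)" using b C by (intro le_imp_inverse_le) (auto simp: C_def)
      thus ?thesis by simp
    qed
    hence "ennreal (inverse C * ?P) \<le> ennreal (b / 2 * ?P)" by (intro ennreal_leI mult_right_mono) auto
    with low show "ennreal (inverse C * ?P) \<le> Linf_norm l (u t)" by (rule order_trans[rotated])
    have "decays s l C u" using up(2)[OF l] by (rule decays_mono) (simp add: C_def)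
    from Linf_norm_le_of_decays[OF meas[OF t0] this t0] show "Linf_norm l (u t) \<le> ennreal (C * ?P)" .
  qed
  moreover have "l \<le> L" if "l < m" for l using that L(2) by linarith
  ultimately show ?thesis using C T by blast
qed

text \<open>The data are invariant under the scaling and so is the bound on \<open>K_norm\<close>;
  hence the rescaled solution competes in the same ball.\<close>

lemma global_solution_self_similar:
  fixes \<Phi> :: "'a::euclidean_space \<Rightarrow> real"
  assumes u: "global_solution a \<gamma> \<alpha> k M \<Phi> u" and \<alpha>: "\<alpha> > 1" and M: "M \<ge> 0"
    and s: "s = (2 + \<gamma>) / (\<alpha> - 1)" and m: "\<Phi> \<in> borel_measurable lebesgue"
    and hom: "\<And>c. c > 0 \<Longrightarrow> AE y in lebesgue. \<Phi> (c *\<^sub>R y) = c powr (-s) * \<Phi> y"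
    and c: "c > 0" and t: "t > 0"
  shows "AE x in lebesgue. c powr s * u (c\<^sup>2 * t) (c *\<^sub>R x) = u t x"
proof -
  let ?v = "\<lambda>t x. c powr s * u (c\<^sup>2 * t) (c *\<^sub>R x)"
  have mild: "mild_solution a \<gamma> \<alpha> \<Phi> u" and K: "K_norm \<gamma> \<alpha> k u \<le> ennreal M"
    and uniq: "\<And>v. mild_solution a \<gamma> \<alpha> \<Phi> v \<Longrightarrow> K_norm \<gamma> \<alpha> k v \<le> ennreal M \<Longrightarrow>
        \<forall>t>0. AE x in lebesgue. v t x = u t x"
    using u by (auto simp: global_solution_def)
  have mv: "mild_solution a \<gamma> \<alpha> \<Phi> ?v" by (rule mild_solution_scale[OF mild \<alpha> c s m hom[OF c]])
  have meas: "u t \<in> borel_measurable lebesgue" "?v t \<in> borel_measurable lebesgue" if "t > 0" for t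
    using mild mv that unfolding mild_solution_def by (blast, blast)
  have du: "decays s k M u" using K K_norm_le_iff_decays[OF meas(1) M] by (simp add: s)
  have "decays s k M ?v"
    unfolding decays_def
  proof (intro allI impI)
    fix t :: real assume t: "t > 0"
    hence "c\<^sup>2 * t > 0" using c by simp
    from AE_lebesgue_scale[OF c decaysD[OF du this]]
    show "AE x in lebesgue. \<bar>?v t x\<bar> \<le> M * (t powr (-(s - k) / 2) * norm x powr (-k))"
    proof eventually_elim
      case (elim x)
      have "(c\<^sup>2 * t) powr (-(s - k) / 2) = c powr (-(s - k)) * t powr (-(s - k) / 2)"
      proof -
        have "(c\<^sup>2) powr (-(s - k) / 2) = c powr (2 * (-(s - k) / 2))"
          using c by (simp add: powr_powr flip: powr_numeral)
        also have "2 * (-(s - k) / 2) = -(s - k)" by (simp add: field_simps)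
        finally show ?thesis using t by (simp add: powr_mult)
      qed
      moreover have "norm (c *\<^sub>R x) powr (-k) = c powr (-k) * norm x powr (-k)"
        using c by (simp add: powr_mult)
      moreover have "c powr s * (c powr (-(s - k)) * c powr (-k)) = 1"
        using c by (simp flip: powr_add)
      ultimately have e: "c powr s * ((c\<^sup>2 * t) powr (-(s - k) / 2) * norm (c *\<^sub>R x) powr (-k))
          = t powr (-(s - k) / 2) * norm x powr (-k)" by (simp add: mult_ac)
      have "\<bar>?v t x\<bar> = c powr s * \<bar>u (c\<^sup>2 * t) (c *\<^sub>R x)\<bar>" by (simp add: abs_mult)
      also have "\<dots> \<le> c powr s * (M * ((c\<^sup>2 * t) powr (-(s - k) / 2) * norm (c *\<^sub>R x) powr (-k)))"
        using elim by (intro mult_left_mono) auto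
      also have "\<dots> = M * (t powr (-(s - k) / 2) * norm x powr (-k))"
        unfolding e[symmetric] by (simp only: mult_ac)
      finally show ?case .
    qed
  qed
  hence "K_norm \<gamma> \<alpha> k ?v \<le> ennreal M" using K_norm_le_iff_decays[OF meas(2) M] by (simp add: s)
  from uniq[OF mv this] t show ?thesis by simp
qed

text \<open>If the solution vanishes, so does its Duhamel term. This reduces the nonvanishing of the
  self-similar solution to the injectivity of the heat semigroup.\<close>

lemma mild_solution_zero_data:
  assumes mild: "mild_solution a \<gamma> \<alpha> \<Phi> u" and z: "\<And>t. t > 0 \<Longrightarrow> AE x in lebesgue. u t x = 0" and t: "t > 0"
  shows "AE x in lebesgue. heat_semigroup t \<Phi> x = 0"
proof -
  have "heat_semigroup (t - \<tau>) (hardy_henon_nonlinearity \<gamma> \<alpha> (u \<tau>)) x = 0" if "\<tau> > 0" for \<tau> x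
    unfolding heat_semigroup_def
  proof (rule integral_eq_zero_AE)
    show "AE y in lebesgue. heat_kernel (t - \<tau>) (x - y) * hardy_henon_nonlinearity \<gamma> \<alpha> (u \<tau>) y = 0"
      using z[OF that] by eventually_elim (simp add: hardy_henon_nonlinearity_def)
  qed
  hence I: "(LINT \<tau>:{0<..<t}|lebesgue. heat_semigroup (t - \<tau>) (hardy_henon_nonlinearity \<gamma> \<alpha> (u \<tau>)) x) = 0" for x
    unfolding set_lebesgue_integral_def by (intro integral_eq_zero_AE AE_I2) (auto simp: indicator_def)
  from mild t have "AE x in lebesgue. u t x = heat_semigroup t \<Phi> x +
      a * (LINT \<tau>:{0<..<t}|lebesgue. heat_semigroup (t - \<tau>) (hardy_henon_nonlinearity \<gamma> \<alpha> (u \<tau>)) x)"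
    by (auto simp: mild_solution_def elim: AE_mp)
  with z[OF t] show ?thesis by eventually_elim (simp add: I)
qed

section \<open>The initial data\<close>

lemma homogeneous_data_properties:
  fixes \<omega> :: "'a::euclidean_space \<Rightarrow> real"
  assumes m[measurable]: "\<omega> \<in> borel_measurable lebesgue"
  shows "homogeneous_data \<omega> \<sigma> \<in> borel_measurable lebesgue"
    and "homogeneous_deg0 \<omega> \<Longrightarrow> c > 0 \<Longrightarrow>
      AE y in lebesgue. homogeneous_data \<omega> \<sigma> (c *\<^sub>R y) = c powr (-\<sigma>) * homogeneous_data \<omega> \<sigma> y"
    and "E \<ge> 0 \<Longrightarrow> Linf_norm 0 \<omega> \<le> ennreal E \<Longrightarrow> AE y in lebesgue. \<bar>homogeneous_data \<omega> \<sigma> y\<bar> \<le> E * norm y powr (-\<sigma>)"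
    and "AE y in lebesgue. homogeneous_data \<omega> \<sigma> y = 0 \<Longrightarrow> AE y in lebesgue. \<omega> y = 0"
proof -
  show "homogeneous_data \<omega> \<sigma> \<in> borel_measurable lebesgue"
    unfolding homogeneous_data_def[abs_def] by measurable
  show "AE y in lebesgue. homogeneous_data \<omega> \<sigma> (c *\<^sub>R y) = c powr (-\<sigma>) * homogeneous_data \<omega> \<sigma> y"
    if "homogeneous_deg0 \<omega>" "c > 0"
  proof -
    have "AE y in lebesgue. \<omega> (c *\<^sub>R y) = \<omega> y" using that by (simp add: homogeneous_deg0_def)
    thus ?thesis by eventually_elim (use that in \<open>simp add: homogeneous_data_def powr_mult\<close>)
  qed
  show "AE y in lebesgue. \<bar>homogeneous_data \<omega> \<sigma> y\<bar> \<le> E * norm y powr (-\<sigma>)"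
    if "E \<ge> 0" "Linf_norm 0 \<omega> \<le> ennreal E"
  proof -
    have "AE y in lebesgue. ennreal (norm y powr 0 * \<bar>\<omega> y\<bar>) \<le> Linf_norm 0 \<omega>"
      unfolding Linf_norm_def by (rule esssup_AE)
    thus ?thesis using AE_lebesgue_nonzero
    proof eventually_elim
      case (elim y)
      have "ennreal (norm y powr 0 * \<bar>\<omega> y\<bar>) \<le> ennreal E" using elim(1) that(2) by (rule order_trans)
      hence "\<bar>\<omega> y\<bar> \<le> E" using elim that(1) by simp
      thus ?case by (simp add: homogeneous_data_def abs_mult mult_right_mono)
    qed
  qed
  show "AE y in lebesgue. \<omega> y = 0" if "AE y in lebesgue. homogeneous_data \<omega> \<sigma> y = 0"
    using that AE_lebesgue_nonzero by eventually_elim (simp add: homogeneous_data_def)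
qed

text \<open>The difference vanishes for |y| \<ge> A, and for |y| < A the singularity can be made
  worse at no cost: |y|^(-\<sigma>) \<le> A^(r - \<sigma>) |y|^(-r). A faster spatial decay of the
  data is a faster decay in time of their heat extension.\<close>

lemma data_difference_bound:
  fixes \<phi> \<omega> :: "'a::euclidean_space \<Rightarrow> real"
  assumes \<phi>: "\<And>x. \<bar>\<phi> x\<bar> \<le> c * (1 + (norm x)\<^sup>2) powr (-\<sigma> / 2)" and \<sigma>: "\<sigma> \<ge> 0"
    and A: "A > 0" "\<And>x. norm x \<ge> A \<Longrightarrow> \<phi> x = \<omega> x * norm x powr (-\<sigma>)"
    and E: "E \<ge> 0" "AE y in lebesgue. \<bar>homogeneous_data \<omega> \<sigma> y\<bar> \<le> E * norm y powr (-\<sigma>)"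
  shows "c \<ge> 0" and "AE y in lebesgue. \<bar>\<phi> y\<bar> \<le> c * norm y powr (-\<sigma>)"
    and "\<sigma> \<le> r \<Longrightarrow> \<exists>D\<ge>0. AE y in lebesgue. \<bar>\<phi> y - homogeneous_data \<omega> \<sigma> y\<bar> \<le> D * norm y powr (-r)"
proof -
  have "0 \<le> \<bar>\<phi> 0\<bar>" by simp
  also have "\<dots> \<le> c" using \<phi>[of 0] by simp
  finally show c: "c \<ge> 0" .
  have bd: "\<bar>\<phi> y\<bar> \<le> c * norm y powr (-\<sigma>)" if "y \<noteq> 0" for y
  proof -
    have "(1 + (norm y)\<^sup>2) powr (-\<sigma> / 2) \<le> ((norm y)\<^sup>2) powr (-\<sigma> / 2)"
      using that \<sigma> by (intro powr_mono2') auto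
    also have "\<dots> = norm y powr (-\<sigma>)" using that by (simp add: powr_powr flip: powr_numeral)
    finally show ?thesis using c by (intro order_trans[OF \<phi>] mult_left_mono)
  qed
  show "AE y in lebesgue. \<bar>\<phi> y\<bar> \<le> c * norm y powr (-\<sigma>)"
    using AE_lebesgue_nonzero by eventually_elim (rule bd)
  show "\<exists>D\<ge>0. AE y in lebesgue. \<bar>\<phi> y - homogeneous_data \<omega> \<sigma> y\<bar> \<le> D * norm y powr (-r)" if r: "\<sigma> \<le> r"
  proof (intro exI conjI)
    show "0 \<le> (c + E) * A powr (r - \<sigma>)" using c E(1) by simp
    show "AE y in lebesgue. \<bar>\<phi> y - homogeneous_data \<omega> \<sigma> y\<bar> \<le> (c + E) * A powr (r - \<sigma>) * norm y powr (-r)"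
      using AE_lebesgue_nonzero E(2)
    proof eventually_elim
      case (elim y)
      show ?case
      proof (cases "norm y \<ge> A")
        case True
        thus ?thesis using A(2)[OF True] c E(1) by (simp add: homogeneous_data_def)
      next
        case False
        have "norm y powr (-\<sigma>) = norm y powr (r - \<sigma>) * norm y powr (-r)" by (simp flip: powr_add)
        also have "\<dots> \<le> A powr (r - \<sigma>) * norm y powr (-r)"
          using False r by (intro mult_right_mono powr_mono2) auto
        finally have le: "norm y powr (-\<sigma>) \<le> A powr (r - \<sigma>) * norm y powr (-r)" .
        have "\<bar>\<phi> y - homogeneous_data \<omega> \<sigma> y\<bar> \<le> \<bar>\<phi> y\<bar> + \<bar>homogeneous_data \<omega> \<sigma> y\<bar>" by (rule abs_triangle_ineq4)
        also have "\<dots> \<le> c * norm y powr (-\<sigma>) + E * norm y powr (-\<sigma>)" using bd elim by (intro add_mono) auto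
        also have "\<dots> = (c + E) * norm y powr (-\<sigma>)" by (simp add: distrib_right)
        also have "\<dots> \<le> (c + E) * (A powr (r - \<sigma>) * norm y powr (-r))"
          using le c E(1) by (intro mult_left_mono) auto
        finally show ?thesis by (simp add: mult.assoc)
      qed
    qed
  qed
qed

text \<open>Passing to a Borel version of the data turns the semigroup into a parameter integral of
  a jointly measurable function.\<close>

lemma heat_semigroup_measurable_lebesgue:
  fixes \<Phi> :: "'a::euclidean_space \<Rightarrow> real"
  assumes m: "\<Phi> \<in> borel_measurable lebesgue"
  shows "heat_semigroup t \<Phi> \<in> borel_measurable lebesgue"
proof -
  obtain f where f[measurable]: "f \<in> borel_measurable borel" and \<Phi>f: "AE x in lborel. \<Phi> x = f x"
    using completion_ex_borel_measurable_real[OF m] by auto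
  have "heat_semigroup t \<Phi> x = (LINT y|lborel. heat_kernel t (x - y) * f y)" for x
  proof -
    have "heat_semigroup t \<Phi> x = (LINT y|lebesgue. heat_kernel t (x - y) * f y)"
      unfolding heat_semigroup_def
    proof (rule integral_cong_AE)
      show "(\<lambda>y. heat_kernel t (x - y) * f y) \<in> borel_measurable lebesgue"
        by (rule measurable_completion) measurable
      show "AE y in lebesgue. heat_kernel t (x - y) * \<Phi> y = heat_kernel t (x - y) * f y"
        using AE_completion[OF \<Phi>f] by eventually_elim simp
    qed (use m in measurable)
    thus ?thesis by (simp add: integral_completion)
  qed
  hence "heat_semigroup t \<Phi> = (\<lambda>x. LINT y|lborel. heat_kernel t (x - y) * f y)" by (rule ext)
  thus ?thesis by simp (rule measurable_completion, measurable)
qed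

text \<open>The thresholds \<open>k\<^sub>0\<close>, \<open>M\<^sub>0\<close> and
  \<open>\<epsilon>\<close> express that k is close to its upper bound and that M and the data are
  small. The constants C, \<delta> and T are chosen before the weight l, so the estimates are
  uniform in it.\<close>

theorem corollary1:
  fixes d :: nat and a \<gamma> \<alpha> \<sigma> :: real
  assumes "d = DIM('a::euclidean_space)"
    and "a \<in> {-1, 1}"
    and "\<gamma> > - min 2 (real d)"
    and "\<alpha> > 1 + (2 + \<gamma>) / real d"
    and "(2 + \<gamma>) / (\<alpha> - 1) \<le> \<sigma>" and "\<sigma> < real d"
  shows
    "\<exists>k\<^sub>0 < min ((2 + \<gamma>) / (\<alpha> - 1)) ((real d + \<gamma>) / \<alpha>).
     \<forall>k. k\<^sub>0 < k \<and> 0 \<le> k \<and> (2 + \<gamma> * \<alpha>) / (\<alpha> * (\<alpha> - 1)) < k \<and>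
         k < min ((2 + \<gamma>) / (\<alpha> - 1)) ((real d + \<gamma>) / \<alpha>) \<longrightarrow>
     (\<exists>M\<^sub>0>0. \<forall>M. 0 < M \<and> M \<le> M\<^sub>0 \<longrightarrow> (\<exists>\<epsilon>>0.
       \<forall>(\<omega> :: 'a \<Rightarrow> real) (\<phi> :: 'a \<Rightarrow> real) (c :: real) (A :: real) (u :: real \<Rightarrow> 'a \<Rightarrow> real).
         \<omega> \<in> borel_measurable lebesgue \<and> Linf_norm 0 \<omega> \<le> ennreal \<epsilon> \<and>
         homogeneous_deg0 \<omega> \<and> \<not> (AE x in lebesgue. \<omega> x = 0) \<and>
         continuous_on UNIV \<phi> \<and>
         c \<le> \<epsilon> \<and> (\<forall>x. \<bar>\<phi> x\<bar> \<le> c * (1 + (norm x)\<^sup>2) powr (- \<sigma> / 2)) \<and>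
         A > 0 \<and> (\<forall>x. norm x \<ge> A \<longrightarrow> \<phi> x = \<omega> x * norm x powr (- \<sigma>)) \<and>
         global_solution a \<gamma> \<alpha> k M \<phi> u
       \<longrightarrow>
         (\<sigma> = (2 + \<gamma>) / (\<alpha> - 1) \<longrightarrow>
           (\<forall>u\<^sub>S. global_solution a \<gamma> \<alpha> k M
                     (homogeneous_data \<omega> ((2 + \<gamma>) / (\<alpha> - 1))) u\<^sub>S \<longrightarrow>
             (\<exists>C>0. \<exists>\<delta>>0. \<forall>t>0. \<forall>l.
                0 \<le> l \<and> l < min ((2 + \<gamma>) / (\<alpha> - 1)) ((real d + \<gamma>) / \<alpha>) \<longrightarrow>
                Linf_norm l (\<lambda>x. u t x - u\<^sub>S t x) \<le>
                  ennreal (C * t powr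
                    (- (real d / 2) * (1 / critical_exponent d \<gamma> \<alpha> - l / real d) - \<delta>))) \<and>
             (\<exists>C>0. \<exists>T>0. \<forall>t\<ge>T. \<forall>l.
                0 \<le> l \<and> l < min ((2 + \<gamma>) / (\<alpha> - 1)) ((real d + \<gamma>) / \<alpha>) \<longrightarrow>
                ennreal (inverse C * t powr
                    (- (real d / 2) * (1 / critical_exponent d \<gamma> \<alpha> - l / real d)))
                  \<le> Linf_norm l (u t) \<and>
                Linf_norm l (u t) \<le>
                  ennreal (C * t powr
                    (- (real d / 2) * (1 / critical_exponent d \<gamma> \<alpha> - l / real d)))))) \<and>
         (\<sigma> > (2 + \<gamma>) / (\<alpha> - 1) \<longrightarrow>
           (\<exists>C>0. \<exists>\<delta>>0. \<forall>t>0. \<forall>l.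
              0 \<le> l \<and> l < min \<sigma> ((real d + \<gamma>) / \<alpha>) \<longrightarrow>
              Linf_norm l (\<lambda>x. u t x - heat_semigroup t (homogeneous_data \<omega> \<sigma>) x) \<le>
                ennreal (C * t powr (- (real d / 2) * (\<sigma> / real d - l / real d) - \<delta>))) \<and>
           (\<exists>C>0. \<exists>T>0. \<forall>t\<ge>T. \<forall>l.
              0 \<le> l \<and> l < min \<sigma> ((real d + \<gamma>) / \<alpha>) \<longrightarrow>
              ennreal (inverse C * t powr (- (real d / 2) * (\<sigma> / real d - l / real d)))
                \<le> Linf_norm l (u t) \<and>
              Linf_norm l (u t) \<le>
                ennreal (C * t powr (- (real d / 2) * (\<sigma> / real d - l / real d)))))))"
proof -
  define s where "s = (2 + \<gamma>) / (\<alpha> - 1)"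
  define m where "m = min s ((real d + \<gamma>) / \<alpha>)"
  define m' where "m' = min \<sigma> ((real d + \<gamma>) / \<alpha>)"
  have d: "real d = DIM('a)" "real d > 0" using assms(1) by auto
  have \<gamma>: "\<gamma> > - 2" "\<gamma> > - real d" using assms(3) by auto
  have "(2 + \<gamma>) / real d > 0" using \<gamma> d by simp
  hence \<alpha>: "\<alpha> > 1" using assms(4) by linarith
  have s0: "s > 0" using \<gamma> \<alpha> by (simp add: s_def)
  have sd: "s < DIM('a)" using assms(5,6) d by (simp add: s_def)
  have \<sigma>: "s \<le> \<sigma>" "\<sigma> < DIM('a)" "0 < \<sigma>" using assms(5,6) d s0 by (auto simp: s_def)
  have a1: "\<bar>a\<bar> = 1" using assms(2) by auto
  have crit: "- (real d / 2) * (1 / critical_exponent d \<gamma> \<alpha> - l / real d) = -(s - l) / 2" for l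
  proof -
    have "1 / critical_exponent d \<gamma> \<alpha> = s / real d" by (simp add: critical_exponent_def s_def)
    thus ?thesis using d(2) by (simp add: field_simps)
  qed
  have lin: "- (real d / 2) * (\<sigma> / real d - l / real d) = -(\<sigma> - l) / 2" for l
    using d(2) by (simp add: field_simps)
  have ms: "m \<le> s" and m\<sigma>: "m' \<le> \<sigma>" by (simp_all add: m_def m'_def)
  \<comment> \<open>With this choice s + 2 \<delta> is the midpoint of s and the dimension, a rate
    above s that the heat semigroup can still reach.\<close>
  define \<delta> where "\<delta> = (DIM('a) - s) / 4"
  have \<delta>: "\<delta> > 0" "0 < s + 2 * \<delta>" "s + 2 * \<delta> < DIM('a)"
    using sd s0 by (auto simp: \<delta>_def field_simps)
  have main: "\<exists>M\<^sub>0>0. \<forall>M. 0 < M \<and> M \<le> M\<^sub>0 \<longrightarrow> (\<exists>\<epsilon>>0.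
       \<forall>(\<omega> :: 'a \<Rightarrow> real) (\<phi> :: 'a \<Rightarrow> real) (c :: real) (A :: real) (u :: real \<Rightarrow> 'a \<Rightarrow> real).
         \<omega> \<in> borel_measurable lebesgue \<and> Linf_norm 0 \<omega> \<le> ennreal \<epsilon> \<and>
         homogeneous_deg0 \<omega> \<and> \<not> (AE x in lebesgue. \<omega> x = 0) \<and>
         continuous_on UNIV \<phi> \<and>
         c \<le> \<epsilon> \<and> (\<forall>x. \<bar>\<phi> x\<bar> \<le> c * (1 + (norm x)\<^sup>2) powr (- \<sigma> / 2)) \<and>
         A > 0 \<and> (\<forall>x. norm x \<ge> A \<longrightarrow> \<phi> x = \<omega> x * norm x powr (- \<sigma>)) \<and>
         global_solution a \<gamma> \<alpha> k M \<phi> u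
       \<longrightarrow>
         (\<sigma> = s \<longrightarrow>
           (\<forall>u\<^sub>S. global_solution a \<gamma> \<alpha> k M
                     (homogeneous_data \<omega> s) u\<^sub>S \<longrightarrow>
             (\<exists>C>0. \<exists>\<delta>>0. \<forall>t>0. \<forall>l.
                0 \<le> l \<and> l < m \<longrightarrow>
                Linf_norm l (\<lambda>x. u t x - u\<^sub>S t x) \<le>
                  ennreal (C * t powr
                    (-(s - l) / 2 - \<delta>))) \<and>
             (\<exists>C>0. \<exists>T>0. \<forall>t\<ge>T. \<forall>l.
                0 \<le> l \<and> l < m \<longrightarrow>
                ennreal (inverse C * t powr
                    (-(s - l) / 2))
                  \<le> Linf_norm l (u t) \<and>
                Linf_norm l (u t) \<le>
                  ennreal (C * t powr
                    (-(s - l) / 2))))) \<and>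
         (\<sigma> > s \<longrightarrow>
           (\<exists>C>0. \<exists>\<delta>>0. \<forall>t>0. \<forall>l.
              0 \<le> l \<and> l < m' \<longrightarrow>
              Linf_norm l (\<lambda>x. u t x - heat_semigroup t (homogeneous_data \<omega> \<sigma>) x) \<le>
                ennreal (C * t powr (-(\<sigma> - l) / 2 - \<delta>))) \<and>
           (\<exists>C>0. \<exists>T>0. \<forall>t\<ge>T. \<forall>l.
              0 \<le> l \<and> l < m' \<longrightarrow>
              ennreal (inverse C * t powr (-(\<sigma> - l) / 2))
                \<le> Linf_norm l (u t) \<and>
              Linf_norm l (u t) \<le>
                ennreal (C * t powr (-(\<sigma> - l) / 2)))))"
    if k: "0 \<le> k" "(2 + \<gamma> * \<alpha>) / (\<alpha> * (\<alpha> - 1)) < k" "k < m" for k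
  proof -
    define p where "p = k * (\<alpha> - 1) - \<gamma>"
    have ks: "k < s" "k < (DIM('a) + \<gamma>) / \<alpha>" using k(3) d by (auto simp: m_def)
    have p2: "p < 2" using ks(1) \<alpha> by (simp add: p_def s_def field_simps)
    have kp: "k + p < DIM('a)" using ks(2) \<alpha> by (simp add: p_def field_simps)
    have skp: "s < k + p"
    proof -
      have "(2 + \<gamma> * \<alpha>) / (\<alpha> - 1) < k * \<alpha>" using k(2) \<alpha> by (simp add: field_simps)
      moreover have "(2 + \<gamma> * \<alpha>) / (\<alpha> - 1) = \<gamma> + s" using \<alpha> by (simp add: s_def field_simps)
      ultimately show ?thesis by (simp add: p_def algebra_simps)
    qed
    have p0: "0 < p" using skp ks by linarith
    \<comment> \<open>Used for two rates: \<sigma> for the size of u itself, and s + 2 \<delta> for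
      u - u_S. Each comes with its own threshold for M.\<close>
    note diff_decay = mild_solutions_difference_decay[OF \<alpha> s_def p_def p0 p2 k(1) less_imp_le[OF ks(1)] skp kp]
    obtain M1 where M1: "M1 > 0"
      "\<And>a (\<phi>1 :: 'a \<Rightarrow> real) \<phi>2 u1 u2 M D. \<bar>a\<bar> = 1 \<Longrightarrow> 0 \<le> M \<Longrightarrow> M \<le> M1 \<Longrightarrow>
        mild_solution a \<gamma> \<alpha> \<phi>1 u1 \<Longrightarrow> mild_solution a \<gamma> \<alpha> \<phi>2 u2 \<Longrightarrow>
        decays s k M u1 \<Longrightarrow> decays s k M u2 \<Longrightarrow>
        D \<ge> 0 \<Longrightarrow> AE y in lebesgue. \<bar>\<phi>1 y - \<phi>2 y\<bar> \<le> D * norm y powr (-\<sigma>) \<Longrightarrow>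
        \<exists>C>0. \<forall>l. 0 \<le> l \<and> l \<le> \<sigma> \<longrightarrow> decays \<sigma> l C (\<lambda>t x. u1 t x - u2 t x)"
      using diff_decay[OF \<sigma>(3,2)] by blast
    obtain M2 where M2: "M2 > 0"
      "\<And>a (\<phi>1 :: 'a \<Rightarrow> real) \<phi>2 u1 u2 M D. \<bar>a\<bar> = 1 \<Longrightarrow> 0 \<le> M \<Longrightarrow> M \<le> M2 \<Longrightarrow>
        mild_solution a \<gamma> \<alpha> \<phi>1 u1 \<Longrightarrow> mild_solution a \<gamma> \<alpha> \<phi>2 u2 \<Longrightarrow>
        decays s k M u1 \<Longrightarrow> decays s k M u2 \<Longrightarrow>
        D \<ge> 0 \<Longrightarrow> AE y in lebesgue. \<bar>\<phi>1 y - \<phi>2 y\<bar> \<le> D * norm y powr (-(s + 2 * \<delta>)) \<Longrightarrow>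
        \<exists>C>0. \<forall>l. 0 \<le> l \<and> l \<le> s + 2 * \<delta> \<longrightarrow> decays (s + 2 * \<delta>) l C (\<lambda>t x. u1 t x - u2 t x)"
      using diff_decay[OF \<delta>(2,3)] by blast
    have concl: "(\<sigma> = s \<longrightarrow>
           (\<forall>u\<^sub>S. global_solution a \<gamma> \<alpha> k M
                     (homogeneous_data \<omega> s) u\<^sub>S \<longrightarrow>
             (\<exists>C>0. \<exists>\<delta>>0. \<forall>t>0. \<forall>l.
                0 \<le> l \<and> l < m \<longrightarrow>
                Linf_norm l (\<lambda>x. u t x - u\<^sub>S t x) \<le>
                  ennreal (C * t powr
                    (-(s - l) / 2 - \<delta>))) \<and>
             (\<exists>C>0. \<exists>T>0. \<forall>t\<ge>T. \<forall>l.
                0 \<le> l \<and> l < m \<longrightarrow>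
                ennreal (inverse C * t powr
                    (-(s - l) / 2))
                  \<le> Linf_norm l (u t) \<and>
                Linf_norm l (u t) \<le>
                  ennreal (C * t powr
                    (-(s - l) / 2))))) \<and>
         (\<sigma> > s \<longrightarrow>
           (\<exists>C>0. \<exists>\<delta>>0. \<forall>t>0. \<forall>l.
              0 \<le> l \<and> l < m' \<longrightarrow>
              Linf_norm l (\<lambda>x. u t x - heat_semigroup t (homogeneous_data \<omega> \<sigma>) x) \<le>
                ennreal (C * t powr (-(\<sigma> - l) / 2 - \<delta>))) \<and>
           (\<exists>C>0. \<exists>T>0. \<forall>t\<ge>T. \<forall>l.
              0 \<le> l \<and> l < m' \<longrightarrow>
              ennreal (inverse C * t powr (-(\<sigma> - l) / 2))
                \<le> Linf_norm l (u t) \<and>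
              Linf_norm l (u t) \<le>
                ennreal (C * t powr (-(\<sigma> - l) / 2))))"
      if M: "0 < M" "M \<le> min M1 M2"
        and \<omega>: "\<omega> \<in> borel_measurable lebesgue" "Linf_norm 0 \<omega> \<le> ennreal 1" "homogeneous_deg0 \<omega>"
          "\<not> (AE x in lebesgue. \<omega> x = 0)"
        and \<phi>: "\<forall>x. \<bar>\<phi> x\<bar> \<le> c * (1 + (norm x)\<^sup>2) powr (- \<sigma> / 2)"
        and A: "A > 0" "\<forall>x. norm x \<ge> A \<longrightarrow> \<phi> x = \<omega> x * norm x powr (- \<sigma>)"
        and u: "global_solution a \<gamma> \<alpha> k M \<phi> u"
      for M c A :: real and \<omega> \<phi> :: "'a \<Rightarrow> real" and u :: "real \<Rightarrow> 'a \<Rightarrow> real"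
    proof -
      have M0: "0 \<le> M" "M \<le> M1" "M \<le> M2" using M by auto
      let ?\<Phi> = "homogeneous_data \<omega> \<sigma>"
      have \<Phi>m: "?\<Phi> \<in> borel_measurable lebesgue" by (rule homogeneous_data_properties(1)[OF \<omega>(1)])
      have \<Phi>hom: "AE y in lebesgue. ?\<Phi> (c *\<^sub>R y) = c powr (-\<sigma>) * ?\<Phi> y" if "c > 0" for c
        by (rule homogeneous_data_properties(2)[OF \<omega>(1,3) that])
      have \<Phi>b: "AE y in lebesgue. \<bar>?\<Phi> y\<bar> \<le> 1 * norm y powr (-\<sigma>)"
        by (rule homogeneous_data_properties(3)[OF \<omega>(1) _ \<omega>(2)]) simp
      have \<Phi>nz: "\<not> (AE y in lebesgue. ?\<Phi> y = 0)" using homogeneous_data_properties(4)[OF \<omega>(1)] \<omega>(4) by blast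
      note data = data_difference_bound[OF \<phi>[rule_format] less_imp_le[OF \<sigma>(3)] A(1) A(2)[rule_format] zero_le_one \<Phi>b]
      have decays_global: "decays s k M w"
        and meas_global: "\<And>t. t > 0 \<Longrightarrow> w t \<in> borel_measurable lebesgue"
        if "global_solution a \<gamma> \<alpha> k M \<psi> w" for \<psi> and w :: "real \<Rightarrow> 'a \<Rightarrow> real"
      proof -
        from that have w: "mild_solution a \<gamma> \<alpha> \<psi> w" "K_norm \<gamma> \<alpha> k w \<le> ennreal M"
          by (auto simp: global_solution_def)
        show m: "w t \<in> borel_measurable lebesgue" if "t > 0" for t using w(1) that by (simp add: mild_solution_def)
        show "decays s k M w" using w(2) K_norm_le_iff_decays[OF m M0(1)] by (simp add: s_def)
      qed
      have mild: "mild_solution a \<gamma> \<alpha> \<phi> u" using u by (simp add: global_solution_def)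
      note du = decays_global[OF u] and um = meas_global[OF u]
      \<comment> \<open>The comparison with the zero solution; its data differ from \<phi> by
        \<phi>, which is bounded by c |y|^(-\<sigma>).\<close>
      have "\<exists>C>0. \<forall>l. 0 \<le> l \<and> l \<le> \<sigma> \<longrightarrow> decays \<sigma> l C (\<lambda>t x. u t x - 0)"
        using data(1,2) M0
        by (intro M1(2)[OF a1 M0(1,2) mild mild_solution_zero du, of c]) (auto simp: decays_def)
      then obtain Cu where Cu: "Cu > 0" "\<And>l. 0 \<le> l \<Longrightarrow> l \<le> \<sigma> \<Longrightarrow> decays \<sigma> l Cu u" by auto
      have exponent: "-(r - l) / 2 - \<eta> = -(r + 2 * \<eta> - l) / 2" for r l \<eta> :: real by (simp add: field_simps)
      have nonlinear: "\<exists>C>0. \<exists>\<delta>>0. \<forall>t>0. \<forall>l. 0 \<le> l \<and> l < m \<longrightarrow>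
            Linf_norm l (\<lambda>x. u t x - u\<^sub>S t x) \<le> ennreal (C * t powr (-(s - l) / 2 - \<delta>))"
          "\<exists>C>0. \<exists>T>0. \<forall>t\<ge>T. \<forall>l. 0 \<le> l \<and> l < m \<longrightarrow>
            ennreal (inverse C * t powr (-(s - l) / 2)) \<le> Linf_norm l (u t) \<and>
            Linf_norm l (u t) \<le> ennreal (C * t powr (-(s - l) / 2))"
        if \<sigma>s: "\<sigma> = s" and uS': "global_solution a \<gamma> \<alpha> k M (homogeneous_data \<omega> s) u\<^sub>S" for u\<^sub>S
      proof -
        have uS: "global_solution a \<gamma> \<alpha> k M ?\<Phi> u\<^sub>S" using uS' \<sigma>s by simp
        hence mildS: "mild_solution a \<gamma> \<alpha> ?\<Phi> u\<^sub>S" by (simp add: global_solution_def)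
        have "s + 2 * \<delta> \<ge> \<sigma>" using \<sigma>s \<delta> by simp
        then obtain D where D: "D \<ge> 0" "AE y in lebesgue. \<bar>\<phi> y - ?\<Phi> y\<bar> \<le> D * norm y powr (-(s + 2 * \<delta>))"
          using data(3) by blast
        obtain C where C: "C > 0"
          "\<And>l. 0 \<le> l \<Longrightarrow> l \<le> s + 2 * \<delta> \<Longrightarrow> decays (s + 2 * \<delta>) l C (\<lambda>t x. u t x - u\<^sub>S t x)"
          using M2(2)[OF a1 M0(1,3) mild mildS du decays_global[OF uS] D] by blast
        have ss: "AE x in lebesgue. c powr s * u\<^sub>S (c\<^sup>2 * t) (c *\<^sub>R x) = u\<^sub>S t x" if "c > 0" "t > 0" for c t
          using \<Phi>hom unfolding \<sigma>s
          by (intro global_solution_self_similar[OF uS[unfolded \<sigma>s] \<alpha> M0(1) s_def \<Phi>m[unfolded \<sigma>s] _ that])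
        \<comment> \<open>By self-similarity, vanishing at time 1 would mean vanishing at all times,
          and then the data would vanish.\<close>
        have nz: "\<not> (AE x in lebesgue. u\<^sub>S 1 x = 0)"
        proof
          assume z1: "AE x in lebesgue. u\<^sub>S 1 x = 0"
          have z: "AE x in lebesgue. u\<^sub>S t x = 0" if t: "t > 0" for t
          proof -
            define c where "c = 1 / sqrt t"
            have c: "c > 0" "c\<^sup>2 * t = 1" using t by (auto simp: c_def power_divide)
            from ss[OF c(1) t] AE_lebesgue_scale[OF c(1) z1] show ?thesis
              by eventually_elim (simp add: c)
          qed
          have "AE y in lebesgue. ?\<Phi> y = 0"
            by (rule heat_semigroup_injective[OF \<Phi>m less_imp_le[OF \<sigma>(3)] \<sigma>(2) zero_le_one \<Phi>b])
              (rule mild_solution_zero_data[OF mildS z])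
          thus False using \<Phi>nz by blast
        qed
        have "\<forall>t>0. \<forall>l. 0 \<le> l \<and> l < m \<longrightarrow>
            Linf_norm l (\<lambda>x. u t x - u\<^sub>S t x) \<le> ennreal (C * t powr (-(s - l) / 2 - \<delta>))"
        proof (intro allI impI)
          fix t l :: real assume t: "t > 0" and l: "0 \<le> l \<and> l < m"
          have "(\<lambda>x. u t x - u\<^sub>S t x) \<in> borel_measurable lebesgue"
            using um[OF t] meas_global[OF uS t] by (rule borel_measurable_diff)
          thus "Linf_norm l (\<lambda>x. u t x - u\<^sub>S t x) \<le> ennreal (C * t powr (-(s - l) / 2 - \<delta>))"
            unfolding exponent using l ms \<delta>(1) t C(2)[of l]
            by (intro Linf_norm_le_of_decays[where w="\<lambda>t x. u t x - u\<^sub>S t x"]) auto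
        qed
        thus "\<exists>C>0. \<exists>\<delta>>0. \<forall>t>0. \<forall>l. 0 \<le> l \<and> l < m \<longrightarrow>
            Linf_norm l (\<lambda>x. u t x - u\<^sub>S t x) \<le> ennreal (C * t powr (-(s - l) / 2 - \<delta>))"
          using C(1) \<delta>(1) by blast
        show "\<exists>C>0. \<exists>T>0. \<forall>t\<ge>T. \<forall>l. 0 \<le> l \<and> l < m \<longrightarrow>
            ennreal (inverse C * t powr (-(s - l) / 2)) \<le> Linf_norm l (u t) \<and>
            Linf_norm l (u t) \<le> ennreal (C * t powr (-(s - l) / 2))"
          by (rule Linf_norm_two_sided[OF _ nz less_imp_le[OF s0] ms um Cu(1) Cu(2)[unfolded \<sigma>s] C(1) \<delta>(1) C(2)])
            (use ss[of _ 1] \<delta> in auto)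
      qed
      have linear: "\<exists>C>0. \<exists>\<delta>>0. \<forall>t>0. \<forall>l. 0 \<le> l \<and> l < m' \<longrightarrow>
            Linf_norm l (\<lambda>x. u t x - heat_semigroup t ?\<Phi> x) \<le> ennreal (C * t powr (-(\<sigma> - l) / 2 - \<delta>))"
          "\<exists>C>0. \<exists>T>0. \<forall>t\<ge>T. \<forall>l. 0 \<le> l \<and> l < m' \<longrightarrow>
            ennreal (inverse C * t powr (-(\<sigma> - l) / 2)) \<le> Linf_norm l (u t) \<and>
            Linf_norm l (u t) \<le> ennreal (C * t powr (-(\<sigma> - l) / 2))"
        if s\<sigma>: "\<sigma> > s"
      proof -
        obtain C \<eta> where C: "C > 0" "\<eta> > 0" "\<And>l. 0 \<le> l \<Longrightarrow> l \<le> \<sigma> \<Longrightarrow>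
            decays (\<sigma> + 2 * \<eta>) l C (\<lambda>t x. u t x - heat_semigroup t ?\<Phi> x)"
          using mild_solution_linear_decay[OF \<alpha> s_def p_def p0 p2 k(1) less_imp_le[OF ks(1)] kp s0 s\<sigma> \<sigma>(2)
              a1 mild M0(1) du Cu \<Phi>m zero_le_one \<Phi>b data(3)] by blast
        have ss: "AE x in lebesgue. c powr \<sigma> * heat_semigroup (c\<^sup>2) ?\<Phi> (c *\<^sub>R x) = heat_semigroup 1 ?\<Phi> x"
          if "c > 0" for c
        proof (rule AE_I2)
          fix x :: 'a
          have "c powr \<sigma> * c powr (-\<sigma>) = 1" using that by (simp flip: powr_add)
          thus "c powr \<sigma> * heat_semigroup (c\<^sup>2) ?\<Phi> (c *\<^sub>R x) = heat_semigroup 1 ?\<Phi> x"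
            using heat_semigroup_homogeneous[OF that zero_le_one \<Phi>m \<Phi>hom[OF that], of x]
            by (simp flip: mult.assoc)
        qed
        have nz: "\<not> (AE x in lebesgue. heat_semigroup 1 ?\<Phi> x = 0)"
        proof
          assume z1: "AE x in lebesgue. heat_semigroup 1 ?\<Phi> x = 0"
          have z: "AE x in lebesgue. heat_semigroup t ?\<Phi> x = 0" if t: "t > 0" for t
          proof -
            define c where "c = 1 / sqrt t"
            have c: "c > 0" "c\<^sup>2 * t = 1" using t by (auto simp: c_def power_divide)
            from AE_lebesgue_scale[OF c(1) z1] show ?thesis
            proof eventually_elim
              case (elim x)
              thus ?case using heat_semigroup_homogeneous[OF c(1) less_imp_le[OF t] \<Phi>m \<Phi>hom[OF c(1)], of x] c by simp
            qed
          qed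
          have "AE y in lebesgue. ?\<Phi> y = 0"
            by (rule heat_semigroup_injective[OF \<Phi>m less_imp_le[OF \<sigma>(3)] \<sigma>(2) zero_le_one \<Phi>b z])
          thus False using \<Phi>nz by blast
        qed
        have "\<forall>t>0. \<forall>l. 0 \<le> l \<and> l < m' \<longrightarrow>
            Linf_norm l (\<lambda>x. u t x - heat_semigroup t ?\<Phi> x) \<le> ennreal (C * t powr (-(\<sigma> - l) / 2 - \<eta>))"
        proof (intro allI impI)
          fix t l :: real assume t: "t > 0" and l: "0 \<le> l \<and> l < m'"
          have "(\<lambda>x. u t x - heat_semigroup t ?\<Phi> x) \<in> borel_measurable lebesgue"
            using um[OF t] heat_semigroup_measurable_lebesgue[OF \<Phi>m] by (rule borel_measurable_diff)
          thus "Linf_norm l (\<lambda>x. u t x - heat_semigroup t ?\<Phi> x) \<le> ennreal (C * t powr (-(\<sigma> - l) / 2 - \<eta>))"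
            unfolding exponent using l m\<sigma> t C(3)[of l]
            by (intro Linf_norm_le_of_decays[where w="\<lambda>t x. u t x - heat_semigroup t ?\<Phi> x"]) auto
        qed
        thus "\<exists>C>0. \<exists>\<delta>>0. \<forall>t>0. \<forall>l. 0 \<le> l \<and> l < m' \<longrightarrow>
            Linf_norm l (\<lambda>x. u t x - heat_semigroup t ?\<Phi> x) \<le> ennreal (C * t powr (-(\<sigma> - l) / 2 - \<delta>))"
          using C(1,2) by blast
        show "\<exists>C>0. \<exists>T>0. \<forall>t\<ge>T. \<forall>l. 0 \<le> l \<and> l < m' \<longrightarrow>
            ennreal (inverse C * t powr (-(\<sigma> - l) / 2)) \<le> Linf_norm l (u t) \<and>
            Linf_norm l (u t) \<le> ennreal (C * t powr (-(\<sigma> - l) / 2))"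
          by (rule Linf_norm_two_sided[OF ss nz less_imp_le[OF \<sigma>(3)] m\<sigma> um Cu C])
      qed
      show ?thesis
        by (intro conjI impI allI) (rule nonlinear linear; assumption)+
    qed
    \<comment> \<open>The smallness that drives the bootstrap is that of M, below both thresholds;
      the value 1 for the data is the bound on \<omega> used in \<open>\<Phi>b\<close>.\<close>
    show ?thesis
      by (rule exI[of _ "min M1 M2"], rule conjI, use M1(1) M2(1) in simp, intro allI impI,
        rule exI[of _ 1], rule conjI, rule zero_less_one, intro allI impI, elim conjE, rule concl)
  qed
  \<comment> \<open>\<open>main\<close> covers every admissible k below m, so any number below m can
    serve as the threshold for k.\<close>
  show ?thesis
    unfolding crit lin s_def[symmetric] m_def[symmetric] m'_def[symmetric]
    by (rule exI[of _ "m - 1"], rule conjI, simp, intro allI impI, elim conjE, rule main)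
qed

end
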